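(* Let $\Lambda$ be an Artin algebra. The exact category $\mathcal{P}(\Lambda)$ of morphisms between projective modules is $0$-Auslander.
   Context: $\mathrm{mod}\text{-}\Lambda$ is the category of finitely generated $\Lambda$-modules and $\mathrm{prj}\text{-}\Lambda$ its full subcategory of projective modules. $\mathcal{H}(\Lambda)$ is the morphism category of $\mathrm{mod}\text{-}\Lambda$: objects are morphisms $f:X\to Y$ in $\mathrm{mod}\text{-}\Lambda$, and a morphism from $(X\xrightarrow{f}Y)$ to $(X'\xrightarrow{f'}Y')$ is a pair $(\sigma_1,\sigma_2)$ with $\sigma_1:X\to X'$, $\sigma_2:Y\to Y'$ and $\sigma_2f=f'\sigma_1$. It is abelian, with exactness computed componentwise. $\mathcal{P}(\Lambda)$ is the full subcategory of $\mathcal{H}(\Lambda)$ of objects $(P\xrightarrow{f}Q)$ with $P,Q$ in $\mathrm{prj}\text{-}\Lambda$; it is extension-closed and is regarded as an exact category with the exact structure inherited from $\mathcal{H}(\Lambda)$ (conflations are the short exact sequences of $\mathcal{H}(\Lambda)$ with all terms in $\mathcal{P}(\Lambda)$). An exact category $\mathcal{E}$ is called $0$-Auslander if: (i) it has enough projectives; (ii) it is hereditary: for every $X\in\mathcal{E}$ there is a short exact sequence (conflation) $0\to P_1\to P_0\to X\to 0$ with $P_0,P_1$ projective; (iii) it has dominant dimension at least $1$: for every projective object $P$ there is a short exact sequence (conflation) $0\to P\to Q\to I\to 0$ with $I$ injective and $Q$ projective-injective. Projective and injective are understood relative to the exact structure. *)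

theory Defs
  imports "HOL-Algebra.Module" "HOL-Algebra.RingHom" "HOL-Library.Equipollence"
begin

section \<open>Exact categories\<close>

text \<open>
  Hom-sets carry their abelian group structure: \<open>HomG C X Y\<close> is the (multiplicatively written)
  group whose carrier is the set of morphisms from \<open>X\<close> to \<open>Y\<close>, whose \<open>mult\<close> is
  the sum and whose \<open>one\<close> is the zero morphism. Hom-sets need not be disjoint, so
  \<open>Cmp C X Y Z g f\<close> (the composite of \<open>f : X \<rightarrow> Y\<close> and \<open>g : Y \<rightarrow> Z\<close>)
  refers to the three objects explicitly. An element \<open>(A, i, B, d, C)\<close> of
  \<open>Confl\<close> is the conflation with inflation \<open>i : A \<rightarrow> B\<close> and deflation
  \<open>d : B \<rightarrow> C\<close>.
\<close>

record ('o, 'h) excat =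
  Ob :: "'o set"
  HomG :: "'o \<Rightarrow> 'o \<Rightarrow> 'h monoid"
  Idm :: "'o \<Rightarrow> 'h"
  Cmp :: "'o \<Rightarrow> 'o \<Rightarrow> 'o \<Rightarrow> 'h \<Rightarrow> 'h \<Rightarrow> 'h"
  Confl :: "('o \<times> 'h \<times> 'o \<times> 'h \<times> 'o) set"

abbreviation Hom :: "('o, 'h) excat \<Rightarrow> 'o \<Rightarrow> 'o \<Rightarrow> 'h set"
  where "Hom C X Y \<equiv> carrier (HomG C X Y)"

abbreviation Hzero :: "('o, 'h) excat \<Rightarrow> 'o \<Rightarrow> 'o \<Rightarrow> 'h"
  where "Hzero C X Y \<equiv> \<one>\<^bsub>HomG C X Y\<^esub>"

locale additive_category =
  fixes C :: "('o, 'h) excat"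
  assumes Idm_in: "X \<in> Ob C \<Longrightarrow> Idm C X \<in> Hom C X X"
    and Cmp_in: "\<lbrakk>X \<in> Ob C; Y \<in> Ob C; Z \<in> Ob C; f \<in> Hom C X Y; g \<in> Hom C Y Z\<rbrakk>
      \<Longrightarrow> Cmp C X Y Z g f \<in> Hom C X Z"
    and Cmp_Idm_right: "\<lbrakk>X \<in> Ob C; Y \<in> Ob C; f \<in> Hom C X Y\<rbrakk> \<Longrightarrow> Cmp C X X Y f (Idm C X) = f"
    and Cmp_Idm_left: "\<lbrakk>X \<in> Ob C; Y \<in> Ob C; f \<in> Hom C X Y\<rbrakk> \<Longrightarrow> Cmp C X Y Y (Idm C Y) f = f"
    and Cmp_assoc: "\<lbrakk>W \<in> Ob C; X \<in> Ob C; Y \<in> Ob C; Z \<in> Ob C;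
        f \<in> Hom C W X; g \<in> Hom C X Y; h \<in> Hom C Y Z\<rbrakk>
      \<Longrightarrow> Cmp C W Y Z h (Cmp C W X Y g f) = Cmp C W X Z (Cmp C X Y Z h g) f"
    and HomG_comm_group: "\<lbrakk>X \<in> Ob C; Y \<in> Ob C\<rbrakk> \<Longrightarrow> comm_group (HomG C X Y)"
    and Cmp_add_right: "\<lbrakk>X \<in> Ob C; Y \<in> Ob C; Z \<in> Ob C;
        f \<in> Hom C X Y; f' \<in> Hom C X Y; g \<in> Hom C Y Z\<rbrakk>
      \<Longrightarrow> Cmp C X Y Z g (f \<otimes>\<^bsub>HomG C X Y\<^esub> f')
        = Cmp C X Y Z g f \<otimes>\<^bsub>HomG C X Z\<^esub> Cmp C X Y Z g f'"
    and Cmp_add_left: "\<lbrakk>X \<in> Ob C; Y \<in> Ob C; Z \<in> Ob C;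
        f \<in> Hom C X Y; g \<in> Hom C Y Z; g' \<in> Hom C Y Z\<rbrakk>
      \<Longrightarrow> Cmp C X Y Z (g \<otimes>\<^bsub>HomG C Y Z\<^esub> g') f
        = Cmp C X Y Z g f \<otimes>\<^bsub>HomG C X Z\<^esub> Cmp C X Y Z g' f"
    and zero_object: "\<exists>Z \<in> Ob C. \<forall>X \<in> Ob C. (\<exists>!f. f \<in> Hom C X Z) \<and> (\<exists>!f. f \<in> Hom C Z X)"
    and biproducts: "\<lbrakk>X \<in> Ob C; Y \<in> Ob C\<rbrakk> \<Longrightarrow>
      \<exists>B \<in> Ob C. \<exists>i1 \<in> Hom C X B. \<exists>i2 \<in> Hom C Y B. \<exists>p1 \<in> Hom C B X. \<exists>p2 \<in> Hom C B Y.
        Cmp C X B X p1 i1 = Idm C X \<and> Cmp C Y B Y p2 i2 = Idm C Y \<and>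
        Cmp C Y B X p1 i2 = Hzero C Y X \<and> Cmp C X B Y p2 i1 = Hzero C X Y \<and>
        Cmp C B X B i1 p1 \<otimes>\<^bsub>HomG C B B\<^esub> Cmp C B Y B i2 p2 = Idm C B"

definition iso_in :: "('o, 'h) excat \<Rightarrow> 'o \<Rightarrow> 'o \<Rightarrow> 'h \<Rightarrow> bool"
  where "iso_in C X Y f \<longleftrightarrow> f \<in> Hom C X Y \<and>
    (\<exists>g \<in> Hom C Y X. Cmp C X Y X g f = Idm C X \<and> Cmp C Y X Y f g = Idm C Y)"

definition is_kernel :: "('o, 'h) excat \<Rightarrow> 'o \<Rightarrow> 'h \<Rightarrow> 'o \<Rightarrow> 'h \<Rightarrow> 'o \<Rightarrow> bool"
  where "is_kernel C X i Y d Z \<longleftrightarrow>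
    i \<in> Hom C X Y \<and> d \<in> Hom C Y Z \<and> Cmp C X Y Z d i = Hzero C X Z \<and>
    (\<forall>W \<in> Ob C. \<forall>f \<in> Hom C W Y. Cmp C W Y Z d f = Hzero C W Z \<longrightarrow>
      (\<exists>!g. g \<in> Hom C W X \<and> Cmp C W X Y i g = f))"

definition is_cokernel :: "('o, 'h) excat \<Rightarrow> 'o \<Rightarrow> 'h \<Rightarrow> 'o \<Rightarrow> 'h \<Rightarrow> 'o \<Rightarrow> bool"
  where "is_cokernel C X i Y d Z \<longleftrightarrow>
    i \<in> Hom C X Y \<and> d \<in> Hom C Y Z \<and> Cmp C X Y Z d i = Hzero C X Z \<and>
    (\<forall>W \<in> Ob C. \<forall>f \<in> Hom C Y W. Cmp C X Y W f i = Hzero C X W \<longrightarrow>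
      (\<exists>!g. g \<in> Hom C Z W \<and> Cmp C Y Z W g d = f))"

definition inflation :: "('o, 'h) excat \<Rightarrow> 'o \<Rightarrow> 'o \<Rightarrow> 'h \<Rightarrow> bool"
  where "inflation C X Y i \<longleftrightarrow> (\<exists>d Z. (X, i, Y, d, Z) \<in> Confl C)"

definition deflation :: "('o, 'h) excat \<Rightarrow> 'o \<Rightarrow> 'o \<Rightarrow> 'h \<Rightarrow> bool"
  where "deflation C Y Z d \<longleftrightarrow> (\<exists>X i. (X, i, Y, d, Z) \<in> Confl C)"

text \<open>
  \<open>is_pushout C X Y X' Y' i f f' i'\<close>: the square with \<open>i : X \<rightarrow> Y\<close>,
  \<open>f : X \<rightarrow> X'\<close>, \<open>f' : Y \<rightarrow> Y'\<close>, \<open>i' : X' \<rightarrow> Y'\<close> is cocartesian.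
  \<open>is_pullback C Y' Z' Y Z d' f' d f\<close>: the square with \<open>d' : Y' \<rightarrow> Z'\<close>,
  \<open>f' : Y' \<rightarrow> Y\<close>, \<open>d : Y \<rightarrow> Z\<close>, \<open>f : Z' \<rightarrow> Z\<close> is cartesian.
\<close>

definition is_pushout ::
    "('o, 'h) excat \<Rightarrow> 'o \<Rightarrow> 'o \<Rightarrow> 'o \<Rightarrow> 'o \<Rightarrow> 'h \<Rightarrow> 'h \<Rightarrow> 'h \<Rightarrow> 'h \<Rightarrow> bool"
  where "is_pushout C X Y X' Y' i f f' i' \<longleftrightarrow>
    i \<in> Hom C X Y \<and> f \<in> Hom C X X' \<and> f' \<in> Hom C Y Y' \<and> i' \<in> Hom C X' Y' \<and>
    Cmp C X Y Y' f' i = Cmp C X X' Y' i' f \<and>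
    (\<forall>W \<in> Ob C. \<forall>u \<in> Hom C Y W. \<forall>v \<in> Hom C X' W. Cmp C X Y W u i = Cmp C X X' W v f \<longrightarrow>
      (\<exists>!h. h \<in> Hom C Y' W \<and> Cmp C Y Y' W h f' = u \<and> Cmp C X' Y' W h i' = v))"

definition is_pullback ::
    "('o, 'h) excat \<Rightarrow> 'o \<Rightarrow> 'o \<Rightarrow> 'o \<Rightarrow> 'o \<Rightarrow> 'h \<Rightarrow> 'h \<Rightarrow> 'h \<Rightarrow> 'h \<Rightarrow> bool"
  where "is_pullback C Y' Z' Y Z d' f' d f \<longleftrightarrow>
    d' \<in> Hom C Y' Z' \<and> f' \<in> Hom C Y' Y \<and> d \<in> Hom C Y Z \<and> f \<in> Hom C Z' Z \<and>
    Cmp C Y' Y Z d f' = Cmp C Y' Z' Z f d' \<and>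
    (\<forall>W \<in> Ob C. \<forall>u \<in> Hom C W Y. \<forall>v \<in> Hom C W Z'. Cmp C W Y Z d u = Cmp C W Z' Z f v \<longrightarrow>
      (\<exists>!h. h \<in> Hom C W Y' \<and> Cmp C W Y' Y f' h = u \<and> Cmp C W Y' Z' d' h = v))"

text \<open>Quillen's axioms, in the form of Buehler's survey \<^emph>\<open>Exact categories\<close>.\<close>

locale exact_category = additive_category +
  assumes Confl_Ob: "(X, i, Y, d, Z) \<in> Confl C \<Longrightarrow> X \<in> Ob C \<and> Y \<in> Ob C \<and> Z \<in> Ob C"
    and Confl_kernel: "(X, i, Y, d, Z) \<in> Confl C \<Longrightarrow> is_kernel C X i Y d Z"
    and Confl_cokernel: "(X, i, Y, d, Z) \<in> Confl C \<Longrightarrow> is_cokernel C X i Y d Z"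
    and Confl_iso: "\<lbrakk>(X, i, Y, d, Z) \<in> Confl C; X' \<in> Ob C; Y' \<in> Ob C; Z' \<in> Ob C;
        iso_in C X X' a; iso_in C Y Y' b; iso_in C Z Z' c; i' \<in> Hom C X' Y'; d' \<in> Hom C Y' Z';
        Cmp C X Y Y' b i = Cmp C X X' Y' i' a; Cmp C Y Z Z' c d = Cmp C Y Y' Z' d' b\<rbrakk>
      \<Longrightarrow> (X', i', Y', d', Z') \<in> Confl C"
    and inflation_Idm: "X \<in> Ob C \<Longrightarrow> inflation C X X (Idm C X)"
    and deflation_Idm: "X \<in> Ob C \<Longrightarrow> deflation C X X (Idm C X)"
    and inflation_Cmp: "\<lbrakk>inflation C X Y i; inflation C Y Z j\<rbrakk> \<Longrightarrow> inflation C X Z (Cmp C X Y Z j i)"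
    and deflation_Cmp: "\<lbrakk>deflation C X Y d; deflation C Y Z e\<rbrakk> \<Longrightarrow> deflation C X Z (Cmp C X Y Z e d)"
    and inflation_pushout: "\<lbrakk>inflation C X Y i; X' \<in> Ob C; f \<in> Hom C X X'\<rbrakk> \<Longrightarrow>
      \<exists>Y' \<in> Ob C. \<exists>f' i'. is_pushout C X Y X' Y' i f f' i' \<and> inflation C X' Y' i'"
    and deflation_pullback: "\<lbrakk>deflation C Y Z d; Z' \<in> Ob C; f \<in> Hom C Z' Z\<rbrakk> \<Longrightarrow>
      \<exists>Y' \<in> Ob C. \<exists>f' d'. is_pullback C Y' Z' Y Z d' f' d f \<and> deflation C Y' Z' d'"

definition proj_obj :: "('o, 'h) excat \<Rightarrow> 'o \<Rightarrow> bool"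
  where "proj_obj C P \<longleftrightarrow> P \<in> Ob C \<and>
    (\<forall>Y Z d. deflation C Y Z d \<longrightarrow> (\<forall>f \<in> Hom C P Z. \<exists>g \<in> Hom C P Y. Cmp C P Y Z d g = f))"

definition inj_obj :: "('o, 'h) excat \<Rightarrow> 'o \<Rightarrow> bool"
  where "inj_obj C I \<longleftrightarrow> I \<in> Ob C \<and>
    (\<forall>X Y i. inflation C X Y i \<longrightarrow> (\<forall>f \<in> Hom C X I. \<exists>g \<in> Hom C Y I. Cmp C X Y I g i = f))"

definition enough_projectives :: "('o, 'h) excat \<Rightarrow> bool"
  where "enough_projectives C \<longleftrightarrow> (\<forall>X \<in> Ob C. \<exists>P d. proj_obj C P \<and> deflation C P X d)"

definition hereditary :: "('o, 'h) excat \<Rightarrow> bool"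
  where "hereditary C \<longleftrightarrow>
    (\<forall>X \<in> Ob C. \<exists>P1 i P0 d. proj_obj C P1 \<and> proj_obj C P0 \<and> (P1, i, P0, d, X) \<in> Confl C)"

definition dominant_dimension_ge_1 :: "('o, 'h) excat \<Rightarrow> bool"
  where "dominant_dimension_ge_1 C \<longleftrightarrow>
    (\<forall>P. proj_obj C P \<longrightarrow>
      (\<exists>i Q d I. proj_obj C Q \<and> inj_obj C Q \<and> inj_obj C I \<and> (P, i, Q, d, I) \<in> Confl C))"

definition zero_auslander :: "('o, 'h) excat \<Rightarrow> bool"
  where "zero_auslander C \<longleftrightarrow>
    exact_category C \<and> enough_projectives C \<and> hereditary C \<and> dominant_dimension_ge_1 C"

text \<open>A full subcategory, with the conflations all of whose terms lie in it.\<close>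

definition full_exact_subcategory :: "('o, 'h) excat \<Rightarrow> 'o set \<Rightarrow> ('o, 'h) excat"
  where "full_exact_subcategory C S =
    C\<lparr>Ob := Ob C \<inter> S,
      Confl := {(X, i, Y, d, Z) \<in> Confl C. X \<in> S \<and> Y \<in> S \<and> Z \<in> S}\<rparr>"


section \<open>Modules over a not necessarily commutative ring\<close>

text \<open>
  Left unital modules. The library locale \<^locale>\<open>module\<close> has the same axioms but requires the
  ring to be commutative. Of the record \<^type>\<open>module\<close>, the fields \<open>mult\<close> and \<open>one\<close>
  play no role here.
\<close>

locale left_module = R?: ring R + M?: abelian_group M
  for R :: "('a, 'c) ring_scheme" (structure) and M :: "('a, 'b) module" (structure) +
  assumes smult_closed: "\<lbrakk>a \<in> carrier R; x \<in> carrier M\<rbrakk> \<Longrightarrow> a \<odot>\<^bsub>M\<^esub> x \<in> carrier M"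
    and smult_l_distr: "\<lbrakk>a \<in> carrier R; b \<in> carrier R; x \<in> carrier M\<rbrakk>
      \<Longrightarrow> (a \<oplus>\<^bsub>R\<^esub> b) \<odot>\<^bsub>M\<^esub> x = a \<odot>\<^bsub>M\<^esub> x \<oplus>\<^bsub>M\<^esub> b \<odot>\<^bsub>M\<^esub> x"
    and smult_r_distr: "\<lbrakk>a \<in> carrier R; x \<in> carrier M; y \<in> carrier M\<rbrakk>
      \<Longrightarrow> a \<odot>\<^bsub>M\<^esub> (x \<oplus>\<^bsub>M\<^esub> y) = a \<odot>\<^bsub>M\<^esub> x \<oplus>\<^bsub>M\<^esub> a \<odot>\<^bsub>M\<^esub> y"
    and smult_assoc: "\<lbrakk>a \<in> carrier R; b \<in> carrier R; x \<in> carrier M\<rbrakk>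
      \<Longrightarrow> (a \<otimes>\<^bsub>R\<^esub> b) \<odot>\<^bsub>M\<^esub> x = a \<odot>\<^bsub>M\<^esub> (b \<odot>\<^bsub>M\<^esub> x)"
    and smult_one: "x \<in> carrier M \<Longrightarrow> \<one>\<^bsub>R\<^esub> \<odot>\<^bsub>M\<^esub> x = x"

definition fg_left_module :: "('a, 'c) ring_scheme \<Rightarrow> ('a, 'b) module \<Rightarrow> bool"
  where "fg_left_module R M \<longleftrightarrow> left_module R M \<and>
    (\<exists>S. finite S \<and> S \<subseteq> carrier M \<and>
      (\<forall>x \<in> carrier M. \<exists>c \<in> S \<rightarrow> carrier R. x = (\<Oplus>\<^bsub>M\<^esub>s\<in>S. c s \<odot>\<^bsub>M\<^esub> s)))"

text \<open>Homomorphisms are extensional, so that equal morphisms are equal functions.\<close>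

definition lmod_hom ::
    "('a, 'c) ring_scheme \<Rightarrow> ('a, 'b) module \<Rightarrow> ('a, 'd) module \<Rightarrow> ('b \<Rightarrow> 'd) set"
  where "lmod_hom R M N = {f \<in> carrier M \<rightarrow>\<^sub>E carrier N.
    (\<forall>x \<in> carrier M. \<forall>y \<in> carrier M. f (x \<oplus>\<^bsub>M\<^esub> y) = f x \<oplus>\<^bsub>N\<^esub> f y) \<and>
    (\<forall>a \<in> carrier R. \<forall>x \<in> carrier M. f (a \<odot>\<^bsub>M\<^esub> x) = a \<odot>\<^bsub>N\<^esub> f x)}"

definition lmod_add :: "('a, 'b) module \<Rightarrow> ('a, 'd) module \<Rightarrow> ('b \<Rightarrow> 'd) \<Rightarrow> ('b \<Rightarrow> 'd) \<Rightarrow> 'b \<Rightarrow> 'd"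
  where "lmod_add M N f g = (\<lambda>x \<in> carrier M. f x \<oplus>\<^bsub>N\<^esub> g x)"

definition lmod_zero :: "('a, 'b) module \<Rightarrow> ('a, 'd) module \<Rightarrow> 'b \<Rightarrow> 'd"
  where "lmod_zero M N = (\<lambda>x \<in> carrier M. \<zero>\<^bsub>N\<^esub>)"

definition lmod_short_exact ::
    "('a, 'b) module \<Rightarrow> ('b \<Rightarrow> 'b) \<Rightarrow> ('a, 'b) module \<Rightarrow> ('b \<Rightarrow> 'b) \<Rightarrow> ('a, 'b) module \<Rightarrow> bool"
  where "lmod_short_exact K i M p N \<longleftrightarrow>
    inj_on i (carrier K) \<and> i ` carrier K = {x \<in> carrier M. p x = \<zero>\<^bsub>N\<^esub>} \<and>
    p ` carrier M = carrier N"

text \<open>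
  The modules tested against range over the modules with underlying set in the type \<open>'b\<close>.
  For finitely generated \<open>P\<close> this is the usual notion as soon as every finitely generated module
  has an isomorphic copy there (see lemma \<open>fg_left_module_copy\<close> below): lifting the identity
  of \<open>P\<close> along an epimorphism from a free module of finite rank exhibits \<open>P\<close> as a direct
  summand of that module.
\<close>

definition projective_left_module :: "('a, 'c) ring_scheme \<Rightarrow> ('a, 'b) module \<Rightarrow> bool"
  where "projective_left_module R P \<longleftrightarrow> left_module R P \<and>
    (\<forall>(M :: ('a, 'b) module) (N :: ('a, 'b) module). \<forall>p f. left_module R M \<and> left_module R N \<and>
      p \<in> lmod_hom R M N \<and> p ` carrier M = carrier N \<and> f \<in> lmod_hom R P N \<longrightarrow>
      (\<exists>g \<in> lmod_hom R P M. compose (carrier P) p g = f))"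


section \<open>Artin algebras\<close>

definition artinian_ring :: "('r, 'c) ring_scheme \<Rightarrow> bool"
  where "artinian_ring R \<longleftrightarrow> cring R \<and>
    (\<forall>I :: nat \<Rightarrow> 'r set. (\<forall>n. ideal (I n) R \<and> I (Suc n) \<subseteq> I n) \<longrightarrow>
      (\<exists>n. \<forall>m \<ge> n. I m = I n))"

text \<open>The ring \<open>L\<close> regarded as a module over \<open>R\<close> along \<open>\<phi>\<close>.\<close>

definition scalar_module :: "('a, 'c) ring_scheme \<Rightarrow> ('r \<Rightarrow> 'a) \<Rightarrow> ('r, 'a) module"
  where "scalar_module L \<phi> =
    \<lparr>carrier = carrier L, mult = mult L, one = one L, zero = zero L, add = add L,
     smult = (\<lambda>r x. \<phi> r \<otimes>\<^bsub>L\<^esub> x)\<rparr>"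

definition artin_algebra ::
    "('r, 'c) ring_scheme \<Rightarrow> ('a, 'd) ring_scheme \<Rightarrow> ('r \<Rightarrow> 'a) \<Rightarrow> bool"
  where "artin_algebra R L \<phi> \<longleftrightarrow> artinian_ring R \<and> ring L \<and> \<phi> \<in> ring_hom R L \<and>
    (\<forall>r \<in> carrier R. \<forall>x \<in> carrier L. \<phi> r \<otimes>\<^bsub>L\<^esub> x = x \<otimes>\<^bsub>L\<^esub> \<phi> r) \<and>
    fg_left_module R (scalar_module L \<phi>)"


section \<open>The morphism category and its subcategory of morphisms between projectives\<close>

record ('a, 'b) arrow =
  src :: "('a, 'b) module"
  tgt :: "('a, 'b) module"
  arr :: "'b \<Rightarrow> 'b"

definition morphism_objects :: "('a, 'c) ring_scheme \<Rightarrow> ('a, 'b) arrow set"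
  where "morphism_objects L = {X. fg_left_module L (src X) \<and> fg_left_module L (tgt X) \<and>
    arr X \<in> lmod_hom L (src X) (tgt X)}"

definition morphism_homs ::
    "('a, 'c) ring_scheme \<Rightarrow> ('a, 'b) arrow \<Rightarrow> ('a, 'b) arrow \<Rightarrow> (('b \<Rightarrow> 'b) \<times> ('b \<Rightarrow> 'b)) set"
  where "morphism_homs L X Y = {(s1, s2). s1 \<in> lmod_hom L (src X) (src Y) \<and>
    s2 \<in> lmod_hom L (tgt X) (tgt Y) \<and>
    compose (carrier (src X)) s2 (arr X) = compose (carrier (src X)) (arr Y) s1}"

definition morphism_category ::
    "('a, 'c) ring_scheme \<Rightarrow> (('a, 'b) arrow, ('b \<Rightarrow> 'b) \<times> ('b \<Rightarrow> 'b)) excat"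
  where "morphism_category L =
    \<lparr>Ob = morphism_objects L,
     HomG = (\<lambda>X Y. \<lparr>carrier = morphism_homs L X Y,
       mult = (\<lambda>(s1, s2) (t1, t2).
         (lmod_add (src X) (src Y) s1 t1, lmod_add (tgt X) (tgt Y) s2 t2)),
       one = (lmod_zero (src X) (src Y), lmod_zero (tgt X) (tgt Y))\<rparr>),
     Idm = (\<lambda>X. (\<lambda>x \<in> carrier (src X). x, \<lambda>x \<in> carrier (tgt X). x)),
     Cmp = (\<lambda>X Y Z (t1, t2) (s1, s2).
       (compose (carrier (src X)) t1 s1, compose (carrier (tgt X)) t2 s2)),
     Confl = {(X, i, Y, d, Z). X \<in> morphism_objects L \<and> Y \<in> morphism_objects L \<and>
       Z \<in> morphism_objects L \<and> i \<in> morphism_homs L X Y \<and> d \<in> morphism_homs L Y Z \<and>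
       lmod_short_exact (src X) (fst i) (src Y) (fst d) (src Z) \<and>
       lmod_short_exact (tgt X) (snd i) (tgt Y) (snd d) (tgt Z)}\<rparr>"

definition proj_morphism_category ::
    "('a, 'c) ring_scheme \<Rightarrow> (('a, 'b) arrow, ('b \<Rightarrow> 'b) \<times> ('b \<Rightarrow> 'b)) excat"
  where "proj_morphism_category L = full_exact_subcategory (morphism_category L)
    {X. projective_left_module L (src X) \<and> projective_left_module L (tgt X)}"


section \<open>Size of the universe of modules\<close>

text \<open>
  The modules considered have their underlying sets in a type \<open>'b\<close>. If this type is infinite
  and at least as large as the ring, then every finitely generated module, with underlying set in
  whatever type, is isomorphic to one of them.
\<close>

lemma lepoll_PiE_universe:
  assumes "infinite (UNIV :: 'b set)" "A \<lesssim> (UNIV :: 'b set)" "finite S"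
  shows "(S \<rightarrow>\<^sub>E A) \<lesssim> (UNIV :: 'b set)"
  using assms(3)
proof (induction S)
  case empty
  show ?case by (simp add: lepoll_def)
next
  case (insert s S)
  have "(insert s S \<rightarrow>\<^sub>E A) \<lesssim> A \<times> (S \<rightarrow>\<^sub>E A)"
    by (simp add: PiE_insert_eq image_lepoll)
  also have "\<dots> \<lesssim> (UNIV :: 'b set) \<times> (UNIV :: 'b set)"
    by (rule times_lepoll_mono[OF assms(2) insert.IH])
  also have "\<dots> \<lesssim> (UNIV :: 'b set)"
    using card_of_Times_same_infinite[OF assms(1)] unfolding lepoll_def
    by (metis card_of_ordLeq ordIso_iff_ordLeq subset_UNIV)
  finally show ?case .
qed

lemma fg_left_module_lepoll:
  fixes L :: "('a, 'c) ring_scheme" and N :: "('a, 'n) module"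
  assumes "infinite (UNIV :: 'b set)" "carrier L \<lesssim> (UNIV :: 'b set)" "fg_left_module L N"
  shows "carrier N \<lesssim> (UNIV :: 'b set)"
proof -
  interpret left_module L N using assms(3) by (simp add: fg_left_module_def)
  obtain S where S: "finite S" "S \<subseteq> carrier N"
    "\<And>x. x \<in> carrier N \<Longrightarrow> \<exists>c \<in> S \<rightarrow> carrier L. x = (\<Oplus>\<^bsub>N\<^esub>s\<in>S. c s \<odot>\<^bsub>N\<^esub> s)"
    using assms(3) by (auto simp: fg_left_module_def)
  have "carrier N \<subseteq> (\<lambda>c. \<Oplus>\<^bsub>N\<^esub>s\<in>S. c s \<odot>\<^bsub>N\<^esub> s) ` (S \<rightarrow>\<^sub>E carrier L)"
  proof
    fix x assume "x \<in> carrier N"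
    then obtain c where c: "c \<in> S \<rightarrow> carrier L" "x = (\<Oplus>\<^bsub>N\<^esub>s\<in>S. c s \<odot>\<^bsub>N\<^esub> s)"
      using S(3) by blast
    have "x = (\<Oplus>\<^bsub>N\<^esub>s\<in>S. restrict c S s \<odot>\<^bsub>N\<^esub> s)"
      unfolding c(2) using c(1) S(2) by (intro M.finsum_cong') (auto intro!: smult_closed)
    then show "x \<in> (\<lambda>c. \<Oplus>\<^bsub>N\<^esub>s\<in>S. c s \<odot>\<^bsub>N\<^esub> s) ` (S \<rightarrow>\<^sub>E carrier L)"
      using c(1) by (intro image_eqI[where x = "restrict c S"]) auto
  qed
  then have "carrier N \<lesssim> (S \<rightarrow>\<^sub>E carrier L)" by (rule subset_image_lepoll)
  also have "\<dots> \<lesssim> (UNIV :: 'b set)" by (rule lepoll_PiE_universe[OF assms(1,2) S(1)])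
  finally show ?thesis .
qed

lemma fg_left_module_copy:
  fixes L :: "('a, 'c) ring_scheme" and N :: "('a, 'n) module"
  assumes "infinite (UNIV :: 'b set)" "carrier L \<lesssim> (UNIV :: 'b set)" "fg_left_module L N"
  shows "\<exists>M :: ('a, 'b) module. fg_left_module L M \<and>
    (\<exists>f \<in> lmod_hom L N M. bij_betw f (carrier N) (carrier M))"
proof -
  interpret N: left_module L N using assms(3) by (simp add: fg_left_module_def)
  obtain h :: "'n \<Rightarrow> 'b" where h: "inj_on h (carrier N)"
    using fg_left_module_lepoll[OF assms] by (auto simp: lepoll_def)
  define g where "g = the_inv_into (carrier N) h"
  have gh [simp]: "g (h x) = x" if "x \<in> carrier N" for x
    using that h by (simp add: g_def the_inv_into_f_f)
  define M :: "('a, 'b) module" where "M = \<lparr>carrier = h ` carrier N, mult = undefined,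
    one = undefined, zero = h \<zero>\<^bsub>N\<^esub>, add = (\<lambda>x y. h (g x \<oplus>\<^bsub>N\<^esub> g y)),
    smult = (\<lambda>a x. h (a \<odot>\<^bsub>N\<^esub> g x))\<rparr>"
  have M: "carrier M = h ` carrier N" "\<zero>\<^bsub>M\<^esub> = h \<zero>\<^bsub>N\<^esub>"
    "\<And>x y. x \<oplus>\<^bsub>M\<^esub> y = h (g x \<oplus>\<^bsub>N\<^esub> g y)" "\<And>a x. a \<odot>\<^bsub>M\<^esub> x = h (a \<odot>\<^bsub>N\<^esub> g x)"
    by (simp_all add: M_def)
  have ag: "abelian_group M"
  proof (rule abelian_groupI)
    fix x assume "x \<in> carrier M"
    then obtain u where u: "u \<in> carrier N" "x = h u" by (auto simp: M)
    show "\<exists>y\<in>carrier M. y \<oplus>\<^bsub>M\<^esub> x = \<zero>\<^bsub>M\<^esub>"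
      by (rule bexI[of _ "h (\<ominus>\<^bsub>N\<^esub> u)"]) (use u in \<open>auto simp: M N.M.l_neg\<close>)
  qed (auto simp: M N.M.a_ac)
  interpret M: abelian_group M by (rule ag)
  have lm: "left_module L M"
    by (intro left_module.intro left_module_axioms.intro N.R.ring_axioms ag)
      (auto simp: M N.smult_closed N.smult_l_distr N.smult_r_distr N.smult_assoc N.smult_one)
  define f where "f = restrict h (carrier N)"
  have hom: "f \<in> lmod_hom L N M"
    by (auto simp: lmod_hom_def f_def M N.smult_closed)
  obtain S where S: "finite S" "S \<subseteq> carrier N"
    "\<And>x. x \<in> carrier N \<Longrightarrow> \<exists>c \<in> S \<rightarrow> carrier L. x = (\<Oplus>\<^bsub>N\<^esub>s\<in>S. c s \<odot>\<^bsub>N\<^esub> s)"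
    using assms(3) by (auto simp: fg_left_module_def)
  have hS: "inj_on h S" using h S(2) by (rule inj_on_subset)
  have sum: "h (\<Oplus>\<^bsub>N\<^esub>s\<in>T. c s \<odot>\<^bsub>N\<^esub> s) = (\<Oplus>\<^bsub>M\<^esub>t\<in>h ` T. c (g t) \<odot>\<^bsub>M\<^esub> t)"
    if "finite T" "T \<subseteq> carrier N" "c \<in> T \<rightarrow> carrier L" for T c
    using that
  proof (induction T)
    case empty
    show ?case by (simp add: M)
  next
    case (insert s T)
    have c: "c s \<in> carrier L" "s \<in> carrier N" "c \<in> T \<rightarrow> carrier L" "T \<subseteq> carrier N"
      using insert.prems by auto
    have inN: "(\<lambda>s. c s \<odot>\<^bsub>N\<^esub> s) \<in> T \<rightarrow> carrier N"
      using c(3,4) by (auto intro!: N.smult_closed)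
    have inM: "(\<lambda>t. c (g t) \<odot>\<^bsub>M\<^esub> t) \<in> h ` T \<rightarrow> carrier M"
      using inN c(4) by (auto simp: M subset_iff)
    have ns: "h s \<notin> h ` T"
      using insert.hyps(2) c(2,4) h by (metis inj_on_image_mem_iff)
    have "h (\<Oplus>\<^bsub>N\<^esub>s\<in>insert s T. c s \<odot>\<^bsub>N\<^esub> s) = h (c s \<odot>\<^bsub>N\<^esub> s \<oplus>\<^bsub>N\<^esub> (\<Oplus>\<^bsub>N\<^esub>s\<in>T. c s \<odot>\<^bsub>N\<^esub> s))"
      using insert.hyps inN c(1,2) by (simp add: N.smult_closed)
    also have "\<dots> = h (c s \<odot>\<^bsub>N\<^esub> s) \<oplus>\<^bsub>M\<^esub> h (\<Oplus>\<^bsub>N\<^esub>s\<in>T. c s \<odot>\<^bsub>N\<^esub> s)"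
      using c(1,2) inN by (simp add: M(3) N.smult_closed)
    also have "\<dots> = (\<Oplus>\<^bsub>M\<^esub>t\<in>insert (h s) (h ` T). c (g t) \<odot>\<^bsub>M\<^esub> t)"
      using insert.hyps(1) ns inM c insert.IH[OF c(4,3)]
      by (subst M.finsum_insert) (auto simp: M(1,4) N.smult_closed)
    finally show ?case by simp
  qed
  have "\<exists>c \<in> h ` S \<rightarrow> carrier L. x = (\<Oplus>\<^bsub>M\<^esub>t\<in>h ` S. c t \<odot>\<^bsub>M\<^esub> t)" if x: "x \<in> carrier M" for x
  proof -
    obtain u where u: "u \<in> carrier N" "x = h u" using x by (auto simp: M)
    obtain c where c: "c \<in> S \<rightarrow> carrier L" "u = (\<Oplus>\<^bsub>N\<^esub>s\<in>S. c s \<odot>\<^bsub>N\<^esub> s)" using S(3) u(1) by blast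
    show ?thesis
      by (rule bexI[of _ "\<lambda>t. c (g t)"]) (use sum[OF S(1,2) c(1)] u c S(2) in \<open>auto simp: subset_iff\<close>)
  qed
  then have "fg_left_module L M"
    unfolding fg_left_module_def using lm S(1,2)
    by (intro conjI exI[of _ "h ` S"]) (auto simp: M)
  moreover have "bij_betw f (carrier N) (carrier M)"
    using h by (auto simp: f_def M bij_betw_def inj_on_restrict_eq)
  ultimately show ?thesis using hom by blast
qed

end

theory Submission
  imports Defs
begin

text \<open>
  The third term of a conflation has projective components, so conflations split componentwise:
  a morphism is a deflation iff both components are surjective, and an inflation iff both components
  are split mono. Pushouts and pullbacks are therefore cokernels and kernels of componentwise split
  maps out of, respectively into, a direct sum, and all of them can be realised as kernels of
  retractions or of surjections; no quotient modules are needed.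

  By a direct correction of componentwise lifts and extensions, \<open>f : P \<rightarrow> Q\<close> is projective if \<open>f\<close> is
  split mono and injective if \<open>f\<close> is split epi. Every \<open>f : P \<rightarrow> Q\<close> is covered by the split mono
  \<open>P \<rightarrow> P \<oplus> Q\<close> via \<open>(id, (f, id))\<close>, with kernel of the form \<open>0 \<rightarrow> K\<close>; this cover splits when \<open>f\<close> is
  projective, so projective objects are split mono. Finally a split mono \<open>f : P \<rightarrow> Q\<close> embeds via
  \<open>(f, id)\<close> into the projective-injective \<open>Q = Q\<close>, with cokernel of the form \<open>C \<rightarrow> 0\<close>.
\<close>

section \<open>Left modules\<close>

text \<open>Lifts of the two components of a morphism out of \<open>f : P \<rightarrow> Q\<close>
  along a deflation are found independently and need not form a commuting square. The defect of the
  square is killed by the deflation, because the morphism being lifted does commute. A retraction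
  \<open>r\<close> of \<open>f\<close> extends the defect over \<open>Q\<close>, and adding this
  extension to the target component repairs the square without disturbing the lift. Injectivity
  mirrors this: the defect of an extension is pulled through a section of the arrow and added to the
  source component.

  The retractions of an inflation also need not commute with the arrows: conflations split in each
  component but in general not in the morphism category. A cokernel is still carried by the kernels
  of the retractions, but its arrow has to be followed by a projection.

  Projectivity is tested against modules with carrier in \<open>'b\<close>, so every auxiliary
  module must live on \<open>'b\<close> as well. Kernels are subsets of the ambient carrier, and a
  direct sum needs its pairs coded back into \<open>'b\<close>.\<close>

lemma left_module_fg: "fg_left_module L M \<Longrightarrow> left_module L M"
  by (simp add: fg_left_module_def)

lemma lmod_hom_closed: "\<lbrakk>f \<in> lmod_hom L M N; x \<in> carrier M\<rbrakk> \<Longrightarrow> f x \<in> carrier N"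
  by (auto simp: lmod_hom_def)

lemma lmod_hom_add:
  "\<lbrakk>f \<in> lmod_hom L M N; x \<in> carrier M; y \<in> carrier M\<rbrakk> \<Longrightarrow> f (x \<oplus>\<^bsub>M\<^esub> y) = f x \<oplus>\<^bsub>N\<^esub> f y"
  by (auto simp: lmod_hom_def)

lemma lmod_hom_smult:
  "\<lbrakk>f \<in> lmod_hom L M N; a \<in> carrier L; x \<in> carrier M\<rbrakk> \<Longrightarrow> f (a \<odot>\<^bsub>M\<^esub> x) = a \<odot>\<^bsub>N\<^esub> f x"
  by (auto simp: lmod_hom_def)

lemma lmod_hom_eqI:
  "\<lbrakk>f \<in> lmod_hom L M N; g \<in> lmod_hom L M N; \<And>x. x \<in> carrier M \<Longrightarrow> f x = g x\<rbrakk> \<Longrightarrow> f = g"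
  by (auto simp: lmod_hom_def intro: PiE_ext)

context abelian_group
begin

lemma diff_eq_zero_iff: "\<lbrakk>x \<in> carrier G; y \<in> carrier G\<rbrakk> \<Longrightarrow> x \<ominus> y = \<zero> \<longleftrightarrow> x = y"
  by (metis a_minus_def add.inv_solve_right' l_zero a_inv_closed minus_minus minus_unique r_neg)

lemma diff_self: "x \<in> carrier G \<Longrightarrow> x \<ominus> x = \<zero>"
  by (simp add: diff_eq_zero_iff)

lemma diff_zero: "x \<in> carrier G \<Longrightarrow> x \<ominus> \<zero> = x"
  by (simp add: a_minus_def)

lemma add_diff_cancel: "\<lbrakk>x \<in> carrier G; y \<in> carrier G\<rbrakk> \<Longrightarrow> x \<oplus> (y \<ominus> x) = y"
  by (metis a_minus_def a_inv_closed a_comm a_assoc l_neg r_zero)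

end

context left_module
begin

lemma smult_zero_right: "a \<in> carrier R \<Longrightarrow> a \<odot>\<^bsub>M\<^esub> \<zero>\<^bsub>M\<^esub> = \<zero>\<^bsub>M\<^esub>"
  using smult_r_distr[of a "\<zero>\<^bsub>M\<^esub>" "\<zero>\<^bsub>M\<^esub>"] smult_closed[of a "\<zero>\<^bsub>M\<^esub>"]
  by (simp add: M.add.l_cancel_one)

lemma smult_zero_left: "x \<in> carrier M \<Longrightarrow> \<zero>\<^bsub>R\<^esub> \<odot>\<^bsub>M\<^esub> x = \<zero>\<^bsub>M\<^esub>"
  using smult_l_distr[of "\<zero>\<^bsub>R\<^esub>" "\<zero>\<^bsub>R\<^esub>" x] smult_closed[of "\<zero>\<^bsub>R\<^esub>" x]
  by (simp add: M.add.l_cancel_one)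

lemma smult_minus: "\<lbrakk>a \<in> carrier R; x \<in> carrier M\<rbrakk> \<Longrightarrow> a \<odot>\<^bsub>M\<^esub> (\<ominus>\<^bsub>M\<^esub> x) = \<ominus>\<^bsub>M\<^esub> (a \<odot>\<^bsub>M\<^esub> x)"
  using smult_r_distr[of a "\<ominus>\<^bsub>M\<^esub> x" x] smult_closed
  by (simp add: smult_zero_right M.l_neg M.minus_equality)

lemma minus_eq_smult: "x \<in> carrier M \<Longrightarrow> \<ominus>\<^bsub>M\<^esub> x = (\<ominus>\<^bsub>R\<^esub> \<one>\<^bsub>R\<^esub>) \<odot>\<^bsub>M\<^esub> x"
  using smult_l_distr[of "\<ominus>\<^bsub>R\<^esub> \<one>\<^bsub>R\<^esub>" "\<one>\<^bsub>R\<^esub>" x] smult_closed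
  by (simp add: smult_zero_left R.l_neg M.minus_equality smult_one)

text \<open>Closure under negation follows from closure under scalars, by multiplying with -1; this
  is why only zero, sums and scalars appear as conditions on \<open>H\<close>.\<close>

lemma left_module_subset:
  assumes "H \<subseteq> carrier M" "\<zero>\<^bsub>M\<^esub> \<in> H" "\<And>x y. \<lbrakk>x \<in> H; y \<in> H\<rbrakk> \<Longrightarrow> x \<oplus>\<^bsub>M\<^esub> y \<in> H"
    "\<And>a x. \<lbrakk>a \<in> carrier R; x \<in> H\<rbrakk> \<Longrightarrow> a \<odot>\<^bsub>M\<^esub> x \<in> H"
  shows "left_module R (M\<lparr>carrier := H\<rparr>)"
proof -
  have inM: "x \<in> carrier M" if "x \<in> H" for x using that assms(1) by auto
  have "abelian_group (M\<lparr>carrier := H\<rparr>)"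
  proof (rule abelian_groupI)
    fix x assume "x \<in> carrier (M\<lparr>carrier := H\<rparr>)"
    then have x: "x \<in> H" by simp
    have "\<ominus>\<^bsub>M\<^esub> x \<in> H" using x inM assms(4)[of "\<ominus>\<^bsub>R\<^esub> \<one>\<^bsub>R\<^esub>" x] by (simp add: minus_eq_smult)
    then show "\<exists>y\<in>carrier (M\<lparr>carrier := H\<rparr>). y \<oplus>\<^bsub>M\<lparr>carrier := H\<rparr>\<^esub> x = \<zero>\<^bsub>M\<lparr>carrier := H\<rparr>\<^esub>"
      using x inM by (auto simp: M.l_neg intro!: bexI[of _ "\<ominus>\<^bsub>M\<^esub> x"])
  qed (use assms in \<open>auto simp: inM intro: M.a_assoc M.a_comm\<close>)
  then show ?thesis
    by (intro left_module.intro left_module_axioms.intro R.ring_axioms)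
      (auto simp: inM assms smult_l_distr smult_r_distr smult_assoc smult_one)
qed

end

text \<open>The finite linear combinations of \<open>S\<close> form the least subset that contains
  \<open>S\<close> and is closed under zero, sums and scalars. In this form generation passes along
  homomorphisms by taking preimages of a closed set, with no bookkeeping for generators whose images
  coincide.\<close>

lemma fg_left_module_iff_closure:
  "fg_left_module L M \<longleftrightarrow> left_module L M \<and> (\<exists>S. finite S \<and> S \<subseteq> carrier M \<and>
    (\<forall>H. S \<subseteq> H \<and> H \<subseteq> carrier M \<and> \<zero>\<^bsub>M\<^esub> \<in> H \<and> (\<forall>x\<in>H. \<forall>y\<in>H. x \<oplus>\<^bsub>M\<^esub> y \<in> H) \<and>
      (\<forall>a\<in>carrier L. \<forall>x\<in>H. a \<odot>\<^bsub>M\<^esub> x \<in> H) \<longrightarrow> carrier M \<subseteq> H))"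
    (is "_ \<longleftrightarrow> _ \<and> (\<exists>S. finite S \<and> S \<subseteq> carrier M \<and> (\<forall>H. ?closed S H \<longrightarrow> _))")
proof (intro iffI conjI)
  assume fg: "fg_left_module L M"
  then show "left_module L M" by (rule left_module_fg)
  interpret left_module L M using fg by (rule left_module_fg)
  obtain S where S: "finite S" "S \<subseteq> carrier M"
    "\<And>x. x \<in> carrier M \<Longrightarrow> \<exists>c \<in> S \<rightarrow> carrier L. x = (\<Oplus>\<^bsub>M\<^esub>s\<in>S. c s \<odot>\<^bsub>M\<^esub> s)"
    using fg by (auto simp: fg_left_module_def)
  have "carrier M \<subseteq> H" if H: "?closed S H" for H
  proof
    fix x assume "x \<in> carrier M"
    then obtain c where c: "c \<in> S \<rightarrow> carrier L" "x = (\<Oplus>\<^bsub>M\<^esub>s\<in>S. c s \<odot>\<^bsub>M\<^esub> s)"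
      using S(3) by blast
    have "(\<Oplus>\<^bsub>M\<^esub>s\<in>T. c s \<odot>\<^bsub>M\<^esub> s) \<in> H" if "finite T" "T \<subseteq> S" for T
      using that
    proof (induction T)
      case (insert s T)
      then have "c s \<odot>\<^bsub>M\<^esub> s \<in> H" using c(1) H by blast
      moreover have "(\<lambda>s. c s \<odot>\<^bsub>M\<^esub> s) \<in> T \<rightarrow> carrier M" "c s \<odot>\<^bsub>M\<^esub> s \<in> carrier M"
        using insert.prems c(1) S(2) by (auto intro!: smult_closed)
      ultimately show ?case using insert H by simp
    qed (use H in simp)
    then show "x \<in> H" using c(2) S(1) by simp
  qed
  then show "\<exists>S. finite S \<and> S \<subseteq> carrier M \<and> (\<forall>H. ?closed S H \<longrightarrow> carrier M \<subseteq> H)"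
    using S(1,2) by blast
next
  assume *: "left_module L M \<and> (\<exists>S. finite S \<and> S \<subseteq> carrier M \<and> (\<forall>H. ?closed S H \<longrightarrow> carrier M \<subseteq> H))"
  then interpret left_module L M by simp
  obtain S where S: "finite S" "S \<subseteq> carrier M" "\<And>H. ?closed S H \<Longrightarrow> carrier M \<subseteq> H"
    using * by blast
  define lc where "lc = (\<lambda>c. \<Oplus>\<^bsub>M\<^esub>s\<in>S. c s \<odot>\<^bsub>M\<^esub> s)"
  have cl: "(\<lambda>s. c s \<odot>\<^bsub>M\<^esub> s) \<in> S \<rightarrow> carrier M" if "c \<in> S \<rightarrow> carrier L" for c
    using that S(2) by (auto intro!: smult_closed)
  \<comment> \<open>It is enough that the set of linear combinations is itself closed; the assumed
    minimality then makes it all of \<open>M\<close>.\<close>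
  have "?closed S (lc ` (S \<rightarrow> carrier L))"
  proof (intro conjI ballI)
    show "S \<subseteq> lc ` (S \<rightarrow> carrier L)"
    proof
      fix s assume s: "s \<in> S"
      \<comment> \<open>Kronecker coefficients collapse the sum to the single generator
        \<open>s\<close>.\<close>
      let ?c = "\<lambda>t. if s = t then \<one>\<^bsub>L\<^esub> else \<zero>\<^bsub>L\<^esub>"
      have "lc ?c = (\<Oplus>\<^bsub>M\<^esub>t\<in>S. if s = t then t else \<zero>\<^bsub>M\<^esub>)"
        unfolding lc_def using S(2) by (intro M.finsum_cong') (auto simp: smult_one smult_zero_left)
      also have "\<dots> = s" using s S(1,2) M.finsum_singleton[of s S "\<lambda>t. t"] by auto
      finally show "s \<in> lc ` (S \<rightarrow> carrier L)" by (intro image_eqI[of _ _ ?c]) auto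
    qed
    show "lc ` (S \<rightarrow> carrier L) \<subseteq> carrier M"
      unfolding lc_def using cl by (auto intro!: M.finsum_closed)
    have "lc (\<lambda>_. \<zero>\<^bsub>L\<^esub>) = (\<Oplus>\<^bsub>M\<^esub>s\<in>S. \<zero>\<^bsub>M\<^esub>)"
      unfolding lc_def using S(2) by (intro M.finsum_cong') (auto simp: smult_zero_left)
    then show "\<zero>\<^bsub>M\<^esub> \<in> lc ` (S \<rightarrow> carrier L)"
      by (intro image_eqI[of _ _ "\<lambda>_. \<zero>\<^bsub>L\<^esub>"]) auto
  next
    fix x y assume "x \<in> lc ` (S \<rightarrow> carrier L)" "y \<in> lc ` (S \<rightarrow> carrier L)"
    then obtain c e where c: "c \<in> S \<rightarrow> carrier L" "x = lc c" and e: "e \<in> S \<rightarrow> carrier L" "y = lc e"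
      by blast
    have "lc (\<lambda>s. c s \<oplus>\<^bsub>L\<^esub> e s) = (\<Oplus>\<^bsub>M\<^esub>s\<in>S. c s \<odot>\<^bsub>M\<^esub> s \<oplus>\<^bsub>M\<^esub> e s \<odot>\<^bsub>M\<^esub> s)"
      unfolding lc_def using S(2) c(1) e(1)
      by (intro M.finsum_cong') (auto simp: smult_l_distr Pi_iff subset_iff intro!: M.a_closed smult_closed)
    also have "\<dots> = x \<oplus>\<^bsub>M\<^esub> y"
      unfolding c(2) e(2) lc_def using cl[OF c(1)] cl[OF e(1)] by (rule M.finsum_addf)
    finally show "x \<oplus>\<^bsub>M\<^esub> y \<in> lc ` (S \<rightarrow> carrier L)"
      using c(1) e(1) by (intro image_eqI[of _ _ "\<lambda>s. c s \<oplus>\<^bsub>L\<^esub> e s"]) auto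
  next
    fix a x assume a: "a \<in> carrier L" and "x \<in> lc ` (S \<rightarrow> carrier L)"
    then obtain c where c: "c \<in> S \<rightarrow> carrier L" "x = lc c" by blast
    have "a \<odot>\<^bsub>M\<^esub> (\<Oplus>\<^bsub>M\<^esub>s\<in>T. c s \<odot>\<^bsub>M\<^esub> s) = (\<Oplus>\<^bsub>M\<^esub>s\<in>T. (a \<otimes>\<^bsub>L\<^esub> c s) \<odot>\<^bsub>M\<^esub> s)"
      if "finite T" "T \<subseteq> S" for T
      using that
    proof (induction T)
      case (insert s T)
      then have "(\<lambda>s. c s \<odot>\<^bsub>M\<^esub> s) \<in> T \<rightarrow> carrier M" "c s \<odot>\<^bsub>M\<^esub> s \<in> carrier M" "s \<in> carrier M"
        "(\<lambda>s. (a \<otimes>\<^bsub>L\<^esub> c s) \<odot>\<^bsub>M\<^esub> s) \<in> T \<rightarrow> carrier M" "(a \<otimes>\<^bsub>L\<^esub> c s) \<odot>\<^bsub>M\<^esub> s \<in> carrier M"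
        "c s \<in> carrier L"
        using a c(1) S(2) by (auto simp: Pi_iff subset_iff intro!: smult_closed)
      then show ?case using insert a
        by (simp add: smult_r_distr smult_assoc)
    qed (use a in \<open>simp add: smult_zero_right\<close>)
    then have "lc (\<lambda>s. a \<otimes>\<^bsub>L\<^esub> c s) = a \<odot>\<^bsub>M\<^esub> x" using S(1) by (simp add: lc_def c(2))
    then show "a \<odot>\<^bsub>M\<^esub> x \<in> lc ` (S \<rightarrow> carrier L)"
      using a c(1) by (intro image_eqI[of _ _ "\<lambda>s. a \<otimes>\<^bsub>L\<^esub> c s"]) auto
  qed
  then have "carrier M \<subseteq> lc ` (S \<rightarrow> carrier L)" by (rule S(3))
  then show "fg_left_module L M"
    unfolding fg_left_module_def using S(1,2) left_module_axioms
    by (intro conjI exI[of _ S]) (auto simp: lc_def)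
qed

section \<open>Homomorphisms and their factorisations\<close>

lemma lmod_hom_zero:
  assumes "left_module L M" "left_module L N" "f \<in> lmod_hom L M N"
  shows "f \<zero>\<^bsub>M\<^esub> = \<zero>\<^bsub>N\<^esub>"
proof -
  interpret M: left_module L M by fact
  interpret N: left_module L N by fact
  show ?thesis
    using lmod_hom_add[OF assms(3), of "\<zero>\<^bsub>M\<^esub>" "\<zero>\<^bsub>M\<^esub>"] lmod_hom_closed[OF assms(3), of "\<zero>\<^bsub>M\<^esub>"]
    by (simp add: N.M.add.l_cancel_one)
qed

lemma lmod_hom_minus:
  assumes "left_module L M" "left_module L N" "f \<in> lmod_hom L M N" "x \<in> carrier M"
  shows "f (\<ominus>\<^bsub>M\<^esub> x) = \<ominus>\<^bsub>N\<^esub> f x"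
proof -
  interpret M: left_module L M by fact
  interpret N: left_module L N by fact
  show ?thesis
    using assms(4) lmod_hom_closed[OF assms(3,4)]
    by (simp add: M.minus_eq_smult N.minus_eq_smult lmod_hom_smult[OF assms(3)])
qed

lemma lmod_hom_diff:
  assumes "left_module L M" "left_module L N" "f \<in> lmod_hom L M N" "x \<in> carrier M" "y \<in> carrier M"
  shows "f (x \<ominus>\<^bsub>M\<^esub> y) = f x \<ominus>\<^bsub>N\<^esub> f y"
proof -
  interpret M: left_module L M by fact
  interpret N: left_module L N by fact
  show ?thesis
    using assms by (simp add: a_minus_def lmod_hom_add[OF assms(3)] lmod_hom_minus)
qed

lemma restrict_lmod_hom:
  assumes "left_module L M" "\<And>x. x \<in> carrier M \<Longrightarrow> f x \<in> carrier N"
    "\<And>x y. \<lbrakk>x \<in> carrier M; y \<in> carrier M\<rbrakk> \<Longrightarrow> f (x \<oplus>\<^bsub>M\<^esub> y) = f x \<oplus>\<^bsub>N\<^esub> f y"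
    "\<And>a x. \<lbrakk>a \<in> carrier L; x \<in> carrier M\<rbrakk> \<Longrightarrow> f (a \<odot>\<^bsub>M\<^esub> x) = a \<odot>\<^bsub>N\<^esub> f x"
  shows "restrict f (carrier M) \<in> lmod_hom L M N"
proof -
  interpret M: left_module L M by fact
  show ?thesis using assms(2-) by (auto simp: lmod_hom_def M.smult_closed)
qed

lemma id_lmod_hom: "left_module L M \<Longrightarrow> (\<lambda>x\<in>carrier M. x) \<in> lmod_hom L M M"
  by (rule restrict_lmod_hom) auto

lemma compose_lmod_hom:
  assumes "left_module L M" "f \<in> lmod_hom L M N" "g \<in> lmod_hom L N P"
  shows "compose (carrier M) g f \<in> lmod_hom L M P"
  unfolding compose_def using assms
  by (intro restrict_lmod_hom) (auto simp: lmod_hom_closed lmod_hom_add lmod_hom_smult)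

lemma lmod_zero_hom:
  assumes "left_module L M" "left_module L N"
  shows "lmod_zero M N \<in> lmod_hom L M N"
proof -
  interpret N: left_module L N by fact
  show ?thesis unfolding lmod_zero_def
    by (intro restrict_lmod_hom assms) (auto simp: N.smult_zero_right)
qed

lemma lmod_add_hom:
  assumes "left_module L M" "left_module L N" "f \<in> lmod_hom L M N" "g \<in> lmod_hom L M N"
  shows "lmod_add M N f g \<in> lmod_hom L M N"
proof -
  interpret N: left_module L N by fact
  note c = lmod_hom_closed[OF assms(3)] lmod_hom_closed[OF assms(4)]
  show ?thesis unfolding lmod_add_def
    by (intro restrict_lmod_hom assms)
      (auto simp: c lmod_hom_add[OF assms(3)] lmod_hom_add[OF assms(4)]
        lmod_hom_smult[OF assms(3)] lmod_hom_smult[OF assms(4)] N.smult_r_distr N.M.a_ac)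
qed

lemma minus_lmod_hom:
  assumes "left_module L M" "left_module L N" "f \<in> lmod_hom L M N"
  shows "(\<lambda>x\<in>carrier M. \<ominus>\<^bsub>N\<^esub> f x) \<in> lmod_hom L M N"
proof -
  interpret N: left_module L N by fact
  note c = lmod_hom_closed[OF assms(3)]
  show ?thesis
    by (intro restrict_lmod_hom assms)
      (auto simp: c lmod_hom_add[OF assms(3)] lmod_hom_smult[OF assms(3)] N.smult_minus N.M.minus_add)
qed

lemma diff_lmod_hom:
  assumes "left_module L M" "left_module L N" "f \<in> lmod_hom L M N" "g \<in> lmod_hom L M N"
  shows "(\<lambda>x\<in>carrier M. f x \<ominus>\<^bsub>N\<^esub> g x) \<in> lmod_hom L M N"
proof -
  have "(\<lambda>x\<in>carrier M. f x \<ominus>\<^bsub>N\<^esub> g x) = lmod_add M N f (\<lambda>x\<in>carrier M. \<ominus>\<^bsub>N\<^esub> g x)"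
    by (auto simp: lmod_add_def a_minus_def)
  then show ?thesis using assms by (simp add: lmod_add_hom minus_lmod_hom)
qed

text \<open>Any choice of preimages works: an identity between chosen values can be tested after
  applying the injective \<open>i\<close>, where it is inherited from \<open>f\<close>.\<close>

lemma lmod_hom_factor_mono:
  assumes "left_module L W" "left_module L K" "i \<in> lmod_hom L K M" "inj_on i (carrier K)"
    "f \<in> lmod_hom L W M" "f ` carrier W \<subseteq> i ` carrier K"
  shows "\<exists>g \<in> lmod_hom L W K. \<forall>w \<in> carrier W. i (g w) = f w"
proof -
  interpret W: left_module L W by fact
  interpret K: left_module L K by fact
  have "\<forall>w \<in> carrier W. \<exists>k \<in> carrier K. i k = f w" using assms(6) by (auto simp: image_subset_iff image_iff) metis
  then obtain g where g: "\<And>w. w \<in> carrier W \<Longrightarrow> g w \<in> carrier K" "\<And>w. w \<in> carrier W \<Longrightarrow> i (g w) = f w"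
    by metis
  have "restrict g (carrier W) \<in> lmod_hom L W K"
  proof (rule restrict_lmod_hom)
    fix x y assume "x \<in> carrier W" "y \<in> carrier W"
    then show "g (x \<oplus>\<^bsub>W\<^esub> y) = g x \<oplus>\<^bsub>K\<^esub> g y"
      using assms(4) by (intro inj_onD[OF assms(4)])
        (auto simp: g lmod_hom_add[OF assms(3)] lmod_hom_add[OF assms(5)])
  next
    fix a x assume "a \<in> carrier L" "x \<in> carrier W"
    then show "g (a \<odot>\<^bsub>W\<^esub> x) = a \<odot>\<^bsub>K\<^esub> g x"
      using assms(4) by (intro inj_onD[OF assms(4)])
        (auto simp: g lmod_hom_smult[OF assms(3)] lmod_hom_smult[OF assms(5)] W.smult_closed K.smult_closed)
  qed (use assms g in auto)
  then show ?thesis using g by (intro bexI[of _ "restrict g (carrier W)"]) auto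
qed

text \<open>Two points in one fibre of \<open>p\<close> differ by an element of its kernel, where
  \<open>f\<close> vanishes; so \<open>f\<close> is constant on fibres and descends to
  \<open>N\<close>. This is the universal property of a quotient, stated for an arbitrary
  surjection.\<close>

lemma lmod_hom_factor_epi:
  assumes "left_module L M" "left_module L N" "left_module L W" "p \<in> lmod_hom L M N"
    "p ` carrier M = carrier N" "f \<in> lmod_hom L M W"
    "\<And>x. \<lbrakk>x \<in> carrier M; p x = \<zero>\<^bsub>N\<^esub>\<rbrakk> \<Longrightarrow> f x = \<zero>\<^bsub>W\<^esub>"
  shows "\<exists>g \<in> lmod_hom L N W. \<forall>x \<in> carrier M. g (p x) = f x"
proof -
  interpret M: left_module L M by fact
  interpret N: left_module L N by fact
  interpret W: left_module L W by fact
  note pc = lmod_hom_closed[OF assms(4)] and fc = lmod_hom_closed[OF assms(6)]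
  have wd: "f x = f y" if "x \<in> carrier M" "y \<in> carrier M" "p x = p y" for x y
  proof -
    have "p (x \<ominus>\<^bsub>M\<^esub> y) = \<zero>\<^bsub>N\<^esub>"
      using that pc by (simp add: lmod_hom_diff[OF assms(1,2,4)] N.M.diff_self)
    then have "f x \<ominus>\<^bsub>W\<^esub> f y = \<zero>\<^bsub>W\<^esub>"
      using assms(7)[of "x \<ominus>\<^bsub>M\<^esub> y"] that by (simp add: lmod_hom_diff[OF assms(1,3,6)])
    then show ?thesis using that fc by (simp add: W.M.diff_eq_zero_iff)
  qed
  have s: "\<And>z. z \<in> carrier N \<Longrightarrow> inv_into (carrier M) p z \<in> carrier M"
    "\<And>z. z \<in> carrier N \<Longrightarrow> p (inv_into (carrier M) p z) = z"
    unfolding assms(5)[symmetric] by (auto intro: inv_into_into f_inv_into_f)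
  \<comment> \<open>\<open>s\<close> is a merely set-theoretic section of \<open>p\<close>;
    linearity is recovered only after applying \<open>f\<close>, through \<open>wd\<close>.\<close>
  define s where "s = inv_into (carrier M) p"
  note s = s[folded s_def]
  have "(\<lambda>z\<in>carrier N. f (s z)) \<in> lmod_hom L N W"
  proof (rule restrict_lmod_hom)
    fix x y assume "x \<in> carrier N" "y \<in> carrier N"
    then show "f (s (x \<oplus>\<^bsub>N\<^esub> y)) = f (s x) \<oplus>\<^bsub>W\<^esub> f (s y)"
      using wd[of "s (x \<oplus>\<^bsub>N\<^esub> y)" "s x \<oplus>\<^bsub>M\<^esub> s y"]
      by (simp add: s lmod_hom_add[OF assms(4)] lmod_hom_add[OF assms(6)])
  next
    fix a x assume "a \<in> carrier L" "x \<in> carrier N"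
    then show "f (s (a \<odot>\<^bsub>N\<^esub> x)) = a \<odot>\<^bsub>W\<^esub> f (s x)"
      using wd[of "s (a \<odot>\<^bsub>N\<^esub> x)" "a \<odot>\<^bsub>M\<^esub> s x"]
      by (simp add: s lmod_hom_smult[OF assms(4)] lmod_hom_smult[OF assms(6)] M.smult_closed N.smult_closed)
  qed (use assms s fc in auto)
  moreover have "f (s (p x)) = f x" if "x \<in> carrier M" for x
    using that pc by (intro wd) (simp_all add: s)
  ultimately show ?thesis using pc by (intro bexI[of _ "\<lambda>z\<in>carrier N. f (s z)"]) auto
qed

text \<open>Bijective homomorphisms transport all three clauses of exactness. The maps
  \<open>i'\<close> and \<open>p'\<close> enter only through the commuting squares, which determine
  them because \<open>a\<close> and \<open>b\<close> are onto.\<close>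

lemma short_exact_iso:
  assumes "left_module L K" "left_module L K'" "left_module L M" "left_module L M'" "left_module L N" "left_module L N'"
    and se: "lmod_short_exact K i M p N"
    and a: "a \<in> lmod_hom L K K'" "bij_betw a (carrier K) (carrier K')"
    and b: "b \<in> lmod_hom L M M'" "bij_betw b (carrier M) (carrier M')"
    and c: "c \<in> lmod_hom L N N'" "bij_betw c (carrier N) (carrier N')"
    and i: "i \<in> lmod_hom L K M" and i': "\<And>x. x \<in> carrier K \<Longrightarrow> b (i x) = i' (a x)"
    and p: "p \<in> lmod_hom L M N" and p': "\<And>x. x \<in> carrier M \<Longrightarrow> c (p x) = p' (b x)"
  shows "lmod_short_exact K' i' M' p' N'"
proof -
  have K': "carrier K' = a ` carrier K" and M': "carrier M' = b ` carrier M" and N': "carrier N' = c ` carrier N"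
    using a b c by (auto simp: bij_betw_def)
  have c0: "c \<zero>\<^bsub>N\<^esub> = \<zero>\<^bsub>N'\<^esub>" using assms by (intro lmod_hom_zero)
  interpret N: left_module L N by fact
  have se': "inj_on i (carrier K)" "i ` carrier K = {x \<in> carrier M. p x = \<zero>\<^bsub>N\<^esub>}" "p ` carrier M = carrier N"
    using se by (auto simp: lmod_short_exact_def)
  have bi: "b x = b y \<longleftrightarrow> x = y" if "x \<in> carrier M" "y \<in> carrier M" for x y
    using b(2) that by (auto simp: bij_betw_def inj_on_def)
  have ci: "c x = \<zero>\<^bsub>N'\<^esub> \<longleftrightarrow> x = \<zero>\<^bsub>N\<^esub>" if "x \<in> carrier N" for x
    using c(2) that c0 N.M.zero_closed unfolding bij_betw_def inj_on_def by metis
  have "inj_on i' (carrier K')"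
    using se'(1) lmod_hom_closed[OF i] bi unfolding K' by (auto simp: inj_on_def simp flip: i')
  moreover have "i' ` carrier K' = b ` i ` carrier K"
    unfolding K' image_image using i' by (intro image_cong) auto
  then have "i' ` carrier K' = {x \<in> carrier M'. p' x = \<zero>\<^bsub>N'\<^esub>}"
    unfolding se'(2) M' using lmod_hom_closed[OF p] ci by (auto simp flip: p')
  moreover have "p' ` carrier M' = c ` p ` carrier M"
    unfolding M' image_image using p' by (intro image_cong) auto
  ultimately show ?thesis using se'(3) N' by (simp add: lmod_short_exact_def)
qed

section \<open>Finitely generated projective modules\<close>

text \<open>The objects of the category of finitely generated projectives that have their carrier in
  \<open>'b\<close>; both ends of an object of the morphism category under study are of this
  kind.\<close>

definition fg_projective :: "('a, 'c) ring_scheme \<Rightarrow> ('a, 'b) module \<Rightarrow> bool"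
  where "fg_projective L M \<longleftrightarrow> fg_left_module L M \<and> projective_left_module L M"

lemma fg_projective_left_module: "fg_projective L M \<Longrightarrow> left_module L M"
  by (simp add: fg_projective_def left_module_fg)

lemma fg_projective_lift:
  fixes P M N :: "('a, 'b) module"
  assumes "fg_projective L P" "left_module L M" "left_module L N"
    "p \<in> lmod_hom L M N" "p ` carrier M = carrier N" "f \<in> lmod_hom L P N"
  shows "\<exists>g \<in> lmod_hom L P M. \<forall>x \<in> carrier P. p (g x) = f x"
proof -
  have "\<exists>g \<in> lmod_hom L P M. compose (carrier P) p g = f"
    using assms unfolding fg_projective_def projective_left_module_def by blast
  then show ?thesis by (auto simp: compose_def)
qed

lemma fg_projective_section:
  fixes M N :: "('a, 'b) module"
  assumes "fg_projective L N" "left_module L M" "p \<in> lmod_hom L M N" "p ` carrier M = carrier N"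
  shows "\<exists>s \<in> lmod_hom L N M. \<forall>x \<in> carrier N. p (s x) = x"
  using fg_projective_lift[OF assms(1,2) fg_projective_left_module[OF assms(1)] assms(3,4)
    id_lmod_hom[OF fg_projective_left_module[OF assms(1)]]] by auto

text \<open>The preimage of a closed set under \<open>p\<close> is closed, hence is everything once
  it contains \<open>S\<close>; so the image of \<open>S\<close> generates \<open>N\<close>.\<close>

lemma fg_left_module_surj:
  assumes "fg_left_module L M" "left_module L N" "p \<in> lmod_hom L M N" "p ` carrier M = carrier N"
  shows "fg_left_module L N"
proof -
  interpret M: left_module L M using assms(1) by (rule left_module_fg)
  interpret N: left_module L N by fact
  obtain S where S: "finite S" "S \<subseteq> carrier M"
    "\<And>H. \<lbrakk>S \<subseteq> H; H \<subseteq> carrier M; \<zero>\<^bsub>M\<^esub> \<in> H; \<forall>x\<in>H. \<forall>y\<in>H. x \<oplus>\<^bsub>M\<^esub> y \<in> H;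
      \<forall>a\<in>carrier L. \<forall>x\<in>H. a \<odot>\<^bsub>M\<^esub> x \<in> H\<rbrakk> \<Longrightarrow> carrier M \<subseteq> H"
    using assms(1) unfolding fg_left_module_iff_closure by metis
  have p0: "p \<zero>\<^bsub>M\<^esub> = \<zero>\<^bsub>N\<^esub>" using left_module_fg[OF assms(1)] assms(2,3) by (rule lmod_hom_zero)
  show ?thesis
    unfolding fg_left_module_iff_closure
  proof (intro conjI exI[of _ "p ` S"] allI impI)
    fix H assume H: "p ` S \<subseteq> H \<and> H \<subseteq> carrier N \<and> \<zero>\<^bsub>N\<^esub> \<in> H \<and> (\<forall>x\<in>H. \<forall>y\<in>H. x \<oplus>\<^bsub>N\<^esub> y \<in> H) \<and>
      (\<forall>a\<in>carrier L. \<forall>x\<in>H. a \<odot>\<^bsub>N\<^esub> x \<in> H)"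
    have "carrier M \<subseteq> {x \<in> carrier M. p x \<in> H}"
      using H S(2) by (intro S(3))
        (auto simp: p0 lmod_hom_add[OF assms(3)] lmod_hom_smult[OF assms(3)] M.smult_closed)
    then show "carrier N \<subseteq> H" unfolding assms(4)[symmetric] by auto
  qed (use S assms(2) lmod_hom_closed[OF assms(3)] in auto)
qed

text \<open>A lifting problem \<open>f\<close> out of \<open>K\<close> is turned into the problem
  \<open>f\<close> \<open>r\<close> out of \<open>M\<close>; restricting its solution along
  \<open>i\<close> solves the original one because \<open>r\<close> \<open>i\<close> is the
  identity. Finite generation follows since \<open>r\<close> is onto.\<close>

lemma fg_projective_retract:
  fixes M K :: "('a, 'b) module"
  assumes "fg_projective L M" "left_module L K" "i \<in> lmod_hom L K M" "r \<in> lmod_hom L M K"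
    "\<And>x. x \<in> carrier K \<Longrightarrow> r (i x) = x"
  shows "fg_projective L K"
proof -
  have M: "left_module L M" using assms(1) by (rule fg_projective_left_module)
  have "r ` carrier M = carrier K"
    using assms(5) lmod_hom_closed[OF assms(3)] lmod_hom_closed[OF assms(4)] by force
  then have "fg_left_module L K"
    using assms(1) by (intro fg_left_module_surj[OF _ assms(2,4)]) (simp add: fg_projective_def)
  moreover have "\<exists>g \<in> lmod_hom L K A. compose (carrier K) p g = f"
    if A: "left_module L A" "left_module L B" "p \<in> lmod_hom L A B" "p ` carrier A = carrier B"
      "f \<in> lmod_hom L K B" for A B :: "('a, 'b) module" and p f
  proof -
    obtain g where g: "g \<in> lmod_hom L M A" "\<And>x. x \<in> carrier M \<Longrightarrow> p (g x) = f (r x)"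
      using fg_projective_lift[OF assms(1) A(1-4) compose_lmod_hom[OF M assms(4) A(5)]]
      by (auto simp: compose_def)
    have "compose (carrier K) g i \<in> lmod_hom L K A" using assms g by (intro compose_lmod_hom)
    moreover from this have "compose (carrier K) p (compose (carrier K) g i) = f"
      using A assms lmod_hom_closed[OF assms(3)] g(2)
      by (intro lmod_hom_eqI[OF compose_lmod_hom A(5)]) (auto simp: compose_def)
    ultimately show ?thesis by blast
  qed
  ultimately show ?thesis
    using assms(2) unfolding fg_projective_def projective_left_module_def by blast
qed

section \<open>Kernels and split exact sequences\<close>

definition kernel_module :: "('a, 'b) module \<Rightarrow> ('a, 'd) module \<Rightarrow> ('b \<Rightarrow> 'd) \<Rightarrow> ('a, 'b) module"
  where "kernel_module M N p = M\<lparr>carrier := {x \<in> carrier M. p x = \<zero>\<^bsub>N\<^esub>}\<rparr>"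

lemma kernel_module_simps [simp]:
  "carrier (kernel_module M N p) = {x \<in> carrier M. p x = \<zero>\<^bsub>N\<^esub>}"
  "\<zero>\<^bsub>kernel_module M N p\<^esub> = \<zero>\<^bsub>M\<^esub>" "x \<oplus>\<^bsub>kernel_module M N p\<^esub> y = x \<oplus>\<^bsub>M\<^esub> y"
  "a \<odot>\<^bsub>kernel_module M N p\<^esub> x = a \<odot>\<^bsub>M\<^esub> x"
  by (simp_all add: kernel_module_def)

lemma left_module_kernel:
  assumes "left_module L M" "left_module L N" "p \<in> lmod_hom L M N"
  shows "left_module L (kernel_module M N p)"
proof -
  interpret M: left_module L M by fact
  interpret N: left_module L N by fact
  show ?thesis unfolding kernel_module_def
    by (intro M.left_module_subset)
      (auto simp: lmod_hom_add[OF assms(3)] lmod_hom_smult[OF assms(3)] lmod_hom_zero[OF assms]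
        M.smult_closed N.smult_zero_right)
qed

lemma kernel_incl_hom:
  assumes "left_module L M" "left_module L N" "p \<in> lmod_hom L M N"
  shows "(\<lambda>x\<in>carrier (kernel_module M N p). x) \<in> lmod_hom L (kernel_module M N p) M"
  using left_module_kernel[OF assms] by (rule restrict_lmod_hom) auto

text \<open>This is the complementary projection 1 - \<open>s\<close> \<open>p\<close>, which lands
  in the kernel because \<open>p\<close> \<open>s\<close> is the identity. It serves two purposes:
  with \<open>p\<close> a given surjection and \<open>s\<close> its section, and with
  \<open>p\<close> a retraction and \<open>s\<close> the given split mono.\<close>

lemma kernel_projection_hom:
  assumes "left_module L M" "left_module L N" "p \<in> lmod_hom L M N" "s \<in> lmod_hom L N M"
    "\<And>x. x \<in> carrier N \<Longrightarrow> p (s x) = x"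
  shows "(\<lambda>x\<in>carrier M. x \<ominus>\<^bsub>M\<^esub> s (p x)) \<in> lmod_hom L M (kernel_module M N p)"
proof -
  interpret M: left_module L M by fact
  interpret N: left_module L N by fact
  have h: "(\<lambda>x\<in>carrier M. (\<lambda>x\<in>carrier M. x) x \<ominus>\<^bsub>M\<^esub> compose (carrier M) s p x) \<in> lmod_hom L M M"
    using assms by (intro diff_lmod_hom id_lmod_hom compose_lmod_hom)
  have "(\<lambda>x\<in>carrier M. (\<lambda>x\<in>carrier M. x) x \<ominus>\<^bsub>M\<^esub> compose (carrier M) s p x)
    = (\<lambda>x\<in>carrier M. x \<ominus>\<^bsub>M\<^esub> s (p x))" by (auto simp: compose_def)
  with h have h: "(\<lambda>x\<in>carrier M. x \<ominus>\<^bsub>M\<^esub> s (p x)) \<in> lmod_hom L M M" by simp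
  have "p (x \<ominus>\<^bsub>M\<^esub> s (p x)) = \<zero>\<^bsub>N\<^esub>" if "x \<in> carrier M" for x
    using that lmod_hom_closed[OF assms(3)] lmod_hom_closed[OF assms(4)] assms(5)
    by (simp add: lmod_hom_diff[OF assms(1-3)] N.M.diff_self)
  with h show ?thesis by (auto simp: lmod_hom_def PiE_iff)
qed

text \<open>A surjection onto the projective \<open>N\<close> splits, so its kernel is a retract of
  \<open>M\<close> by 1 - \<open>s\<close> \<open>p\<close>; finite generation and projectivity both
  come down from \<open>M\<close>.\<close>

lemma fg_projective_kernel:
  fixes M N :: "('a, 'b) module"
  assumes "fg_projective L M" "fg_projective L N" "p \<in> lmod_hom L M N" "p ` carrier M = carrier N"
  shows "fg_projective L (kernel_module M N p)"
proof -
  have M: "left_module L M" and N: "left_module L N" using assms by (auto intro: fg_projective_left_module)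
  interpret M: left_module L M by fact
  obtain s where s: "s \<in> lmod_hom L N M" "\<And>x. x \<in> carrier N \<Longrightarrow> p (s x) = x"
    using fg_projective_section[OF assms(2) M assms(3,4)] by blast
  show ?thesis
    by (rule fg_projective_retract[OF assms(1) left_module_kernel kernel_incl_hom kernel_projection_hom])
      (use assms M N s lmod_hom_zero[OF N M s(1)] in \<open>auto simp: M.M.diff_zero\<close>)
qed

lemma short_exact_kernel:
  "p ` carrier M = carrier N \<Longrightarrow>
    lmod_short_exact (kernel_module M N p) (\<lambda>x\<in>carrier (kernel_module M N p). x) M p N"
  by (auto simp: lmod_short_exact_def inj_on_def)

text \<open>The image of \<open>i\<close> is the fixed set of \<open>i\<close> \<open>r\<close>,
  that is, the kernel of 1 - \<open>i\<close> \<open>r\<close>, and the image of 1 -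
  \<open>i\<close> \<open>r\<close> is the kernel of \<open>r\<close>. Thus the kernel of
  \<open>r\<close> is a model of the cokernel of \<open>i\<close> inside \<open>M\<close>.\<close>

lemma short_exact_split_mono:
  assumes "left_module L K" "left_module L M" "i \<in> lmod_hom L K M" "r \<in> lmod_hom L M K"
    "\<And>x. x \<in> carrier K \<Longrightarrow> r (i x) = x"
  shows "lmod_short_exact K i M (\<lambda>x\<in>carrier M. x \<ominus>\<^bsub>M\<^esub> i (r x)) (kernel_module M K r)"
proof -
  interpret K: left_module L K by fact
  interpret M: left_module L M by fact
  note ic = lmod_hom_closed[OF assms(3)] and rc = lmod_hom_closed[OF assms(4)]
  have "inj_on i (carrier K)" by (rule inj_on_inverseI[of _ r]) (rule assms(5))
  moreover have "i ` carrier K = {x \<in> carrier M. x \<ominus>\<^bsub>M\<^esub> i (r x) = \<zero>\<^bsub>M\<^esub>}"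
    using ic rc assms(5) by (auto simp: M.M.diff_eq_zero_iff image_iff)
  moreover have "(\<lambda>x. x \<ominus>\<^bsub>M\<^esub> i (r x)) ` carrier M = {x \<in> carrier M. r x = \<zero>\<^bsub>K\<^esub>}"
  proof (intro subset_antisym subsetI)
    fix y assume "y \<in> (\<lambda>x. x \<ominus>\<^bsub>M\<^esub> i (r x)) ` carrier M"
    then obtain x where "x \<in> carrier M" "y = x \<ominus>\<^bsub>M\<^esub> i (r x)" by blast
    then show "y \<in> {x \<in> carrier M. r x = \<zero>\<^bsub>K\<^esub>}"
      using ic rc assms(5) by (simp add: lmod_hom_diff[OF assms(2,1,4)] K.M.diff_self)
  next
    fix x assume "x \<in> {x \<in> carrier M. r x = \<zero>\<^bsub>K\<^esub>}"
    then show "x \<in> (\<lambda>x. x \<ominus>\<^bsub>M\<^esub> i (r x)) ` carrier M"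
      by (intro image_eqI[of _ _ x]) (simp_all add: lmod_hom_zero[OF assms(1-3)] M.M.diff_zero)
  qed
  ultimately show ?thesis by (simp add: lmod_short_exact_def cong: conj_cong)
qed

text \<open>For a section \<open>s\<close> of \<open>p\<close>, the map 1 - \<open>s\<close>
  \<open>p\<close> takes values in the kernel of \<open>p\<close>, which is the image of
  \<open>i\<close>. Factoring it through the injection \<open>i\<close> gives \<open>r\<close> with
  \<open>i\<close> \<open>r\<close> = 1 - \<open>s\<close> \<open>p\<close>.\<close>

lemma short_exact_retraction:
  fixes K M N :: "('a, 'b) module"
  assumes "left_module L K" "left_module L M" "fg_projective L N" "i \<in> lmod_hom L K M" "p \<in> lmod_hom L M N"
    "lmod_short_exact K i M p N"
  shows "\<exists>r \<in> lmod_hom L M K. \<forall>x \<in> carrier K. r (i x) = x"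
proof -
  have N: "left_module L N" using assms by (auto intro: fg_projective_left_module)
  have se: "inj_on i (carrier K)" "i ` carrier K = {x \<in> carrier M. p x = \<zero>\<^bsub>N\<^esub>}" "p ` carrier M = carrier N"
    using assms(6) by (auto simp: lmod_short_exact_def)
  interpret M: left_module L M by fact
  obtain s where s: "s \<in> lmod_hom L N M" "\<And>x. x \<in> carrier N \<Longrightarrow> p (s x) = x"
    using fg_projective_section[OF assms(3,2,5) se(3)] by blast
  define f where "f = (\<lambda>x\<in>carrier M. x \<ominus>\<^bsub>M\<^esub> s (p x))"
  have "f \<in> lmod_hom L M (kernel_module M N p)"
    unfolding f_def using assms N s by (intro kernel_projection_hom)
  then have f: "f \<in> lmod_hom L M M" "f ` carrier M \<subseteq> i ` carrier K"
    unfolding se(2) by (auto simp: lmod_hom_def PiE_iff)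
  obtain r where r: "r \<in> lmod_hom L M K" "\<And>x. x \<in> carrier M \<Longrightarrow> i (r x) = f x"
    using lmod_hom_factor_mono[OF assms(2,1,4) se(1) f] by blast
  have "r (i x) = x" if x: "x \<in> carrier K" for x
  proof -
    have ix: "i x \<in> carrier M" "p (i x) = \<zero>\<^bsub>N\<^esub>" using x se(2) by auto
    \<comment> \<open>Since \<open>p\<close> kills \<open>i x\<close>, the projection 1 -
      \<open>s\<close> \<open>p\<close> fixes it; injectivity of \<open>i\<close> cancels the outer
      \<open>i\<close>.\<close>
    then have "i (r (i x)) = i x"
      using r(2) lmod_hom_zero[OF N assms(2) s(1)] by (simp add: f_def M.M.diff_zero)
    then show ?thesis using x ix(1) lmod_hom_closed[OF r(1)] se(1) by (auto dest: inj_onD)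
  qed
  then show ?thesis using r(1) by blast
qed

text \<open>The carrier is the singleton of \<open>undefined\<close>, an element available in every
  type \<open>'b\<close>.\<close>

definition zero_module :: "('a, 'b) module"
  where "zero_module = \<lparr>carrier = {undefined}, mult = undefined, one = undefined, zero = undefined,
    add = (\<lambda>_ _. undefined), smult = (\<lambda>_ _. undefined)\<rparr>"

text \<open>The only homomorphism out of \<open>M\<close> is zero, and zero lifts it. The empty set
  generates, since a closed set always contains zero.\<close>

lemma fg_projective_trivial:
  fixes M :: "('a, 'b) module"
  assumes "left_module L M" "carrier M = {\<zero>\<^bsub>M\<^esub>}"
  shows "fg_projective L M"
proof -
  interpret M: left_module L M by fact
  have "\<exists>g \<in> lmod_hom L M A. compose (carrier M) p g = f"
    if "left_module L A" "left_module L B" "p \<in> lmod_hom L A B" "f \<in> lmod_hom L M B"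
    for A B :: "('a, 'b) module" and p f
    using lmod_zero_hom[OF assms(1) that(1)] that assms lmod_hom_zero[OF that(1-3)]
      lmod_hom_zero[OF assms(1) that(2,4)]
    by (intro bexI[of _ "lmod_zero M A"] lmod_hom_eqI[OF compose_lmod_hom that(4)])
      (auto simp: compose_def lmod_zero_def)
  moreover have "fg_left_module L M"
    unfolding fg_left_module_iff_closure using assms by (intro conjI exI[of _ "{}"]) auto
  ultimately show ?thesis
    using assms unfolding fg_projective_def projective_left_module_def by blast
qed

lemma zero_module:
  assumes "ring L"
  shows "left_module L zero_module" "carrier zero_module = {\<zero>\<^bsub>zero_module\<^esub>}"
  by (auto simp: zero_module_def intro!: left_module.intro assms left_module_axioms.intro abelian_groupI)

section \<open>Direct sums\<close>

text \<open>All modules live on the type \<open>'b\<close>, so pairs are encoded in \<open>'b\<close>; for finite \<open>'b\<close> the encoding is junk.\<close>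

definition pr :: "'b \<times> 'b \<Rightarrow> 'b"
  where "pr = (SOME h. inj h)"

abbreviation pr1 :: "'b \<Rightarrow> 'b"
  where "pr1 z \<equiv> fst (inv_into UNIV pr z)"

abbreviation pr2 :: "'b \<Rightarrow> 'b"
  where "pr2 z \<equiv> snd (inv_into UNIV pr z)"

text \<open>An infinite set is equipollent to its square, so an injection of pairs exists and the
  choice made in \<open>pr\<close> is an injection. All decoding in direct sums rests on
  this.\<close>

lemma inv_pr:
  assumes "infinite (UNIV :: 'b set)"
  shows "inv_into UNIV (pr :: 'b \<times> 'b \<Rightarrow> 'b) (pr z) = z"
proof -
  have "\<exists>h :: 'b \<times> 'b \<Rightarrow> 'b. inj h"
    using card_of_Times_same_infinite[OF assms]
    by (metis UNIV_Times_UNIV card_of_ordLeq ordIso_iff_ordLeq)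
  then have "inj (pr :: 'b \<times> 'b \<Rightarrow> 'b)" unfolding pr_def by (rule someI_ex)
  then show ?thesis by simp
qed

lemma pr_eq_iff: "infinite (UNIV :: 'b set) \<Longrightarrow> pr (z :: 'b \<times> 'b) = pr w \<longleftrightarrow> z = w"
  using inv_pr by metis

definition direct_sum :: "('a, 'b) module \<Rightarrow> ('a, 'b) module \<Rightarrow> ('a, 'b) module"
  where "direct_sum M N = \<lparr>carrier = pr ` (carrier M \<times> carrier N), mult = undefined, one = undefined,
    zero = pr (\<zero>\<^bsub>M\<^esub>, \<zero>\<^bsub>N\<^esub>), add = (\<lambda>x y. pr (pr1 x \<oplus>\<^bsub>M\<^esub> pr1 y, pr2 x \<oplus>\<^bsub>N\<^esub> pr2 y)),
    smult = (\<lambda>a x. pr (a \<odot>\<^bsub>M\<^esub> pr1 x, a \<odot>\<^bsub>N\<^esub> pr2 x))\<rparr>"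

lemma dsum_simps:
  "carrier (direct_sum M N) = pr ` (carrier M \<times> carrier N)" "\<zero>\<^bsub>direct_sum M N\<^esub> = pr (\<zero>\<^bsub>M\<^esub>, \<zero>\<^bsub>N\<^esub>)"
  "x \<oplus>\<^bsub>direct_sum M N\<^esub> y = pr (pr1 x \<oplus>\<^bsub>M\<^esub> pr1 y, pr2 x \<oplus>\<^bsub>N\<^esub> pr2 y)"
  "a \<odot>\<^bsub>direct_sum M N\<^esub> x = pr (a \<odot>\<^bsub>M\<^esub> pr1 x, a \<odot>\<^bsub>N\<^esub> pr2 x)"
  by (simp_all add: direct_sum_def)

context
  fixes M N :: "('a, 'b) module" and L :: "('a, 'c) ring_scheme"
  assumes inf: "infinite (UNIV :: 'b set)" and M: "left_module L M" and N: "left_module L N"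
begin

interpretation M: left_module L M by (rule M)
interpretation N: left_module L N by (rule N)

lemma left_module_dsum: "left_module L (direct_sum M N)"
proof -
  have "abelian_group (direct_sum M N)"
  proof (rule abelian_groupI)
    fix x assume "x \<in> carrier (direct_sum M N)"
    then show "\<exists>y\<in>carrier (direct_sum M N). y \<oplus>\<^bsub>direct_sum M N\<^esub> x = \<zero>\<^bsub>direct_sum M N\<^esub>"
      by (intro bexI[of _ "pr (\<ominus>\<^bsub>M\<^esub> pr1 x, \<ominus>\<^bsub>N\<^esub> pr2 x)"])
        (auto simp: dsum_simps inv_pr[OF inf] M.M.l_neg N.M.l_neg)
  qed (auto simp: dsum_simps inv_pr[OF inf] M.M.a_ac N.M.a_ac)
  then show ?thesis
    by (intro left_module.intro left_module_axioms.intro M.R.ring_axioms)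
      (auto simp: dsum_simps inv_pr[OF inf] M.smult_closed M.smult_l_distr M.smult_r_distr M.smult_assoc M.smult_one
        N.smult_closed N.smult_l_distr N.smult_r_distr N.smult_assoc N.smult_one)
qed

lemma dsum_inl_hom: "(\<lambda>x\<in>carrier M. pr (x, \<zero>\<^bsub>N\<^esub>)) \<in> lmod_hom L M (direct_sum M N)"
  by (intro restrict_lmod_hom M) (auto simp: dsum_simps inv_pr[OF inf] N.smult_zero_right)

lemma dsum_inr_hom: "(\<lambda>x\<in>carrier N. pr (\<zero>\<^bsub>M\<^esub>, x)) \<in> lmod_hom L N (direct_sum M N)"
  by (intro restrict_lmod_hom N) (auto simp: dsum_simps inv_pr[OF inf] M.smult_zero_right)

lemma dsum_pr1_hom: "(\<lambda>x\<in>carrier (direct_sum M N). pr1 x) \<in> lmod_hom L (direct_sum M N) M"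
  by (intro restrict_lmod_hom left_module_dsum) (auto simp: dsum_simps inv_pr[OF inf])

lemma dsum_pr2_hom: "(\<lambda>x\<in>carrier (direct_sum M N). pr2 x) \<in> lmod_hom L (direct_sum M N) N"
  by (intro restrict_lmod_hom left_module_dsum) (auto simp: dsum_simps inv_pr[OF inf])

lemma dsum_pair_hom:
  assumes "left_module L W" "f \<in> lmod_hom L W M" "g \<in> lmod_hom L W N"
  shows "(\<lambda>w\<in>carrier W. pr (f w, g w)) \<in> lmod_hom L W (direct_sum M N)"
  by (intro restrict_lmod_hom assms(1))
    (use assms(2,3) in \<open>auto simp: dsum_simps inv_pr[OF inf] lmod_hom_closed lmod_hom_add lmod_hom_smult\<close>)

lemma dsum_copair_hom:
  assumes "left_module L W" "f \<in> lmod_hom L M W" "g \<in> lmod_hom L N W"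
  shows "(\<lambda>x\<in>carrier (direct_sum M N). f (pr1 x) \<oplus>\<^bsub>W\<^esub> g (pr2 x)) \<in> lmod_hom L (direct_sum M N) W"
proof -
  have h: "compose (carrier (direct_sum M N)) f (\<lambda>x\<in>carrier (direct_sum M N). pr1 x) \<in> lmod_hom L (direct_sum M N) W"
    "compose (carrier (direct_sum M N)) g (\<lambda>x\<in>carrier (direct_sum M N). pr2 x) \<in> lmod_hom L (direct_sum M N) W"
    by (rule compose_lmod_hom[OF left_module_dsum dsum_pr1_hom assms(2)]
      compose_lmod_hom[OF left_module_dsum dsum_pr2_hom assms(3)])+
  have "(\<lambda>x\<in>carrier (direct_sum M N). f (pr1 x) \<oplus>\<^bsub>W\<^esub> g (pr2 x)) = lmod_add (direct_sum M N) W
    (compose (carrier (direct_sum M N)) f (\<lambda>x\<in>carrier (direct_sum M N). pr1 x))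
    (compose (carrier (direct_sum M N)) g (\<lambda>x\<in>carrier (direct_sum M N). pr2 x))"
    by (auto simp: lmod_add_def compose_def)
  then show ?thesis using lmod_add_hom[OF left_module_dsum assms(1) h] by simp
qed

end

text \<open>Generators are the images of generators of \<open>M\<close> and \<open>N\<close> under
  the two inclusions; a lifting problem is solved on each summand and the solutions are added. Both
  arguments use that a pair is the sum of its images under the inclusions.\<close>

lemma fg_projective_dsum:
  fixes M N :: "('a, 'b) module"
  assumes inf: "infinite (UNIV :: 'b set)" and M: "fg_projective L M" and N: "fg_projective L N"
  shows "fg_projective L (direct_sum M N)"
proof -
  interpret M: left_module L M by (rule fg_projective_left_module[OF M])
  interpret N: left_module L N by (rule fg_projective_left_module[OF N])
  note lM = M.left_module_axioms and lN = N.left_module_axioms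
  have fM: "fg_left_module L M" and fN: "fg_left_module L N" using M N by (auto simp: fg_projective_def)
  obtain S where S: "finite S" "S \<subseteq> carrier M"
    "\<And>H. \<lbrakk>S \<subseteq> H; H \<subseteq> carrier M; \<zero>\<^bsub>M\<^esub> \<in> H; \<forall>x\<in>H. \<forall>y\<in>H. x \<oplus>\<^bsub>M\<^esub> y \<in> H;
      \<forall>a\<in>carrier L. \<forall>x\<in>H. a \<odot>\<^bsub>M\<^esub> x \<in> H\<rbrakk> \<Longrightarrow> carrier M \<subseteq> H"
    using fM unfolding fg_left_module_iff_closure by metis
  obtain T where T: "finite T" "T \<subseteq> carrier N"
    "\<And>H. \<lbrakk>T \<subseteq> H; H \<subseteq> carrier N; \<zero>\<^bsub>N\<^esub> \<in> H; \<forall>x\<in>H. \<forall>y\<in>H. x \<oplus>\<^bsub>N\<^esub> y \<in> H;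
      \<forall>a\<in>carrier L. \<forall>x\<in>H. a \<odot>\<^bsub>N\<^esub> x \<in> H\<rbrakk> \<Longrightarrow> carrier N \<subseteq> H"
    using fN unfolding fg_left_module_iff_closure by metis
  let ?i = "\<lambda>x\<in>carrier M. pr (x, \<zero>\<^bsub>N\<^esub>)" and ?j = "\<lambda>x\<in>carrier N. pr (\<zero>\<^bsub>M\<^esub>, x)"
  note ih = dsum_inl_hom[OF inf lM lN] and jh = dsum_inr_hom[OF inf lM lN]
  have lm: "left_module L (direct_sum M N)" by (rule left_module_dsum[OF inf lM lN])
  have "fg_left_module L (direct_sum M N)"
    unfolding fg_left_module_iff_closure
  proof (intro conjI exI[of _ "?i ` S \<union> ?j ` T"] allI impI lm)
    fix H assume H: "?i ` S \<union> ?j ` T \<subseteq> H \<and> H \<subseteq> carrier (direct_sum M N) \<and> \<zero>\<^bsub>direct_sum M N\<^esub> \<in> H \<and>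
      (\<forall>x\<in>H. \<forall>y\<in>H. x \<oplus>\<^bsub>direct_sum M N\<^esub> y \<in> H) \<and> (\<forall>a\<in>carrier L. \<forall>x\<in>H. a \<odot>\<^bsub>direct_sum M N\<^esub> x \<in> H)"
    \<comment> \<open>The preimage of \<open>H\<close> under the inclusion is a closed subset of
      \<open>M\<close> containing \<open>S\<close>, hence all of \<open>M\<close>.\<close>
    have 1: "carrier M \<subseteq> {x \<in> carrier M. ?i x \<in> H}"
    proof (rule S(3))
      show "S \<subseteq> {x \<in> carrier M. ?i x \<in> H}" using H S(2) by blast
      show "\<zero>\<^bsub>M\<^esub> \<in> {x \<in> carrier M. ?i x \<in> H}" using H lmod_hom_zero[OF lM lm ih] by simp
      show "\<forall>x\<in>{x \<in> carrier M. ?i x \<in> H}. \<forall>y\<in>{x \<in> carrier M. ?i x \<in> H}. x \<oplus>\<^bsub>M\<^esub> y \<in> {x \<in> carrier M. ?i x \<in> H}"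
        using H lmod_hom_add[OF ih] by (metis (no_types, lifting) M.M.a_closed mem_Collect_eq)
      show "\<forall>a\<in>carrier L. \<forall>x\<in>{x \<in> carrier M. ?i x \<in> H}. a \<odot>\<^bsub>M\<^esub> x \<in> {x \<in> carrier M. ?i x \<in> H}"
        using H lmod_hom_smult[OF ih] by (metis (no_types, lifting) M.smult_closed mem_Collect_eq)
    qed blast
    have 2: "carrier N \<subseteq> {x \<in> carrier N. ?j x \<in> H}"
    proof (rule T(3))
      show "T \<subseteq> {x \<in> carrier N. ?j x \<in> H}" using H T(2) by blast
      show "\<zero>\<^bsub>N\<^esub> \<in> {x \<in> carrier N. ?j x \<in> H}" using H lmod_hom_zero[OF lN lm jh] by simp
      show "\<forall>x\<in>{x \<in> carrier N. ?j x \<in> H}. \<forall>y\<in>{x \<in> carrier N. ?j x \<in> H}. x \<oplus>\<^bsub>N\<^esub> y \<in> {x \<in> carrier N. ?j x \<in> H}"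
        using H lmod_hom_add[OF jh] by (metis (no_types, lifting) N.M.a_closed mem_Collect_eq)
      show "\<forall>a\<in>carrier L. \<forall>x\<in>{x \<in> carrier N. ?j x \<in> H}. a \<odot>\<^bsub>N\<^esub> x \<in> {x \<in> carrier N. ?j x \<in> H}"
        using H lmod_hom_smult[OF jh] by (metis (no_types, lifting) N.smult_closed mem_Collect_eq)
    qed blast
    show "carrier (direct_sum M N) \<subseteq> H"
    proof
      fix z assume "z \<in> carrier (direct_sum M N)"
      then obtain x y where xy: "x \<in> carrier M" "y \<in> carrier N" "z = pr (x, y)" by (auto simp: dsum_simps)
      then have "z = ?i x \<oplus>\<^bsub>direct_sum M N\<^esub> ?j y" by (simp add: dsum_simps inv_pr[OF inf])
      moreover have "?i x \<in> H" "?j y \<in> H" using 1 2 xy by blast+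
      ultimately show "z \<in> H" using H by blast
    qed
  next
    show "?i ` S \<union> ?j ` T \<subseteq> carrier (direct_sum M N)"
      using S(2) T(2) lmod_hom_closed[OF ih] lmod_hom_closed[OF jh] by blast
  qed (use S(1) T(1) in simp)
  moreover have "\<exists>g \<in> lmod_hom L (direct_sum M N) A. compose (carrier (direct_sum M N)) p g = f"
    if A: "left_module L A" "left_module L B" "p \<in> lmod_hom L A B" "p ` carrier A = carrier B"
      "f \<in> lmod_hom L (direct_sum M N) B" for A B :: "('a, 'b) module" and p f
  proof -
    obtain g1 where g1: "g1 \<in> lmod_hom L M A" "\<And>x. x \<in> carrier M \<Longrightarrow> p (g1 x) = f (?i x)"
      using fg_projective_lift[OF M A(1-4) compose_lmod_hom[OF lM ih A(5)]] by (auto simp: compose_def)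
    obtain g2 where g2: "g2 \<in> lmod_hom L N A" "\<And>x. x \<in> carrier N \<Longrightarrow> p (g2 x) = f (?j x)"
      using fg_projective_lift[OF N A(1-4) compose_lmod_hom[OF lN jh A(5)]] by (auto simp: compose_def)
    let ?g = "\<lambda>x\<in>carrier (direct_sum M N). g1 (pr1 x) \<oplus>\<^bsub>A\<^esub> g2 (pr2 x)"
    have g: "?g \<in> lmod_hom L (direct_sum M N) A" by (rule dsum_copair_hom[OF inf lM lN A(1) g1(1) g2(1)])
    have "compose (carrier (direct_sum M N)) p ?g = f"
    proof (rule lmod_hom_eqI[OF compose_lmod_hom[OF lm g A(3)] A(5)])
      fix z assume z: "z \<in> carrier (direct_sum M N)"
      then obtain x y where xy: "x \<in> carrier M" "y \<in> carrier N" "z = pr (x, y)" by (auto simp: dsum_simps)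
      then have "z = ?i x \<oplus>\<^bsub>direct_sum M N\<^esub> ?j y" by (simp add: dsum_simps inv_pr[OF inf])
      then have "f z = f (?i x) \<oplus>\<^bsub>B\<^esub> f (?j y)"
        using lmod_hom_add[OF A(5) lmod_hom_closed[OF ih xy(1)] lmod_hom_closed[OF jh xy(2)]] by metis
      then show "compose (carrier (direct_sum M N)) p ?g z = f z"
        using z xy g1(2) g2(2) lmod_hom_add[OF A(3) lmod_hom_closed[OF g1(1) xy(1)] lmod_hom_closed[OF g2(1) xy(2)]]
        by (simp add: compose_def inv_pr[OF inf])
    qed
    then show ?thesis using g by blast
  qed
  ultimately show ?thesis
    using lm unfolding fg_projective_def projective_left_module_def by blast
qed

section \<open>The category of morphisms between projectives\<close>

abbreviation \<P> ::
    "('a, 'c) ring_scheme \<Rightarrow> (('a, 'b) arrow, ('b \<Rightarrow> 'b) \<times> ('b \<Rightarrow> 'b)) excat"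
  where "\<P> L \<equiv> proj_morphism_category L"

section \<open>Objects, morphisms and composition in components\<close>

lemma Ob_iff: "X \<in> Ob (\<P> L) \<longleftrightarrow> fg_projective L (src X) \<and> fg_projective L (tgt X) \<and>
    arr X \<in> lmod_hom L (src X) (tgt X)"
  by (auto simp: proj_morphism_category_def full_exact_subcategory_def morphism_category_def
      morphism_objects_def fg_projective_def)

lemma HomG_eq: "HomG (\<P> L) X Y = HomG (morphism_category L) X Y"
  by (simp add: proj_morphism_category_def full_exact_subcategory_def)

lemma Cmp_eq: "Cmp (\<P> L) = Cmp (morphism_category L)"
  by (simp add: proj_morphism_category_def full_exact_subcategory_def)

text \<open>Both composites are \<open>undefined\<close> off \<open>A\<close>, so only values on
  \<open>A\<close> matter.\<close>

lemma compose_eq_iff: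
  "compose A g f = compose A g' f' \<longleftrightarrow> (\<forall>x\<in>A. g (f x) = g' (f' x))"
  unfolding compose_def fun_eq_iff by auto

lemma Hom_iff: "s \<in> Hom (\<P> L) X Y \<longleftrightarrow> fst s \<in> lmod_hom L (src X) (src Y) \<and>
    snd s \<in> lmod_hom L (tgt X) (tgt Y) \<and>
    (\<forall>x\<in>carrier (src X). snd s (arr X x) = arr Y (fst s x))"
  by (cases s) (auto simp: HomG_eq morphism_category_def morphism_homs_def compose_eq_iff)

lemma fst_Cmp: "x \<in> carrier (src X) \<Longrightarrow> fst (Cmp (\<P> L) X Y Z g f) x = fst g (fst f x)"
  by (simp add: Cmp_eq morphism_category_def case_prod_beta compose_def)

lemma snd_Cmp: "x \<in> carrier (tgt X) \<Longrightarrow> snd (Cmp (\<P> L) X Y Z g f) x = snd g (snd f x)"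
  by (simp add: Cmp_eq morphism_category_def case_prod_beta compose_def)

lemma fst_Idm: "x \<in> carrier (src X) \<Longrightarrow> fst (Idm (\<P> L) X) x = x"
  by (simp add: proj_morphism_category_def full_exact_subcategory_def morphism_category_def)

lemma snd_Idm: "x \<in> carrier (tgt X) \<Longrightarrow> snd (Idm (\<P> L) X) x = x"
  by (simp add: proj_morphism_category_def full_exact_subcategory_def morphism_category_def)

lemma fst_Hzero: "x \<in> carrier (src X) \<Longrightarrow> fst (Hzero (\<P> L) X Y) x = \<zero>\<^bsub>src Y\<^esub>"
  by (simp add: HomG_eq morphism_category_def lmod_zero_def)

lemma snd_Hzero: "x \<in> carrier (tgt X) \<Longrightarrow> snd (Hzero (\<P> L) X Y) x = \<zero>\<^bsub>tgt Y\<^esub>"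
  by (simp add: HomG_eq morphism_category_def lmod_zero_def)

lemma fst_Hadd: "x \<in> carrier (src X) \<Longrightarrow> fst (f \<otimes>\<^bsub>HomG (\<P> L) X Y\<^esub> g) x = fst f x \<oplus>\<^bsub>src Y\<^esub> fst g x"
  by (simp add: HomG_eq morphism_category_def lmod_add_def case_prod_beta)

lemma snd_Hadd: "x \<in> carrier (tgt X) \<Longrightarrow> snd (f \<otimes>\<^bsub>HomG (\<P> L) X Y\<^esub> g) x = snd f x \<oplus>\<^bsub>tgt Y\<^esub> snd g x"
  by (simp add: HomG_eq morphism_category_def lmod_add_def case_prod_beta)

lemmas component_simps = fst_Cmp snd_Cmp fst_Idm snd_Idm fst_Hzero snd_Hzero fst_Hadd snd_Hadd

lemma Ob_left_module:
  assumes "X \<in> Ob (\<P> L)"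
  shows "left_module L (src X)" "left_module L (tgt X)"
  using assms by (auto simp: Ob_iff fg_projective_left_module)

lemma Ob_arr:
  assumes "X \<in> Ob (\<P> L)"
  shows "arr X \<in> lmod_hom L (src X) (tgt X)"
  using assms by (auto simp: Ob_iff)

lemma Hom_component:
  assumes "f \<in> Hom (\<P> L) X Y"
  shows "fst f \<in> lmod_hom L (src X) (src Y)" "snd f \<in> lmod_hom L (tgt X) (tgt Y)"
  using assms by (auto simp: Hom_iff)

lemma Hom_commute:
  assumes "f \<in> Hom (\<P> L) X Y" "x \<in> carrier (src X)"
  shows "snd f (arr X x) = arr Y (fst f x)"
  using assms by (auto simp: Hom_iff)

lemma Hom_closed:
  assumes "f \<in> Hom (\<P> L) X Y"
  shows "x \<in> carrier (src X) \<Longrightarrow> fst f x \<in> carrier (src Y)"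
    "x \<in> carrier (tgt X) \<Longrightarrow> snd f x \<in> carrier (tgt Y)"
  using Hom_component[OF assms] by (auto intro: lmod_hom_closed)

lemma Hom_add:
  assumes "f \<in> Hom (\<P> L) X Y"
  shows "\<lbrakk>x \<in> carrier (src X); y \<in> carrier (src X)\<rbrakk> \<Longrightarrow> fst f (x \<oplus>\<^bsub>src X\<^esub> y) = fst f x \<oplus>\<^bsub>src Y\<^esub> fst f y"
    "\<lbrakk>x \<in> carrier (tgt X); y \<in> carrier (tgt X)\<rbrakk> \<Longrightarrow> snd f (x \<oplus>\<^bsub>tgt X\<^esub> y) = snd f x \<oplus>\<^bsub>tgt Y\<^esub> snd f y"
  using Hom_component[OF assms] by (auto intro: lmod_hom_add)

lemma Hom_zero:
  assumes "X \<in> Ob (\<P> L)" "Y \<in> Ob (\<P> L)" "f \<in> Hom (\<P> L) X Y"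
  shows "fst f \<zero>\<^bsub>src X\<^esub> = \<zero>\<^bsub>src Y\<^esub>" "snd f \<zero>\<^bsub>tgt X\<^esub> = \<zero>\<^bsub>tgt Y\<^esub>"
  using Hom_component[OF assms(3)] assms(1,2) by (auto intro!: lmod_hom_zero simp: Ob_left_module)

text \<open>Components are extensional functions, so agreement on the carriers is equality. Together
  with \<open>component_simps\<close> this turns an equation of morphisms into a pair of pointwise
  identities.\<close>

lemma Hom_eq_iff:
  assumes "f \<in> Hom (\<P> L) X Y" "g \<in> Hom (\<P> L) X Y"
  shows "f = g \<longleftrightarrow> (\<forall>x\<in>carrier (src X). fst f x = fst g x) \<and> (\<forall>x\<in>carrier (tgt X). snd f x = snd g x)"
  using Hom_component[OF assms(1)] Hom_component[OF assms(2)]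
  by (auto simp: prod_eq_iff intro!: lmod_hom_eqI)

lemma Idm_Hom: "X \<in> Ob (\<P> L) \<Longrightarrow> Idm (\<P> L) X \<in> Hom (\<P> L) X X"
  using lmod_hom_closed[OF Ob_arr[of X L]]
  by (auto simp: Hom_iff component_simps)
    (simp_all add: proj_morphism_category_def full_exact_subcategory_def morphism_category_def
      id_lmod_hom Ob_left_module[unfolded proj_morphism_category_def])

lemma Cmp_Hom:
  assumes "X \<in> Ob (\<P> L)" "f \<in> Hom (\<P> L) X Y" "g \<in> Hom (\<P> L) Y Z"
  shows "Cmp (\<P> L) X Y Z g f \<in> Hom (\<P> L) X Z"
proof -
  have "fst (Cmp (\<P> L) X Y Z g f) = compose (carrier (src X)) (fst g) (fst f)"
    "snd (Cmp (\<P> L) X Y Z g f) = compose (carrier (tgt X)) (snd g) (snd f)"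
    by (simp_all add: Cmp_eq morphism_category_def case_prod_beta)
  then show ?thesis
    using compose_lmod_hom[OF Ob_left_module(1)[OF assms(1)] Hom_component(1)[OF assms(2)] Hom_component(1)[OF assms(3)]]
      compose_lmod_hom[OF Ob_left_module(2)[OF assms(1)] Hom_component(2)[OF assms(2)] Hom_component(2)[OF assms(3)]]
      lmod_hom_closed[OF Ob_arr[OF assms(1)]] Hom_closed(1)[OF assms(2)]
    by (simp add: Hom_iff compose_def) (simp add: Hom_commute[OF assms(2)] Hom_commute[OF assms(3)])
qed

lemma Hzero_Hom:
  assumes "X \<in> Ob (\<P> L)" "Y \<in> Ob (\<P> L)"
  shows "Hzero (\<P> L) X Y \<in> Hom (\<P> L) X Y"
proof -
  have "Hzero (\<P> L) X Y = (lmod_zero (src X) (src Y), lmod_zero (tgt X) (tgt Y))"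
    by (simp add: HomG_eq morphism_category_def)
  then show ?thesis
    using Ob_left_module[OF assms(1)] Ob_left_module[OF assms(2)] Ob_arr[OF assms(2)]
      lmod_hom_closed[OF Ob_arr[OF assms(1)]]
    by (simp add: Hom_iff lmod_zero_hom) (simp add: lmod_zero_def lmod_hom_zero)
qed

lemma Hadd_Hom:
  assumes "X \<in> Ob (\<P> L)" "Y \<in> Ob (\<P> L)" "f \<in> Hom (\<P> L) X Y" "g \<in> Hom (\<P> L) X Y"
  shows "f \<otimes>\<^bsub>HomG (\<P> L) X Y\<^esub> g \<in> Hom (\<P> L) X Y"
proof -
  have "f \<otimes>\<^bsub>HomG (\<P> L) X Y\<^esub> g
      = (lmod_add (src X) (src Y) (fst f) (fst g), lmod_add (tgt X) (tgt Y) (snd f) (snd g))"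
    by (simp add: HomG_eq morphism_category_def case_prod_beta)
  then show ?thesis
    using Ob_left_module[OF assms(1)] Ob_left_module[OF assms(2)] Ob_arr[OF assms(2)]
      lmod_hom_closed[OF Ob_arr[OF assms(1)]] assms(3,4)
    by (simp add: Hom_iff lmod_add_hom) (simp add: lmod_add_def lmod_hom_add[OF Ob_arr[OF assms(2)]] Hom_closed[OF assms(3)] Hom_closed[OF assms(4)])
qed

section \<open>Hom groups, zero object and biproducts\<close>

lemma HomG_group:
  assumes "X \<in> Ob (\<P> L)" "Y \<in> Ob (\<P> L)"
  shows "comm_group (HomG (\<P> L) X Y)"
proof -
  note mX = Ob_left_module[OF assms(1)] and mY = Ob_left_module[OF assms(2)]
  interpret s: left_module L "src Y" by (rule mY)
  interpret t: left_module L "tgt Y" by (rule mY)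
  note cl = Hadd_Hom[OF assms] Hzero_Hom[OF assms]
  show ?thesis
  proof (rule comm_groupI)
    fix f assume f: "f \<in> Hom (\<P> L) X Y"
    \<comment> \<open>The componentwise negative is a morphism because \<open>arr Y\<close>
      preserves negatives.\<close>
    let ?g = "(\<lambda>x\<in>carrier (src X). \<ominus>\<^bsub>src Y\<^esub> fst f x, \<lambda>x\<in>carrier (tgt X). \<ominus>\<^bsub>tgt Y\<^esub> snd f x)"
    have g: "?g \<in> Hom (\<P> L) X Y"
      using f mX mY lmod_hom_closed[OF Ob_arr[OF assms(1)]]
      by (auto simp: Hom_iff minus_lmod_hom lmod_hom_minus[OF mY Ob_arr[OF assms(2)]] lmod_hom_closed)
    then have "?g \<otimes>\<^bsub>HomG (\<P> L) X Y\<^esub> f = Hzero (\<P> L) X Y"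
      using f Hom_closed[OF f] by (subst Hom_eq_iff[where L = L and X = X and Y = Y]) (auto intro: cl simp: component_simps s.M.l_neg t.M.l_neg)
    with g show "\<exists>g\<in>Hom (\<P> L) X Y. g \<otimes>\<^bsub>HomG (\<P> L) X Y\<^esub> f = Hzero (\<P> L) X Y" by blast
  next
    fix f g assume "f \<in> Hom (\<P> L) X Y" "g \<in> Hom (\<P> L) X Y"
    then show "f \<otimes>\<^bsub>HomG (\<P> L) X Y\<^esub> g = g \<otimes>\<^bsub>HomG (\<P> L) X Y\<^esub> f"
      by (subst Hom_eq_iff[where L = L and X = X and Y = Y]) (auto simp: cl component_simps Hom_closed s.M.a_comm t.M.a_comm)
  next
    fix f g h assume "f \<in> Hom (\<P> L) X Y" "g \<in> Hom (\<P> L) X Y" "h \<in> Hom (\<P> L) X Y"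
    then show "f \<otimes>\<^bsub>HomG (\<P> L) X Y\<^esub> g \<otimes>\<^bsub>HomG (\<P> L) X Y\<^esub> h
        = f \<otimes>\<^bsub>HomG (\<P> L) X Y\<^esub> (g \<otimes>\<^bsub>HomG (\<P> L) X Y\<^esub> h)"
      by (subst Hom_eq_iff[where L = L and X = X and Y = Y]) (auto simp: cl component_simps Hom_closed s.M.a_assoc t.M.a_assoc)
  next
    fix f assume "f \<in> Hom (\<P> L) X Y"
    then show "Hzero (\<P> L) X Y \<otimes>\<^bsub>HomG (\<P> L) X Y\<^esub> f = f"
      by (subst Hom_eq_iff[where L = L and X = X and Y = Y]) (auto simp: cl component_simps Hom_closed)
  qed (auto intro: cl)
qed

text \<open>Both carriers of \<open>Z\<close> are singletons: a morphism into \<open>Z\<close> has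
  only one possible value, and a morphism out of \<open>Z\<close> is fixed because homomorphisms
  preserve zero. So each agrees with the zero morphism.\<close>

lemma zero_object_exists:
  fixes L :: "('a, 'c) ring_scheme"
  assumes "ring L"
  shows "\<exists>Z \<in> Ob (\<P> L :: (('a, 'b) arrow, ('b \<Rightarrow> 'b) \<times> ('b \<Rightarrow> 'b)) excat). \<forall>X \<in> Ob (\<P> L). (\<exists>!f. f \<in> Hom (\<P> L) X Z) \<and> (\<exists>!f. f \<in> Hom (\<P> L) Z X)"
proof -
  define Z :: "('a, 'b) arrow"
    where "Z = \<lparr>src = zero_module, tgt = zero_module,
      arr = lmod_zero (zero_module :: ('a, 'b) module) (zero_module :: ('a, 'b) module)\<rparr>"
  have z: "left_module L (zero_module :: ('a, 'b) module)"
    "carrier (zero_module :: ('a, 'b) module) = {\<zero>\<^bsub>zero_module :: ('a, 'b) module\<^esub>}"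
    using zero_module[OF assms] by blast+
  have Z: "Z \<in> Ob (\<P> L)"
    using fg_projective_trivial[OF z] lmod_zero_hom[OF z(1) z(1)] by (simp add: Z_def Ob_iff)
  have carrier_Z: "carrier (src Z) = {\<zero>\<^bsub>src Z\<^esub>}" "carrier (tgt Z) = {\<zero>\<^bsub>tgt Z\<^esub>}"
    unfolding Z_def arrow.simps by (rule z(2))+
  show ?thesis
  proof (intro bexI[OF _ Z] ballI conjI)
    fix X :: "('a, 'b) arrow" assume X: "X \<in> Ob (\<P> L)"
    have "f = Hzero (\<P> L) X Z" if f: "f \<in> Hom (\<P> L) X Z" for f
      using Hom_closed[OF f] by (subst Hom_eq_iff[OF f Hzero_Hom[OF X Z]]) (auto simp: component_simps carrier_Z)
    then show "\<exists>!f. f \<in> Hom (\<P> L) X Z" using Hzero_Hom[OF X Z] by blast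
    have "f = Hzero (\<P> L) Z X" if f: "f \<in> Hom (\<P> L) Z X" for f
      using Hom_zero[OF Z X f] by (subst Hom_eq_iff[OF f Hzero_Hom[OF Z X]]) (auto simp: component_simps carrier_Z)
    then show "\<exists>!f. f \<in> Hom (\<P> L) Z X" using Hzero_Hom[OF Z X] by blast
  qed
qed

definition dsum_arrow :: "('a, 'b) arrow \<Rightarrow> ('a, 'b) arrow \<Rightarrow> ('a, 'b) arrow"
  where "dsum_arrow X Y = \<lparr>src = direct_sum (src X) (src Y), tgt = direct_sum (tgt X) (tgt Y),
    arr = (\<lambda>z\<in>carrier (direct_sum (src X) (src Y)). pr (arr X (pr1 z), arr Y (pr2 z)))\<rparr>"

definition inl_arrow :: "('a, 'b) arrow \<Rightarrow> ('a, 'b) arrow \<Rightarrow> ('b \<Rightarrow> 'b) \<times> ('b \<Rightarrow> 'b)"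
  where "inl_arrow X Y = (\<lambda>x\<in>carrier (src X). pr (x, \<zero>\<^bsub>src Y\<^esub>), \<lambda>x\<in>carrier (tgt X). pr (x, \<zero>\<^bsub>tgt Y\<^esub>))"

definition inr_arrow :: "('a, 'b) arrow \<Rightarrow> ('a, 'b) arrow \<Rightarrow> ('b \<Rightarrow> 'b) \<times> ('b \<Rightarrow> 'b)"
  where "inr_arrow X Y = (\<lambda>y\<in>carrier (src Y). pr (\<zero>\<^bsub>src X\<^esub>, y), \<lambda>y\<in>carrier (tgt Y). pr (\<zero>\<^bsub>tgt X\<^esub>, y))"

definition prl_arrow :: "('a, 'b) arrow \<Rightarrow> ('a, 'b) arrow \<Rightarrow> ('b \<Rightarrow> 'b) \<times> ('b \<Rightarrow> 'b)"
  where "prl_arrow X Y = (\<lambda>z\<in>carrier (direct_sum (src X) (src Y)). pr1 z, \<lambda>z\<in>carrier (direct_sum (tgt X) (tgt Y)). pr1 z)"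

definition prr_arrow :: "('a, 'b) arrow \<Rightarrow> ('a, 'b) arrow \<Rightarrow> ('b \<Rightarrow> 'b) \<times> ('b \<Rightarrow> 'b)"
  where "prr_arrow X Y = (\<lambda>z\<in>carrier (direct_sum (src X) (src Y)). pr2 z, \<lambda>z\<in>carrier (direct_sum (tgt X) (tgt Y)). pr2 z)"

definition pair_arrow :: "('a, 'b) arrow \<Rightarrow> ('b \<Rightarrow> 'b) \<times> ('b \<Rightarrow> 'b) \<Rightarrow> ('b \<Rightarrow> 'b) \<times> ('b \<Rightarrow> 'b) \<Rightarrow> ('b \<Rightarrow> 'b) \<times> ('b \<Rightarrow> 'b)"
  where "pair_arrow W u v = (\<lambda>w\<in>carrier (src W). pr (fst u w, fst v w), \<lambda>w\<in>carrier (tgt W). pr (snd u w, snd v w))"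

definition copair_arrow :: "('a, 'b) arrow \<Rightarrow> ('a, 'b) arrow \<Rightarrow> ('a, 'b) arrow \<Rightarrow>
    ('b \<Rightarrow> 'b) \<times> ('b \<Rightarrow> 'b) \<Rightarrow> ('b \<Rightarrow> 'b) \<times> ('b \<Rightarrow> 'b) \<Rightarrow> ('b \<Rightarrow> 'b) \<times> ('b \<Rightarrow> 'b)"
  where "copair_arrow X Y W u v =
    (\<lambda>z\<in>carrier (direct_sum (src X) (src Y)). fst u (pr1 z) \<oplus>\<^bsub>src W\<^esub> fst v (pr2 z),
     \<lambda>z\<in>carrier (direct_sum (tgt X) (tgt Y)). snd u (pr1 z) \<oplus>\<^bsub>tgt W\<^esub> snd v (pr2 z))"

lemma dsum_arrow_simps [simp]:
  "src (dsum_arrow X Y) = direct_sum (src X) (src Y)" "tgt (dsum_arrow X Y) = direct_sum (tgt X) (tgt Y)"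
  by (simp_all add: dsum_arrow_def)

lemma dsum_carrierE:
  assumes "z \<in> carrier (direct_sum M N)"
  obtains x y where "x \<in> carrier M" "y \<in> carrier N" "z = pr (x, y)"
  using assms by (auto simp: dsum_simps)

lemma pr_inv:
  fixes M N :: "('a, 'b) module"
  assumes "infinite (UNIV :: 'b set)" "z \<in> carrier (direct_sum M N)"
  shows "pr (inv_into UNIV pr z) = z"
  using assms by (auto simp: inv_pr elim!: dsum_carrierE)

lemma dsum_carrierI: "\<lbrakk>x \<in> carrier M; y \<in> carrier N\<rbrakk> \<Longrightarrow> pr (x, y) \<in> carrier (direct_sum M N)"
  by (auto simp: dsum_simps)

context
  fixes X Y :: "('a, 'b) arrow" and L :: "('a, 'c) ring_scheme"
  assumes inf: "infinite (UNIV :: 'b set)" and X: "X \<in> Ob (\<P> L)" and Y: "Y \<in> Ob (\<P> L)"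
begin

lemmas mX = Ob_left_module[OF X]
lemmas mY = Ob_left_module[OF Y]

interpretation sX: left_module L "src X" by (rule mX)
interpretation tX: left_module L "tgt X" by (rule mX)
interpretation sY: left_module L "src Y" by (rule mY)
interpretation tY: left_module L "tgt Y" by (rule mY)

lemma arr_dsum_arrow: "\<lbrakk>x \<in> carrier (src X); y \<in> carrier (src Y)\<rbrakk> \<Longrightarrow>
    arr (dsum_arrow X Y) (pr (x, y)) = pr (arr X x, arr Y y)"
  by (simp add: dsum_arrow_def dsum_carrierI inv_pr[OF inf])

lemma dsum_arrow_Ob: "dsum_arrow X Y \<in> Ob (\<P> L)"
proof -
  have "arr (dsum_arrow X Y) \<in> lmod_hom L (direct_sum (src X) (src Y)) (direct_sum (tgt X) (tgt Y))"
    unfolding dsum_arrow_def arrow.simps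
    by (intro restrict_lmod_hom left_module_dsum inf mX mY)
      (auto simp: dsum_simps inv_pr[OF inf] lmod_hom_closed[OF Ob_arr[OF X]] lmod_hom_closed[OF Ob_arr[OF Y]]
        lmod_hom_add[OF Ob_arr[OF X]] lmod_hom_add[OF Ob_arr[OF Y]]
        lmod_hom_smult[OF Ob_arr[OF X]] lmod_hom_smult[OF Ob_arr[OF Y]])
  then show ?thesis
    using X Y inf by (simp add: Ob_iff fg_projective_dsum)
qed

lemma inl_arrow_Hom: "inl_arrow X Y \<in> Hom (\<P> L) X (dsum_arrow X Y)"
  using dsum_inl_hom[OF inf mX(1) mY(1)] dsum_inl_hom[OF inf mX(2) mY(2)]
  by (simp add: Hom_iff inl_arrow_def arr_dsum_arrow lmod_hom_closed[OF Ob_arr[OF X]]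
      lmod_hom_zero[OF mY Ob_arr[OF Y]])

lemma inr_arrow_Hom: "inr_arrow X Y \<in> Hom (\<P> L) Y (dsum_arrow X Y)"
  using dsum_inr_hom[OF inf mX(1) mY(1)] dsum_inr_hom[OF inf mX(2) mY(2)]
  by (simp add: Hom_iff inr_arrow_def arr_dsum_arrow lmod_hom_closed[OF Ob_arr[OF Y]]
      lmod_hom_zero[OF mX Ob_arr[OF X]])

lemma prl_arrow_Hom: "prl_arrow X Y \<in> Hom (\<P> L) (dsum_arrow X Y) X"
  using dsum_pr1_hom[OF inf mX(1) mY(1)] dsum_pr1_hom[OF inf mX(2) mY(2)]
  by (auto simp: Hom_iff prl_arrow_def arr_dsum_arrow lmod_hom_closed[OF Ob_arr[OF X]]
      lmod_hom_closed[OF Ob_arr[OF Y]] inv_pr[OF inf] pr_eq_iff[OF inf] dsum_carrierI elim!: dsum_carrierE)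

lemma prr_arrow_Hom: "prr_arrow X Y \<in> Hom (\<P> L) (dsum_arrow X Y) Y"
  using dsum_pr2_hom[OF inf mX(1) mY(1)] dsum_pr2_hom[OF inf mX(2) mY(2)]
  by (auto simp: Hom_iff prr_arrow_def arr_dsum_arrow lmod_hom_closed[OF Ob_arr[OF X]]
      lmod_hom_closed[OF Ob_arr[OF Y]] inv_pr[OF inf] pr_eq_iff[OF inf] dsum_carrierI elim!: dsum_carrierE)

lemma pair_arrow_Hom:
  assumes "W \<in> Ob (\<P> L)" "u \<in> Hom (\<P> L) W X" "v \<in> Hom (\<P> L) W Y"
  shows "pair_arrow W u v \<in> Hom (\<P> L) W (dsum_arrow X Y)"
  using Ob_left_module[OF assms(1)] Hom_component[OF assms(2)] Hom_component[OF assms(3)]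
  by (auto simp: Hom_iff pair_arrow_def arr_dsum_arrow lmod_hom_closed[OF Ob_arr[OF assms(1)]]
      Hom_closed[OF assms(2)] Hom_closed[OF assms(3)] Hom_commute[OF assms(2)] Hom_commute[OF assms(3)]
      intro!: dsum_pair_hom inf mX mY)

lemma copair_arrow_Hom:
  assumes "W \<in> Ob (\<P> L)" "u \<in> Hom (\<P> L) X W" "v \<in> Hom (\<P> L) Y W"
  shows "copair_arrow X Y W u v \<in> Hom (\<P> L) (dsum_arrow X Y) W"
  using Ob_left_module[OF assms(1)] Hom_component[OF assms(2)] Hom_component[OF assms(3)]
  by (auto simp: Hom_iff copair_arrow_def arr_dsum_arrow inv_pr[OF inf] pr_eq_iff[OF inf] dsum_carrierI
      Hom_closed[OF assms(2)] Hom_closed[OF assms(3)] Hom_commute[OF assms(2)] Hom_commute[OF assms(3)]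
      lmod_hom_add[OF Ob_arr[OF assms(1)]] lmod_hom_closed[OF Ob_arr[OF X]] lmod_hom_closed[OF Ob_arr[OF Y]]
      intro!: dsum_copair_hom inf mX mY elim!: dsum_carrierE)

text \<open>The biproduct is the direct sum taken in each component; at a coded pair (x, y) the last
  identity reads (x, 0) + (0, y) = (x, y).\<close>

lemma biproduct_exists:
  "\<exists>B \<in> Ob (\<P> L). \<exists>i1 \<in> Hom (\<P> L) X B. \<exists>i2 \<in> Hom (\<P> L) Y B. \<exists>p1 \<in> Hom (\<P> L) B X. \<exists>p2 \<in> Hom (\<P> L) B Y.
    Cmp (\<P> L) X B X p1 i1 = Idm (\<P> L) X \<and> Cmp (\<P> L) Y B Y p2 i2 = Idm (\<P> L) Y \<and>
    Cmp (\<P> L) Y B X p1 i2 = Hzero (\<P> L) Y X \<and> Cmp (\<P> L) X B Y p2 i1 = Hzero (\<P> L) X Y \<and>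
    Cmp (\<P> L) B X B i1 p1 \<otimes>\<^bsub>HomG (\<P> L) B B\<^esub> Cmp (\<P> L) B Y B i2 p2 = Idm (\<P> L) B"
proof (intro bexI conjI)
  note homs = inl_arrow_Hom inr_arrow_Hom prl_arrow_Hom prr_arrow_Hom Idm_Hom[OF X] Idm_Hom[OF Y]
    Idm_Hom[OF dsum_arrow_Ob] Hzero_Hom[OF X Y] Hzero_Hom[OF Y X]
  note Cmps = Cmp_Hom[OF X] Cmp_Hom[OF Y] Cmp_Hom[OF dsum_arrow_Ob] Hadd_Hom[OF dsum_arrow_Ob dsum_arrow_Ob]
  note simps = component_simps inl_arrow_def inr_arrow_def prl_arrow_def prr_arrow_def inv_pr[OF inf] dsum_carrierI
  show "Cmp (\<P> L) X (dsum_arrow X Y) X (prl_arrow X Y) (inl_arrow X Y) = Idm (\<P> L) X"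
    by (subst Hom_eq_iff[OF Cmps(1)[OF homs(1,3)] homs(5)]) (auto simp: simps)
  show "Cmp (\<P> L) Y (dsum_arrow X Y) Y (prr_arrow X Y) (inr_arrow X Y) = Idm (\<P> L) Y"
    by (subst Hom_eq_iff[OF Cmps(2)[OF homs(2,4)] homs(6)]) (auto simp: simps)
  show "Cmp (\<P> L) Y (dsum_arrow X Y) X (prl_arrow X Y) (inr_arrow X Y) = Hzero (\<P> L) Y X"
    by (subst Hom_eq_iff[OF Cmps(2)[OF homs(2,3)] homs(9)]) (auto simp: simps)
  show "Cmp (\<P> L) X (dsum_arrow X Y) Y (prr_arrow X Y) (inl_arrow X Y) = Hzero (\<P> L) X Y"
    by (subst Hom_eq_iff[OF Cmps(1)[OF homs(1,4)] homs(8)]) (auto simp: simps)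
  show "Cmp (\<P> L) (dsum_arrow X Y) X (dsum_arrow X Y) (inl_arrow X Y) (prl_arrow X Y)
      \<otimes>\<^bsub>HomG (\<P> L) (dsum_arrow X Y) (dsum_arrow X Y)\<^esub>
      Cmp (\<P> L) (dsum_arrow X Y) Y (dsum_arrow X Y) (inr_arrow X Y) (prr_arrow X Y) = Idm (\<P> L) (dsum_arrow X Y)"
    by (subst Hom_eq_iff[OF Cmps(4)[OF Cmps(3)[OF homs(3,1)] Cmps(3)[OF homs(4,2)]] homs(7)])
      (auto simp: simps dsum_simps(3) elim!: dsum_carrierE)
qed (rule dsum_arrow_Ob inl_arrow_Hom inr_arrow_Hom prl_arrow_Hom prr_arrow_Hom)+

end

lemma additive_category_proj_morphism:
  fixes L :: "('a, 'c) ring_scheme"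
  assumes "ring L" "infinite (UNIV :: 'b set)"
  shows "additive_category (\<P> L :: (('a, 'b) arrow, ('b \<Rightarrow> 'b) \<times> ('b \<Rightarrow> 'b)) excat)"
proof (rule additive_category.intro)
  fix X Y :: "('a, 'b) arrow" and f
  assume XY: "X \<in> Ob (\<P> L)" "Y \<in> Ob (\<P> L)" and f: "f \<in> Hom (\<P> L) X Y"
  show "Cmp (\<P> L) X X Y f (Idm (\<P> L) X) = f"
    by (subst Hom_eq_iff[OF Cmp_Hom[OF XY(1) Idm_Hom[OF XY(1)] f] f]) (auto simp: component_simps)
  show "Cmp (\<P> L) X Y Y (Idm (\<P> L) Y) f = f"
    by (subst Hom_eq_iff[OF Cmp_Hom[OF XY(1) f Idm_Hom[OF XY(2)]] f]) (auto simp: component_simps Hom_closed[OF f])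
next
  fix W X Y Z :: "('a, 'b) arrow" and f g h
  assume Ob: "W \<in> Ob (\<P> L)" "X \<in> Ob (\<P> L)" "Y \<in> Ob (\<P> L)" "Z \<in> Ob (\<P> L)"
    and f: "f \<in> Hom (\<P> L) W X" and g: "g \<in> Hom (\<P> L) X Y" and h: "h \<in> Hom (\<P> L) Y Z"
  show "Cmp (\<P> L) W Y Z h (Cmp (\<P> L) W X Y g f) = Cmp (\<P> L) W X Z (Cmp (\<P> L) X Y Z h g) f"
    by (subst Hom_eq_iff[OF Cmp_Hom[OF Ob(1) Cmp_Hom[OF Ob(1) f g] h] Cmp_Hom[OF Ob(1) f Cmp_Hom[OF Ob(2) g h]]])
      (auto simp: component_simps Hom_closed[OF f])
next
  fix X Y Z :: "('a, 'b) arrow" and f f' g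
  assume Ob: "X \<in> Ob (\<P> L)" "Y \<in> Ob (\<P> L)" "Z \<in> Ob (\<P> L)"
    and f: "f \<in> Hom (\<P> L) X Y" "f' \<in> Hom (\<P> L) X Y" and g: "g \<in> Hom (\<P> L) Y Z"
  show "Cmp (\<P> L) X Y Z g (f \<otimes>\<^bsub>HomG (\<P> L) X Y\<^esub> f')
      = Cmp (\<P> L) X Y Z g f \<otimes>\<^bsub>HomG (\<P> L) X Z\<^esub> Cmp (\<P> L) X Y Z g f'"
    by (subst Hom_eq_iff[OF Cmp_Hom[OF Ob(1) Hadd_Hom[OF Ob(1,2) f] g]
        Hadd_Hom[OF Ob(1,3) Cmp_Hom[OF Ob(1) f(1) g] Cmp_Hom[OF Ob(1) f(2) g]]])
      (auto simp: component_simps Hom_closed[OF f(1)] Hom_closed[OF f(2)] Hom_add[OF g])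
next
  fix X Y Z :: "('a, 'b) arrow" and f g g'
  assume Ob: "X \<in> Ob (\<P> L)" "Y \<in> Ob (\<P> L)" "Z \<in> Ob (\<P> L)"
    and f: "f \<in> Hom (\<P> L) X Y" and g: "g \<in> Hom (\<P> L) Y Z" "g' \<in> Hom (\<P> L) Y Z"
  show "Cmp (\<P> L) X Y Z (g \<otimes>\<^bsub>HomG (\<P> L) Y Z\<^esub> g') f
      = Cmp (\<P> L) X Y Z g f \<otimes>\<^bsub>HomG (\<P> L) X Z\<^esub> Cmp (\<P> L) X Y Z g' f"
    by (subst Hom_eq_iff[OF Cmp_Hom[OF Ob(1) f Hadd_Hom[OF Ob(2,3) g]]
        Hadd_Hom[OF Ob(1,3) Cmp_Hom[OF Ob(1) f g(1)] Cmp_Hom[OF Ob(1) f g(2)]]])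
      (auto simp: component_simps Hom_closed[OF f])
next
  show "\<exists>Z \<in> Ob (\<P> L :: (('a, 'b) arrow, _) excat). \<forall>X \<in> Ob (\<P> L). (\<exists>!f. f \<in> Hom (\<P> L) X Z) \<and> (\<exists>!f. f \<in> Hom (\<P> L) Z X)"
    by (rule zero_object_exists[OF assms(1)])
qed ((rule Idm_Hom Cmp_Hom HomG_group biproduct_exists[OF assms(2)]; assumption)+)

section \<open>Conflations\<close>

lemma Confl_iff:
  "(X, i, Y, d, Z) \<in> Confl (\<P> L) \<longleftrightarrow> X \<in> Ob (\<P> L) \<and> Y \<in> Ob (\<P> L) \<and> Z \<in> Ob (\<P> L) \<and>
    i \<in> Hom (\<P> L) X Y \<and> d \<in> Hom (\<P> L) Y Z \<and>
    lmod_short_exact (src X) (fst i) (src Y) (fst d) (src Z) \<and>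
    lmod_short_exact (tgt X) (snd i) (tgt Y) (snd d) (tgt Z)"
  by (auto simp: proj_morphism_category_def full_exact_subcategory_def morphism_category_def)

text \<open>Each component factors on its own. That the two factors form a commuting square is
  tested after the injective \<open>snd i\<close>, where the squares of \<open>i\<close> and
  \<open>f\<close> give it.\<close>

lemma Hom_factor_mono:
  assumes "X \<in> Ob (\<P> L)" "W \<in> Ob (\<P> L)" "i \<in> Hom (\<P> L) X Y"
    "inj_on (fst i) (carrier (src X))" "inj_on (snd i) (carrier (tgt X))" "f \<in> Hom (\<P> L) W Y"
    "fst f ` carrier (src W) \<subseteq> fst i ` carrier (src X)" "snd f ` carrier (tgt W) \<subseteq> snd i ` carrier (tgt X)"
  shows "\<exists>!g. g \<in> Hom (\<P> L) W X \<and> Cmp (\<P> L) W X Y i g = f"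
proof -
  note mX = Ob_left_module[OF assms(1)] and mW = Ob_left_module[OF assms(2)]
  note aX = lmod_hom_closed[OF Ob_arr[OF assms(1)]] and aW = lmod_hom_closed[OF Ob_arr[OF assms(2)]]
  obtain g1 where g1: "g1 \<in> lmod_hom L (src W) (src X)" "\<And>w. w \<in> carrier (src W) \<Longrightarrow> fst i (g1 w) = fst f w"
    using lmod_hom_factor_mono[OF mW(1) mX(1) Hom_component(1)[OF assms(3)] assms(4) Hom_component(1)[OF assms(6)] assms(7)]
    by blast
  obtain g2 where g2: "g2 \<in> lmod_hom L (tgt W) (tgt X)" "\<And>w. w \<in> carrier (tgt W) \<Longrightarrow> snd i (g2 w) = snd f w"
    using lmod_hom_factor_mono[OF mW(2) mX(2) Hom_component(2)[OF assms(3)] assms(5) Hom_component(2)[OF assms(6)] assms(8)]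
    by blast
  note gc = lmod_hom_closed[OF g1(1)] lmod_hom_closed[OF g2(1)]
  have "g2 (arr W w) = arr X (g1 w)" if w: "w \<in> carrier (src W)" for w
    by (rule inj_onD[OF assms(5)])
      (use w in \<open>simp_all add: aX aW gc g1(2) g2(2) Hom_commute[OF assms(3)] Hom_commute[OF assms(6)]\<close>)
  then have g: "(g1, g2) \<in> Hom (\<P> L) W X" using g1 g2 by (simp add: Hom_iff)
  have eq: "Cmp (\<P> L) W X Y i h = f \<longleftrightarrow> (\<forall>w\<in>carrier (src W). fst i (fst h w) = fst f w) \<and>
      (\<forall>w\<in>carrier (tgt W). snd i (snd h w) = snd f w)" if "h \<in> Hom (\<P> L) W X" for h
    by (subst Hom_eq_iff[OF Cmp_Hom[OF assms(2) that assms(3)] assms(6)]) (simp add: component_simps)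
  show ?thesis
  proof (rule ex1I[of _ "(g1, g2)"])
    show "(g1, g2) \<in> Hom (\<P> L) W X \<and> Cmp (\<P> L) W X Y i (g1, g2) = f"
      using g g1 g2 by (simp add: eq)
  next
    fix h assume h': "h \<in> Hom (\<P> L) W X \<and> Cmp (\<P> L) W X Y i h = f"
    then have h: "h \<in> Hom (\<P> L) W X" by simp
    have h: "h \<in> Hom (\<P> L) W X" "\<And>w. w \<in> carrier (src W) \<Longrightarrow> fst i (fst h w) = fst f w"
      "\<And>w. w \<in> carrier (tgt W) \<Longrightarrow> snd i (snd h w) = snd f w" using h' eq[OF h] by blast+
    show "h = (g1, g2)"
      unfolding Hom_eq_iff[OF h(1) g]
    proof (intro conjI ballI)
      fix w assume "w \<in> carrier (src W)"
      then have "fst i (fst h w) = fst i (g1 w)" "fst h w \<in> carrier (src X)" "g1 w \<in> carrier (src X)"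
        by (simp_all add: h(2) g1(2) gc Hom_closed[OF h(1)])
      then show "fst h w = fst (g1, g2) w" using assms(4) by (simp add: inj_on_def)
    next
      fix w assume "w \<in> carrier (tgt W)"
      then have "snd i (snd h w) = snd i (g2 w)" "snd h w \<in> carrier (tgt X)" "g2 w \<in> carrier (tgt X)"
        by (simp_all add: h(3) g2(2) gc Hom_closed[OF h(1)])
      then show "snd h w = snd (g1, g2) w" using assms(5) by (simp add: inj_on_def)
    qed
  qed
qed

text \<open>Each component descends on its own. The square of the descended maps is tested at
  elements \<open>fst d y\<close>, which exhaust the source of \<open>Z\<close>, and there it
  follows from the squares of \<open>d\<close> and \<open>f\<close>.\<close>

lemma Hom_factor_epi:
  assumes "Y \<in> Ob (\<P> L)" "Z \<in> Ob (\<P> L)" "W \<in> Ob (\<P> L)" "d \<in> Hom (\<P> L) Y Z"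
    "fst d ` carrier (src Y) = carrier (src Z)" "snd d ` carrier (tgt Y) = carrier (tgt Z)" "f \<in> Hom (\<P> L) Y W"
    "\<And>y. \<lbrakk>y \<in> carrier (src Y); fst d y = \<zero>\<^bsub>src Z\<^esub>\<rbrakk> \<Longrightarrow> fst f y = \<zero>\<^bsub>src W\<^esub>"
    "\<And>y. \<lbrakk>y \<in> carrier (tgt Y); snd d y = \<zero>\<^bsub>tgt Z\<^esub>\<rbrakk> \<Longrightarrow> snd f y = \<zero>\<^bsub>tgt W\<^esub>"
  shows "\<exists>!g. g \<in> Hom (\<P> L) Z W \<and> Cmp (\<P> L) Y Z W g d = f"
proof -
  note mY = Ob_left_module[OF assms(1)] and mZ = Ob_left_module[OF assms(2)] and mW = Ob_left_module[OF assms(3)]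
  note aY = lmod_hom_closed[OF Ob_arr[OF assms(1)]] and aZ = lmod_hom_closed[OF Ob_arr[OF assms(2)]]
  obtain g1 where g1: "g1 \<in> lmod_hom L (src Z) (src W)" "\<And>y. y \<in> carrier (src Y) \<Longrightarrow> g1 (fst d y) = fst f y"
    using lmod_hom_factor_epi[OF mY(1) mZ(1) mW(1) Hom_component(1)[OF assms(4)] assms(5) Hom_component(1)[OF assms(7)] assms(8)]
    by blast
  obtain g2 where g2: "g2 \<in> lmod_hom L (tgt Z) (tgt W)" "\<And>y. y \<in> carrier (tgt Y) \<Longrightarrow> g2 (snd d y) = snd f y"
    using lmod_hom_factor_epi[OF mY(2) mZ(2) mW(2) Hom_component(2)[OF assms(4)] assms(6) Hom_component(2)[OF assms(7)] assms(9)]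
    by blast
  have "g2 (arr Z z) = arr W (g1 z)" if z: "z \<in> carrier (src Z)" for z
  proof -
    obtain y where y: "y \<in> carrier (src Y)" "z = fst d y" using z assms(5) by blast
    have "g2 (arr Z z) = g2 (snd d (arr Y y))" using y by (simp add: Hom_commute[OF assms(4)])
    also have "\<dots> = arr W (g1 z)" using y by (simp add: g1(2) g2(2) aY Hom_commute[OF assms(7)])
    finally show ?thesis .
  qed
  then have g: "(g1, g2) \<in> Hom (\<P> L) Z W" using g1 g2 by (simp add: Hom_iff)
  have eq: "Cmp (\<P> L) Y Z W h d = f \<longleftrightarrow> (\<forall>y\<in>carrier (src Y). fst h (fst d y) = fst f y) \<and>
      (\<forall>y\<in>carrier (tgt Y). snd h (snd d y) = snd f y)" if "h \<in> Hom (\<P> L) Z W" for h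
    by (subst Hom_eq_iff[OF Cmp_Hom[OF assms(1) assms(4) that] assms(7)]) (simp add: component_simps)
  show ?thesis
  proof (rule ex1I[of _ "(g1, g2)"])
    show "(g1, g2) \<in> Hom (\<P> L) Z W \<and> Cmp (\<P> L) Y Z W (g1, g2) d = f"
      using g g1 g2 by (simp add: eq)
  next
    fix h assume h': "h \<in> Hom (\<P> L) Z W \<and> Cmp (\<P> L) Y Z W h d = f"
    then have h: "h \<in> Hom (\<P> L) Z W" by simp
    have h: "h \<in> Hom (\<P> L) Z W" "\<And>y. y \<in> carrier (src Y) \<Longrightarrow> fst h (fst d y) = fst f y"
      "\<And>y. y \<in> carrier (tgt Y) \<Longrightarrow> snd h (snd d y) = snd f y" using h' eq[OF h] by blast+
    show "h = (g1, g2)"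
      by (subst Hom_eq_iff[OF h(1) g], unfold assms(5,6)[symmetric]) (auto simp: h(2,3) g1(2) g2(2))
  qed
qed

lemma short_exact_inj: "lmod_short_exact K i M p N \<Longrightarrow> inj_on i (carrier K)"
  and short_exact_image: "lmod_short_exact K i M p N \<Longrightarrow> i ` carrier K = {x \<in> carrier M. p x = \<zero>\<^bsub>N\<^esub>}"
  and short_exact_surj: "lmod_short_exact K i M p N \<Longrightarrow> p ` carrier M = carrier N"
  by (simp_all add: lmod_short_exact_def)

lemma short_exact_zero: "\<lbrakk>lmod_short_exact K i M p N; x \<in> carrier K\<rbrakk> \<Longrightarrow> p (i x) = \<zero>\<^bsub>N\<^esub>"
  using short_exact_image by fastforce

lemma Cmp_eq_Hzero_iff:
  assumes "X \<in> Ob (\<P> L)" "Z \<in> Ob (\<P> L)" "f \<in> Hom (\<P> L) X Y" "g \<in> Hom (\<P> L) Y Z"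
  shows "Cmp (\<P> L) X Y Z g f = Hzero (\<P> L) X Z \<longleftrightarrow>
    (\<forall>x\<in>carrier (src X). fst g (fst f x) = \<zero>\<^bsub>src Z\<^esub>) \<and> (\<forall>x\<in>carrier (tgt X). snd g (snd f x) = \<zero>\<^bsub>tgt Z\<^esub>)"
  by (subst Hom_eq_iff[OF Cmp_Hom[OF assms(1,3,4)] Hzero_Hom[OF assms(1,2)]]) (simp add: component_simps)

section \<open>Kernel, cokernel and isomorphism axioms\<close>

lemma conflation_is_kernel:
  assumes "(X, i, Y, d, Z) \<in> Confl (\<P> L)"
  shows "is_kernel (\<P> L) X i Y d Z"
proof -
  have c: "X \<in> Ob (\<P> L)" "Y \<in> Ob (\<P> L)" "Z \<in> Ob (\<P> L)" "i \<in> Hom (\<P> L) X Y" "d \<in> Hom (\<P> L) Y Z"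
    and se: "lmod_short_exact (src X) (fst i) (src Y) (fst d) (src Z)"
      "lmod_short_exact (tgt X) (snd i) (tgt Y) (snd d) (tgt Z)"
    using assms by (auto simp: Confl_iff)
  show ?thesis
    unfolding is_kernel_def
  proof (intro conjI ballI impI c)
    show "Cmp (\<P> L) X Y Z d i = Hzero (\<P> L) X Z"
      using c se by (simp add: Cmp_eq_Hzero_iff short_exact_zero)
    fix W f assume W: "W \<in> Ob (\<P> L)" and f: "f \<in> Hom (\<P> L) W Y" and "Cmp (\<P> L) W Y Z d f = Hzero (\<P> L) W Z"
    then have "fst f ` carrier (src W) \<subseteq> fst i ` carrier (src X)" "snd f ` carrier (tgt W) \<subseteq> snd i ` carrier (tgt X)"
      using c Hom_closed[OF f] unfolding se[THEN short_exact_image] by (auto simp: Cmp_eq_Hzero_iff)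
    then show "\<exists>!g. g \<in> Hom (\<P> L) W X \<and> Cmp (\<P> L) W X Y i g = f"
      using c W f se by (intro Hom_factor_mono) (auto intro: short_exact_inj)
  qed
qed

lemma conflation_is_cokernel:
  assumes "(X, i, Y, d, Z) \<in> Confl (\<P> L)"
  shows "is_cokernel (\<P> L) X i Y d Z"
proof -
  have c: "X \<in> Ob (\<P> L)" "Y \<in> Ob (\<P> L)" "Z \<in> Ob (\<P> L)" "i \<in> Hom (\<P> L) X Y" "d \<in> Hom (\<P> L) Y Z"
    and se: "lmod_short_exact (src X) (fst i) (src Y) (fst d) (src Z)"
      "lmod_short_exact (tgt X) (snd i) (tgt Y) (snd d) (tgt Z)"
    using assms by (auto simp: Confl_iff)
  show ?thesis
    unfolding is_cokernel_def
  proof (intro conjI ballI impI c)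
    show "Cmp (\<P> L) X Y Z d i = Hzero (\<P> L) X Z"
      using c se by (simp add: Cmp_eq_Hzero_iff short_exact_zero)
    fix W f assume W: "W \<in> Ob (\<P> L)" and f: "f \<in> Hom (\<P> L) Y W" and 0: "Cmp (\<P> L) X Y W f i = Hzero (\<P> L) X W"
    have f0: "\<forall>x\<in>carrier (src X). fst f (fst i x) = \<zero>\<^bsub>src W\<^esub>" "\<forall>x\<in>carrier (tgt X). snd f (snd i x) = \<zero>\<^bsub>tgt W\<^esub>"
      using 0 c W f by (auto simp: Cmp_eq_Hzero_iff)
    show "\<exists>!g. g \<in> Hom (\<P> L) Z W \<and> Cmp (\<P> L) Y Z W g d = f"
    proof (rule Hom_factor_epi[OF c(2,3) W c(5) se[THEN short_exact_surj] f])
      fix y assume "y \<in> carrier (src Y)" "fst d y = \<zero>\<^bsub>src Z\<^esub>"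
      then have "y \<in> fst i ` carrier (src X)" using se(1)[THEN short_exact_image] by blast
      then show "fst f y = \<zero>\<^bsub>src W\<^esub>" using f0 by blast
    next
      fix y assume "y \<in> carrier (tgt Y)" "snd d y = \<zero>\<^bsub>tgt Z\<^esub>"
      then have "y \<in> snd i ` carrier (tgt X)" using se(2)[THEN short_exact_image] by blast
      then show "snd f y = \<zero>\<^bsub>tgt W\<^esub>" using f0 by blast
    qed
  qed
qed

text \<open>An isomorphism of the category is bijective in both components, with the components of
  its inverse as inverse maps; exactness is then transported in each component.\<close>

lemma conflation_iso:
  assumes "(X, i, Y, d, Z) \<in> Confl (\<P> L)" "X' \<in> Ob (\<P> L)" "Y' \<in> Ob (\<P> L)" "Z' \<in> Ob (\<P> L)"
    "iso_in (\<P> L) X X' a" "iso_in (\<P> L) Y Y' b" "iso_in (\<P> L) Z Z' c"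
    "i' \<in> Hom (\<P> L) X' Y'" "d' \<in> Hom (\<P> L) Y' Z'"
    "Cmp (\<P> L) X Y Y' b i = Cmp (\<P> L) X X' Y' i' a" "Cmp (\<P> L) Y Z Z' c d = Cmp (\<P> L) Y Y' Z' d' b"
  shows "(X', i', Y', d', Z') \<in> Confl (\<P> L)"
proof -
  have conf: "X \<in> Ob (\<P> L)" "Y \<in> Ob (\<P> L)" "Z \<in> Ob (\<P> L)" "i \<in> Hom (\<P> L) X Y" "d \<in> Hom (\<P> L) Y Z"
    and se: "lmod_short_exact (src X) (fst i) (src Y) (fst d) (src Z)"
      "lmod_short_exact (tgt X) (snd i) (tgt Y) (snd d) (tgt Z)"
    using assms(1) by (auto simp: Confl_iff)
  have iso: "f \<in> Hom (\<P> L) A B" "bij_betw (fst f) (carrier (src A)) (carrier (src B))"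
    "bij_betw (snd f) (carrier (tgt A)) (carrier (tgt B))" if iso: "iso_in (\<P> L) A B f" for A B f
  proof -
    obtain g where f: "f \<in> Hom (\<P> L) A B" and g: "g \<in> Hom (\<P> L) B A"
      and e: "Cmp (\<P> L) A B A g f = Idm (\<P> L) A" "Cmp (\<P> L) B A B f g = Idm (\<P> L) B"
      using iso unfolding iso_in_def by blast
    have "fst g (fst f x) = x" if "x \<in> carrier (src A)" for x
      using that by (metis e(1) fst_Cmp fst_Idm)
    moreover have "fst f (fst g x) = x" if "x \<in> carrier (src B)" for x
      using that by (metis e(2) fst_Cmp fst_Idm)
    moreover have "snd g (snd f x) = x" if "x \<in> carrier (tgt A)" for x
      using that by (metis e(1) snd_Cmp snd_Idm)
    moreover have "snd f (snd g x) = x" if "x \<in> carrier (tgt B)" for x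
      using that by (metis e(2) snd_Cmp snd_Idm)
    ultimately show "f \<in> Hom (\<P> L) A B" "bij_betw (fst f) (carrier (src A)) (carrier (src B))"
      "bij_betw (snd f) (carrier (tgt A)) (carrier (tgt B))"
      using f Hom_closed[OF f] Hom_closed[OF g]
      by (auto intro!: bij_betwI[of "fst f" _ _ "fst g"] bij_betwI[of "snd f" _ _ "snd g"])
  qed
  note a = iso[OF assms(5)] and b = iso[OF assms(6)] and c = iso[OF assms(7)]
  have "lmod_short_exact (src X') (fst i') (src Y') (fst d') (src Z')"
  proof (rule short_exact_iso[OF _ _ _ _ _ _ se(1) Hom_component(1)[OF a(1)] a(2) Hom_component(1)[OF b(1)] b(2)
        Hom_component(1)[OF c(1)] c(2) Hom_component(1)[OF conf(4)] _ Hom_component(1)[OF conf(5)]])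
    show "fst b (fst i x) = fst i' (fst a x)" if "x \<in> carrier (src X)" for x
      using that by (metis assms(10) fst_Cmp)
    show "fst c (fst d x) = fst d' (fst b x)" if "x \<in> carrier (src Y)" for x
      using that by (metis assms(11) fst_Cmp)
  qed (use conf assms(2-4) in \<open>simp_all add: Ob_left_module\<close>)
  moreover have "lmod_short_exact (tgt X') (snd i') (tgt Y') (snd d') (tgt Z')"
  proof (rule short_exact_iso[OF _ _ _ _ _ _ se(2) Hom_component(2)[OF a(1)] a(3) Hom_component(2)[OF b(1)] b(3)
        Hom_component(2)[OF c(1)] c(3) Hom_component(2)[OF conf(4)] _ Hom_component(2)[OF conf(5)]])
    show "snd b (snd i x) = snd i' (snd a x)" if "x \<in> carrier (tgt X)" for x
      using that by (metis assms(10) snd_Cmp)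
    show "snd c (snd d x) = snd d' (snd b x)" if "x \<in> carrier (tgt Y)" for x
      using that by (metis assms(11) snd_Cmp)
  qed (use conf assms(2-4) in \<open>simp_all add: Ob_left_module\<close>)
  ultimately show ?thesis using assms(2-4,8,9) by (simp add: Confl_iff)
qed

section \<open>Recognising deflations and inflations\<close>

lemma surjective_conflation:
  assumes "Y \<in> Ob (\<P> L)" "Z \<in> Ob (\<P> L)" "d \<in> Hom (\<P> L) Y Z"
    "fst d ` carrier (src Y) = carrier (src Z)" "snd d ` carrier (tgt Y) = carrier (tgt Z)"
  shows "\<exists>X i. (X, i, Y, d, Z) \<in> Confl (\<P> L)"
proof -
  let ?K1 = "kernel_module (src Y) (src Z) (fst d)" and ?K2 = "kernel_module (tgt Y) (tgt Z) (snd d)"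
  let ?X = "\<lparr>src = ?K1, tgt = ?K2, arr = \<lambda>x\<in>carrier ?K1. arr Y x\<rparr>"
  let ?i = "(\<lambda>x\<in>carrier ?K1. x, \<lambda>x\<in>carrier ?K2. x)"
  note mY = Ob_left_module[OF assms(1)] and mZ = Ob_left_module[OF assms(2)] and h = Hom_component[OF assms(3)]
  note a = Ob_arr[OF assms(1)]
  \<comment> \<open>\<open>arr Y\<close> restricts to the kernels because \<open>snd d\<close> after
    \<open>arr Y\<close> equals \<open>arr Z\<close> after \<open>fst d\<close>.\<close>
  have cl: "arr Y x \<in> carrier ?K2" if "x \<in> carrier ?K1" for x
    using that lmod_hom_closed[OF a] Hom_commute[OF assms(3)] lmod_hom_zero[OF mZ Ob_arr[OF assms(2)]] by simp
  have "(\<lambda>x\<in>carrier ?K1. arr Y x) \<in> lmod_hom L ?K1 ?K2"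
  proof (rule restrict_lmod_hom[OF left_module_kernel[OF mY(1) mZ(1) h(1)] cl])
    show "arr Y (x \<oplus>\<^bsub>?K1\<^esub> y) = arr Y x \<oplus>\<^bsub>?K2\<^esub> arr Y y" if "x \<in> carrier ?K1" "y \<in> carrier ?K1" for x y
      using that by (simp add: lmod_hom_add[OF a])
    show "arr Y (r \<odot>\<^bsub>?K1\<^esub> x) = r \<odot>\<^bsub>?K2\<^esub> arr Y x" if "r \<in> carrier L" "x \<in> carrier ?K1" for r x
      using that by (simp add: lmod_hom_smult[OF a])
  qed
  \<comment> \<open>Projectivity of the components of \<open>Z\<close> enters here: it splits both
    surjections.\<close>
  moreover have "fg_projective L ?K1" "fg_projective L ?K2"
    using assms h by (auto simp: Ob_iff intro: fg_projective_kernel)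
  ultimately have "?X \<in> Ob (\<P> L)"
    by (simp add: Ob_iff)
  moreover have "?i \<in> Hom (\<P> L) ?X Y"
    using kernel_incl_hom[OF mY(1) mZ(1) h(1)] kernel_incl_hom[OF mY(2) mZ(2) h(2)] cl by (simp add: Hom_iff)
  ultimately have "(?X, ?i, Y, d, Z) \<in> Confl (\<P> L)"
    using assms by (simp add: Confl_iff short_exact_kernel del: kernel_module_simps)
  then show ?thesis by blast
qed

lemma deflation_iff:
  "deflation (\<P> L) Y Z d \<longleftrightarrow> Y \<in> Ob (\<P> L) \<and> Z \<in> Ob (\<P> L) \<and> d \<in> Hom (\<P> L) Y Z \<and>
    fst d ` carrier (src Y) = carrier (src Z) \<and> snd d ` carrier (tgt Y) = carrier (tgt Z)"
  using surjective_conflation[of Y L Z d] unfolding deflation_def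
  by (auto simp: Confl_iff dest!: short_exact_surj)

lemma image_eq_if_section:
  assumes "\<And>x. x \<in> A \<Longrightarrow> i x \<in> B" "\<And>x. x \<in> A \<Longrightarrow> r (i x) = x" "\<And>y. y \<in> B \<Longrightarrow> r y \<in> A"
  shows "r ` B = A"
proof (intro subset_antisym subsetI)
  fix x assume "x \<in> A"
  then show "x \<in> r ` B" using assms(1,2) by (intro image_eqI[of _ _ "i x"]) simp_all
qed (use assms(3) in blast)

text \<open>\<open>r1\<close> and \<open>r2\<close> need not commute with the arrows, so
  \<open>arr Y\<close> may fail to carry the kernel of \<open>r1\<close> into that of
  \<open>r2\<close>. Following it by the projection \<open>q2\<close> gives an arrow between these
  kernels, and \<open>(q1, q2)\<close> is a morphism because \<open>q2\<close> kills the image of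
  \<open>snd i\<close>.\<close>

lemma split_mono_conflation:
  assumes "X \<in> Ob (\<P> L)" "Y \<in> Ob (\<P> L)" "i \<in> Hom (\<P> L) X Y"
    "r1 \<in> lmod_hom L (src Y) (src X)" "\<And>x. x \<in> carrier (src X) \<Longrightarrow> r1 (fst i x) = x"
    "r2 \<in> lmod_hom L (tgt Y) (tgt X)" "\<And>x. x \<in> carrier (tgt X) \<Longrightarrow> r2 (snd i x) = x"
  shows "\<exists>d Z. (X, i, Y, d, Z) \<in> Confl (\<P> L)"
proof -
  let ?C1 = "kernel_module (src Y) (src X) r1" and ?C2 = "kernel_module (tgt Y) (tgt X) r2"
  define q1 where "q1 = (\<lambda>y\<in>carrier (src Y). y \<ominus>\<^bsub>src Y\<^esub> fst i (r1 y))"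
  define q2 where "q2 = (\<lambda>y\<in>carrier (tgt Y). y \<ominus>\<^bsub>tgt Y\<^esub> snd i (r2 y))"
  define c where "c = (\<lambda>y\<in>carrier ?C1. q2 (arr Y y))"
  let ?Z = "\<lparr>src = ?C1, tgt = ?C2, arr = c\<rparr>"
  note mX = Ob_left_module[OF assms(1)] and mY = Ob_left_module[OF assms(2)] and h = Hom_component[OF assms(3)]
  note a = Ob_arr[OF assms(2)]
  interpret tY: left_module L "tgt Y" by (rule mY)
  have q1: "q1 \<in> lmod_hom L (src Y) ?C1" and q2: "q2 \<in> lmod_hom L (tgt Y) ?C2"
    unfolding q1_def q2_def
    by (rule kernel_projection_hom[OF mY(1) mX(1) assms(4) h(1) assms(5)]
        kernel_projection_hom[OF mY(2) mX(2) assms(6) h(2) assms(7)]; assumption)+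
  have se: "lmod_short_exact (src X) (fst i) (src Y) q1 ?C1" "lmod_short_exact (tgt X) (snd i) (tgt Y) q2 ?C2"
    unfolding q1_def q2_def
    by (rule short_exact_split_mono[OF mX(1) mY(1) h(1) assms(4,5)]
        short_exact_split_mono[OF mX(2) mY(2) h(2) assms(6,7)]; assumption)+
  have c_eq: "c = compose (carrier ?C1) q2 (compose (carrier ?C1) (arr Y) (\<lambda>y\<in>carrier ?C1. y))"
    by (auto simp: c_def compose_def)
  note C1 = left_module_kernel[OF mY(1) mX(1) assms(4)]
  have "c \<in> lmod_hom L ?C1 ?C2"
    using compose_lmod_hom[OF C1 compose_lmod_hom[OF C1 kernel_incl_hom[OF mY(1) mX(1) assms(4)] a] q2]
    by (simp only: c_eq)
  moreover have "r1 ` carrier (src Y) = carrier (src X)" "r2 ` carrier (tgt Y) = carrier (tgt X)"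
    using assms(5,7) lmod_hom_closed[OF assms(4)] lmod_hom_closed[OF assms(6)] Hom_closed[OF assms(3)] by (simp_all add: image_eq_if_section[of _ "fst i"] image_eq_if_section[of _ "snd i"])
  ultimately have Z: "?Z \<in> Ob (\<P> L)"
    using assms by (simp add: Ob_iff fg_projective_kernel)
  have "q2 (arr Y y) = c (q1 y)" if y: "y \<in> carrier (src Y)" for y
  proof -
    have r: "r1 y \<in> carrier (src X)" "fst i (r1 y) \<in> carrier (src Y)" "arr Y y \<in> carrier (tgt Y)"
      "arr X (r1 y) \<in> carrier (tgt X)" "snd i (arr X (r1 y)) \<in> carrier (tgt Y)"
      using y by (auto intro: lmod_hom_closed[OF assms(4)] Hom_closed[OF assms(3)] lmod_hom_closed[OF a]
          lmod_hom_closed[OF Ob_arr[OF assms(1)]])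
    have "c (q1 y) = q2 (arr Y (q1 y))" using lmod_hom_closed[OF q1 y] by (simp add: c_def)
    \<comment> \<open>\<open>arr Y\<close> turns the subtracted term \<open>fst i (r1 y)\<close>
      into \<open>snd i (arr X (r1 y))\<close>, which lies in the kernel of
      \<open>q2\<close>.\<close>
    also have "\<dots> = q2 (arr Y y \<ominus>\<^bsub>tgt Y\<^esub> snd i (arr X (r1 y)))"
      using y r by (simp add: q1_def lmod_hom_diff[OF mY a] Hom_commute[OF assms(3)])
    also have "\<dots> = q2 (arr Y y) \<ominus>\<^bsub>?C2\<^esub> \<zero>\<^bsub>?C2\<^esub>"
      using r short_exact_zero[OF se(2)]
      by (subst lmod_hom_diff[OF mY(2) _ q2]) (simp_all add: left_module_kernel[OF mY(2) mX(2) assms(6)])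
    also have "\<dots> = q2 (arr Y y)"
      using left_module_kernel[OF mY(2) mX(2) assms(6)] lmod_hom_closed[OF q2 r(3)]
      by (simp add: left_module_def abelian_group.diff_zero del: kernel_module_simps)
    finally show ?thesis by simp
  qed
  then have "(q1, q2) \<in> Hom (\<P> L) Y ?Z"
    using q1 q2 by (simp add: Hom_iff)
  then have "(X, i, Y, (q1, q2), ?Z) \<in> Confl (\<P> L)"
    using assms Z se by (simp add: Confl_iff)
  then show ?thesis by blast
qed

text \<open>The two retractions are chosen independently and are not asked to form a morphism. This
  makes the condition checkable one component at a time, as is done for composites and
  pushouts.\<close>

lemma inflation_iff:
  "inflation (\<P> L) X Y i \<longleftrightarrow> X \<in> Ob (\<P> L) \<and> Y \<in> Ob (\<P> L) \<and> i \<in> Hom (\<P> L) X Y \<and>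
    (\<exists>r \<in> lmod_hom L (src Y) (src X). \<forall>x \<in> carrier (src X). r (fst i x) = x) \<and>
    (\<exists>r \<in> lmod_hom L (tgt Y) (tgt X). \<forall>x \<in> carrier (tgt X). r (snd i x) = x)"
proof
  assume "inflation (\<P> L) X Y i"
  then obtain d Z where "(X, i, Y, d, Z) \<in> Confl (\<P> L)" by (auto simp: inflation_def)
  then have c: "X \<in> Ob (\<P> L)" "Y \<in> Ob (\<P> L)" "Z \<in> Ob (\<P> L)" "i \<in> Hom (\<P> L) X Y" "d \<in> Hom (\<P> L) Y Z"
    and se: "lmod_short_exact (src X) (fst i) (src Y) (fst d) (src Z)"
      "lmod_short_exact (tgt X) (snd i) (tgt Y) (snd d) (tgt Z)"
    by (auto simp: Confl_iff)
  have "fg_projective L (src Z)" "fg_projective L (tgt Z)" using c(3) by (auto simp: Ob_iff)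
  note r = short_exact_retraction[OF Ob_left_module(1)[OF c(1)] Ob_left_module(1)[OF c(2)] this(1)
      Hom_component(1)[OF c(4)] Hom_component(1)[OF c(5)] se(1)]
    short_exact_retraction[OF Ob_left_module(2)[OF c(1)] Ob_left_module(2)[OF c(2)] this(2)
      Hom_component(2)[OF c(4)] Hom_component(2)[OF c(5)] se(2)]
  then show "X \<in> Ob (\<P> L) \<and> Y \<in> Ob (\<P> L) \<and> i \<in> Hom (\<P> L) X Y \<and>
    (\<exists>r \<in> lmod_hom L (src Y) (src X). \<forall>x \<in> carrier (src X). r (fst i x) = x) \<and>
    (\<exists>r \<in> lmod_hom L (tgt Y) (tgt X). \<forall>x \<in> carrier (tgt X). r (snd i x) = x)"
    using c by blast
next
  assume "X \<in> Ob (\<P> L) \<and> Y \<in> Ob (\<P> L) \<and> i \<in> Hom (\<P> L) X Y \<and>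
    (\<exists>r \<in> lmod_hom L (src Y) (src X). \<forall>x \<in> carrier (src X). r (fst i x) = x) \<and>
    (\<exists>r \<in> lmod_hom L (tgt Y) (tgt X). \<forall>x \<in> carrier (tgt X). r (snd i x) = x)"
  then show "inflation (\<P> L) X Y i"
    unfolding inflation_def using split_mono_conflation[of X L Y i] by blast
qed

text \<open>In each component the retractions compose in the opposite order.\<close>

lemma inflation_compose:
  assumes "inflation (\<P> L) X Y i" "inflation (\<P> L) Y Z j"
  shows "inflation (\<P> L) X Z (Cmp (\<P> L) X Y Z j i)"
proof -
  have Ob: "X \<in> Ob (\<P> L)" "Y \<in> Ob (\<P> L)" "Z \<in> Ob (\<P> L)" and i: "i \<in> Hom (\<P> L) X Y" and j: "j \<in> Hom (\<P> L) Y Z"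
    using assms by (auto simp: inflation_iff)
  obtain r1 r2 where r: "r1 \<in> lmod_hom L (src Y) (src X)" "\<And>x. x \<in> carrier (src X) \<Longrightarrow> r1 (fst i x) = x"
    "r2 \<in> lmod_hom L (tgt Y) (tgt X)" "\<And>x. x \<in> carrier (tgt X) \<Longrightarrow> r2 (snd i x) = x"
    using assms(1) unfolding inflation_iff by blast
  obtain s1 s2 where s: "s1 \<in> lmod_hom L (src Z) (src Y)" "\<And>x. x \<in> carrier (src Y) \<Longrightarrow> s1 (fst j x) = x"
    "s2 \<in> lmod_hom L (tgt Z) (tgt Y)" "\<And>x. x \<in> carrier (tgt Y) \<Longrightarrow> s2 (snd j x) = x"
    using assms(2) unfolding inflation_iff by blast
  have "compose (carrier (src Z)) r1 s1 \<in> lmod_hom L (src Z) (src X)"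
    "compose (carrier (tgt Z)) r2 s2 \<in> lmod_hom L (tgt Z) (tgt X)"
    using Ob_left_module[OF Ob(3)] r s by (blast intro: compose_lmod_hom)+
  moreover have "compose (carrier (src Z)) r1 s1 (fst (Cmp (\<P> L) X Y Z j i) x) = x" if "x \<in> carrier (src X)" for x
    using that r s by (simp add: compose_def component_simps Hom_closed[OF i] Hom_closed[OF j])
  moreover have "compose (carrier (tgt Z)) r2 s2 (snd (Cmp (\<P> L) X Y Z j i) x) = x" if "x \<in> carrier (tgt X)" for x
    using that r s by (simp add: compose_def component_simps Hom_closed[OF i] Hom_closed[OF j])
  ultimately show ?thesis
    unfolding inflation_iff using Ob Cmp_Hom[OF Ob(1) i j] by blast
qed

lemma deflation_compose:
  assumes "deflation (\<P> L) X Y d" "deflation (\<P> L) Y Z e"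
  shows "deflation (\<P> L) X Z (Cmp (\<P> L) X Y Z e d)"
proof -
  have "fst (Cmp (\<P> L) X Y Z e d) ` carrier (src X) = fst e ` fst d ` carrier (src X)"
    "snd (Cmp (\<P> L) X Y Z e d) ` carrier (tgt X) = snd e ` snd d ` carrier (tgt X)"
    unfolding image_image by (intro image_cong; simp add: component_simps)+
  then show ?thesis using assms Cmp_Hom[of X L d Y e Z] by (simp add: deflation_iff)
qed

lemma inflation_Idm:
  assumes "X \<in> Ob (\<P> L)"
  shows "inflation (\<P> L) X X (Idm (\<P> L) X)"
  unfolding inflation_iff using assms Idm_Hom[OF assms] id_lmod_hom[OF Ob_left_module(1)[OF assms]]
    id_lmod_hom[OF Ob_left_module(2)[OF assms]]
  by (intro conjI bexI[of _ "\<lambda>x\<in>carrier (src X). x"] bexI[of _ "\<lambda>x\<in>carrier (tgt X). x"])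
    (simp_all add: component_simps)

lemma deflation_Idm:
  assumes "X \<in> Ob (\<P> L)"
  shows "deflation (\<P> L) X X (Idm (\<P> L) X)"
  unfolding deflation_iff using assms Idm_Hom[OF assms]
  by (auto simp: component_simps image_iff)

section \<open>Pushouts and pullbacks\<close>

text \<open>The retraction of \<open>K' \<rightarrow> Q\<close> is induced by \<open>(id, f \<circ> r)\<close> on the direct sum.\<close>

lemma pushout_retraction:
  fixes K M K' Q :: "('a, 'b) module"
  assumes inf: "infinite (UNIV :: 'b set)"
    and m: "left_module L K" "left_module L M" "left_module L K'" "left_module L Q"
    and i: "i \<in> lmod_hom L K M" and r: "r \<in> lmod_hom L M K" "\<And>x. x \<in> carrier K \<Longrightarrow> r (i x) = x"
    and f: "f \<in> lmod_hom L K K'" and q: "q \<in> lmod_hom L (direct_sum K' M) Q"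
    and se: "lmod_short_exact K j (direct_sum K' M) q Q"
    and j: "\<And>x. x \<in> carrier K \<Longrightarrow> j x = pr (\<ominus>\<^bsub>K'\<^esub> f x, i x)"
  shows "\<exists>\<rho> \<in> lmod_hom L Q K'. \<forall>a \<in> carrier K'. \<rho> (q (pr (a, \<zero>\<^bsub>M\<^esub>))) = a"
proof -
  interpret K: left_module L K by fact
  interpret M: left_module L M by fact
  interpret K': left_module L K' by fact
  have fr: "compose (carrier M) f r \<in> lmod_hom L M K'" by (rule compose_lmod_hom[OF m(2) r(1) f])
  let ?t = "\<lambda>z\<in>carrier (direct_sum K' M). (\<lambda>x\<in>carrier K'. x) (pr1 z) \<oplus>\<^bsub>K'\<^esub> compose (carrier M) f r (pr2 z)"
  have t: "?t \<in> lmod_hom L (direct_sum K' M) K'"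
    by (rule dsum_copair_hom[OF inf m(3,2,3) id_lmod_hom[OF m(3)] fr])
  \<comment> \<open>At z = \<open>j x\<close> the two summands are the negative of
    \<open>f x\<close> and \<open>f (r (i x))\<close>, which is \<open>f x\<close>; so
    \<open>?t\<close> vanishes on the kernel of \<open>q\<close> and descends to
    \<open>Q\<close>.\<close>
  have "?t z = \<zero>\<^bsub>K'\<^esub>" if z: "z \<in> carrier (direct_sum K' M)" "q z = \<zero>\<^bsub>Q\<^esub>" for z
  proof -
    have "z \<in> j ` carrier K" using z short_exact_image[OF se] by blast
    then obtain x where x: "x \<in> carrier K" "z = pr (\<ominus>\<^bsub>K'\<^esub> f x, i x)" using j by auto
    then show ?thesis
      using z(1) lmod_hom_closed[OF i x(1)] lmod_hom_closed[OF f x(1)] r(2)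
      by (simp add: inv_pr[OF inf] compose_def K'.M.l_neg)
  qed
  then obtain \<rho> where \<rho>: "\<rho> \<in> lmod_hom L Q K'" "\<And>z. z \<in> carrier (direct_sum K' M) \<Longrightarrow> \<rho> (q z) = ?t z"
    using lmod_hom_factor_epi[OF left_module_dsum[OF inf m(3,2)] m(4,3) q short_exact_surj[OF se] t] by blast
  have "\<rho> (q (pr (a, \<zero>\<^bsub>M\<^esub>))) = a" if "a \<in> carrier K'" for a
    using that \<rho>(2)[of "pr (a, \<zero>\<^bsub>M\<^esub>)"] lmod_hom_zero[OF m(2,1) r(1)] lmod_hom_zero[OF m(1,3) f]
    by (simp add: dsum_carrierI inv_pr[OF inf] compose_def)
  then show ?thesis using \<rho>(1) by blast
qed

text \<open>The pushout is the cokernel of the map (-\<open>f\<close>, \<open>i\<close>) from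
  \<open>X\<close> to the direct sum of \<open>X'\<close> and \<open>Y\<close>. Once this map is
  known to be an inflation, a conflation supplies both the object and its universal
  property.\<close>

lemma pushout_exists:
  fixes X :: "('a, 'b) arrow"
  assumes inf: "infinite (UNIV :: 'b set)" and "inflation (\<P> L) X Y i"
    and X': "X' \<in> Ob (\<P> L)" and f: "f \<in> Hom (\<P> L) X X'"
  shows "\<exists>Y' \<in> Ob (\<P> L). \<exists>f' i'. is_pushout (\<P> L) X Y X' Y' i f f' i' \<and> inflation (\<P> L) X' Y' i'"
proof -
  have X: "X \<in> Ob (\<P> L)" and Y: "Y \<in> Ob (\<P> L)" and i: "i \<in> Hom (\<P> L) X Y"
    using assms(2) by (auto simp: inflation_iff)
  obtain r1 r2 where r1: "r1 \<in> lmod_hom L (src Y) (src X)" "\<And>x. x \<in> carrier (src X) \<Longrightarrow> r1 (fst i x) = x"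
    and r2: "r2 \<in> lmod_hom L (tgt Y) (tgt X)" "\<And>x. x \<in> carrier (tgt X) \<Longrightarrow> r2 (snd i x) = x"
    using assms(2) unfolding inflation_iff by blast
  note mX = Ob_left_module[OF X] and mY = Ob_left_module[OF Y] and mX' = Ob_left_module[OF X']
  interpret sY: left_module L "src Y" by (rule mY)
  interpret tY: left_module L "tgt Y" by (rule mY)
  interpret sX': left_module L "src X'" by (rule mX')
  interpret tX': left_module L "tgt X'" by (rule mX')
  note fc = Hom_closed[OF f] and ic = Hom_closed[OF i]
  note aX = lmod_hom_closed[OF Ob_arr[OF X]] and aY = lmod_hom_closed[OF Ob_arr[OF Y]]
  \<comment> \<open>The sign turns the vanishing of \<open>q\<close> after \<open>j\<close> into
    commutativity of the square.\<close>
  define f_neg where "f_neg = (\<lambda>x\<in>carrier (src X). \<ominus>\<^bsub>src X'\<^esub> fst f x, \<lambda>x\<in>carrier (tgt X). \<ominus>\<^bsub>tgt X'\<^esub> snd f x)"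
  have f_neg: "f_neg \<in> Hom (\<P> L) X X'"
    using mX mX' f fc aX
    by (auto simp: f_neg_def Hom_iff minus_lmod_hom lmod_hom_minus[OF mX' Ob_arr[OF X']])
  define B where "B = dsum_arrow X' Y"
  have B: "B \<in> Ob (\<P> L)" unfolding B_def by (rule dsum_arrow_Ob[OF inf X' Y])
  define j where "j = pair_arrow X f_neg i"
  have j: "j \<in> Hom (\<P> L) X B" unfolding j_def B_def by (rule pair_arrow_Hom[OF inf X' Y X f_neg i])
  have fst_j: "fst j x = pr (\<ominus>\<^bsub>src X'\<^esub> fst f x, fst i x)" if "x \<in> carrier (src X)" for x
    using that by (simp add: j_def pair_arrow_def f_neg_def)
  have snd_j: "snd j x = pr (\<ominus>\<^bsub>tgt X'\<^esub> snd f x, snd i x)" if "x \<in> carrier (tgt X)" for x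
    using that by (simp add: j_def pair_arrow_def f_neg_def)
  \<comment> \<open>A retraction of \<open>i\<close> applied to the second coordinate retracts
    \<open>j\<close>, whatever the first coordinate is.\<close>
  have "\<exists>r \<in> lmod_hom L (src B) (src X). \<forall>x\<in>carrier (src X). r (fst j x) = x"
    using compose_lmod_hom[OF _ dsum_pr2_hom[OF inf mX'(1) mY(1)] r1(1)] left_module_dsum[OF inf mX'(1) mY(1)]
      r1(2) fc ic
    by (intro bexI[of _ "compose (carrier (src B)) r1 (\<lambda>z\<in>carrier (src B). pr2 z)"])
      (simp_all add: B_def compose_def fst_j dsum_carrierI inv_pr[OF inf])
  moreover have "\<exists>r \<in> lmod_hom L (tgt B) (tgt X). \<forall>x\<in>carrier (tgt X). r (snd j x) = x"
    using compose_lmod_hom[OF _ dsum_pr2_hom[OF inf mX'(2) mY(2)] r2(1)] left_module_dsum[OF inf mX'(2) mY(2)]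
      r2(2) fc ic
    by (intro bexI[of _ "compose (carrier (tgt B)) r2 (\<lambda>z\<in>carrier (tgt B). pr2 z)"])
      (simp_all add: B_def compose_def snd_j dsum_carrierI inv_pr[OF inf])
  ultimately have "inflation (\<P> L) X B j" using X B j by (simp add: inflation_iff)
  then obtain q Y' where conf: "(X, j, B, q, Y') \<in> Confl (\<P> L)" by (auto simp: inflation_def)
  then have Y': "Y' \<in> Ob (\<P> L)" and q: "q \<in> Hom (\<P> L) B Y'"
    and se: "lmod_short_exact (src X) (fst j) (src B) (fst q) (src Y')"
      "lmod_short_exact (tgt X) (snd j) (tgt B) (snd q) (tgt Y')"
    by (auto simp: Confl_iff)
  interpret sY': left_module L "src Y'" by (rule Ob_left_module[OF Y'])
  interpret tY': left_module L "tgt Y'" by (rule Ob_left_module[OF Y'])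
  define f' where "f' = Cmp (\<P> L) Y B Y' q (inr_arrow X' Y)"
  define i' where "i' = Cmp (\<P> L) X' B Y' q (inl_arrow X' Y)"
  have f': "f' \<in> Hom (\<P> L) Y Y'"
    unfolding f'_def by (rule Cmp_Hom[OF Y inr_arrow_Hom[OF inf X' Y, folded B_def] q])
  have i': "i' \<in> Hom (\<P> L) X' Y'"
    unfolding i'_def by (rule Cmp_Hom[OF X' inl_arrow_Hom[OF inf X' Y, folded B_def] q])
  have f'_app: "y \<in> carrier (src Y) \<Longrightarrow> fst f' y = fst q (pr (\<zero>\<^bsub>src X'\<^esub>, y))"
    "y \<in> carrier (tgt Y) \<Longrightarrow> snd f' y = snd q (pr (\<zero>\<^bsub>tgt X'\<^esub>, y))" for y
    by (simp_all add: f'_def component_simps inr_arrow_def)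
  have i'_app: "a \<in> carrier (src X') \<Longrightarrow> fst i' a = fst q (pr (a, \<zero>\<^bsub>src Y\<^esub>))"
    "a \<in> carrier (tgt X') \<Longrightarrow> snd i' a = snd q (pr (a, \<zero>\<^bsub>tgt Y\<^esub>))" for a
    by (simp_all add: i'_def component_simps inl_arrow_def)
  have q1: "fst q (pr (a, y)) = fst i' a \<oplus>\<^bsub>src Y'\<^esub> fst f' y"
    if "a \<in> carrier (src X')" "y \<in> carrier (src Y)" for a y
    using that Hom_add(1)[OF q, of "pr (a, \<zero>\<^bsub>src Y\<^esub>)" "pr (\<zero>\<^bsub>src X'\<^esub>, y)"]
    by (simp add: f'_app i'_app B_def dsum_carrierI) (simp add: dsum_simps inv_pr[OF inf])
  have q2: "snd q (pr (a, y)) = snd i' a \<oplus>\<^bsub>tgt Y'\<^esub> snd f' y"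
    if "a \<in> carrier (tgt X')" "y \<in> carrier (tgt Y)" for a y
    using that Hom_add(2)[OF q, of "pr (a, \<zero>\<^bsub>tgt Y\<^esub>)" "pr (\<zero>\<^bsub>tgt X'\<^esub>, y)"]
    by (simp add: f'_app i'_app B_def dsum_carrierI) (simp add: dsum_simps inv_pr[OF inf])
  have "fst f' (fst i x) = fst i' (fst f x)" if x: "x \<in> carrier (src X)" for x
  proof -
    have "\<ominus>\<^bsub>src Y'\<^esub> fst i' (fst f x) \<oplus>\<^bsub>src Y'\<^esub> fst f' (fst i x) = \<zero>\<^bsub>src Y'\<^esub>"
      using short_exact_zero[OF se(1) x] x fc ic
      by (simp add: fst_j q1 lmod_hom_minus[OF mX'(1) Ob_left_module(1)[OF Y'] Hom_component(1)[OF i']])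
    then show ?thesis
      using x fc ic Hom_closed[OF f'] Hom_closed[OF i']
      by (metis sY'.M.a_inv_closed sY'.M.minus_equality sY'.M.minus_minus sY'.M.a_comm)
  qed
  moreover have "snd f' (snd i x) = snd i' (snd f x)" if x: "x \<in> carrier (tgt X)" for x
  proof -
    have "\<ominus>\<^bsub>tgt Y'\<^esub> snd i' (snd f x) \<oplus>\<^bsub>tgt Y'\<^esub> snd f' (snd i x) = \<zero>\<^bsub>tgt Y'\<^esub>"
      using short_exact_zero[OF se(2) x] x fc ic
      by (simp add: snd_j q2 lmod_hom_minus[OF mX'(2) Ob_left_module(2)[OF Y'] Hom_component(2)[OF i']])
    then show ?thesis
      using x fc ic Hom_closed[OF f'] Hom_closed[OF i']
      by (metis tY'.M.a_inv_closed tY'.M.minus_equality tY'.M.minus_minus tY'.M.a_comm)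
  qed
  ultimately have comm: "Cmp (\<P> L) X Y Y' f' i = Cmp (\<P> L) X X' Y' i' f"
    by (subst Hom_eq_iff[OF Cmp_Hom[OF X i f'] Cmp_Hom[OF X f i']]) (simp add: component_simps)
  have univ: "\<exists>!h. h \<in> Hom (\<P> L) Y' W \<and> Cmp (\<P> L) Y Y' W h f' = u \<and> Cmp (\<P> L) X' Y' W h i' = v"
    if W: "W \<in> Ob (\<P> L)" and u: "u \<in> Hom (\<P> L) Y W" and v: "v \<in> Hom (\<P> L) X' W"
      and uv: "Cmp (\<P> L) X Y W u i = Cmp (\<P> L) X X' W v f" for W u v
  proof -
    note mW = Ob_left_module[OF W]
    interpret sW: left_module L "src W" by (rule mW)
    interpret tW: left_module L "tgt W" by (rule mW)
    have uv': "x \<in> carrier (src X) \<Longrightarrow> fst u (fst i x) = fst v (fst f x)"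
      "x \<in> carrier (tgt X) \<Longrightarrow> snd u (snd i x) = snd v (snd f x)" for x
      using uv by (metis fst_Cmp) (use uv in \<open>metis snd_Cmp\<close>)
    \<comment> \<open>The maps \<open>v\<close> and \<open>u\<close> are joined into one map out of
      the direct sum; it vanishes on \<open>j\<close> because \<open>u\<close> \<open>i\<close> =
      \<open>v\<close> \<open>f\<close>.\<close>
    define k where "k = copair_arrow X' Y W v u"
    have k: "k \<in> Hom (\<P> L) B W" unfolding k_def B_def by (rule copair_arrow_Hom[OF inf X' Y W v u])
    have k_app: "\<lbrakk>a \<in> carrier (src X'); y \<in> carrier (src Y)\<rbrakk> \<Longrightarrow> fst k (pr (a, y)) = fst v a \<oplus>\<^bsub>src W\<^esub> fst u y"
      "\<lbrakk>a \<in> carrier (tgt X'); y \<in> carrier (tgt Y)\<rbrakk> \<Longrightarrow> snd k (pr (a, y)) = snd v a \<oplus>\<^bsub>tgt W\<^esub> snd u y" for a y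
      by (simp_all add: k_def copair_arrow_def dsum_carrierI inv_pr[OF inf])
    have "Cmp (\<P> L) X B W k j = Hzero (\<P> L) X W"
      using fc ic uv' Hom_closed[OF v]
      by (simp add: Cmp_eq_Hzero_iff[OF X W j k] fst_j snd_j k_app
          lmod_hom_minus[OF mX'(1) mW(1) Hom_component(1)[OF v]]
          lmod_hom_minus[OF mX'(2) mW(2) Hom_component(2)[OF v]] sW.M.l_neg tW.M.l_neg)
    then have ex1: "\<exists>!h. h \<in> Hom (\<P> L) Y' W \<and> Cmp (\<P> L) B Y' W h q = k"
      using conflation_is_cokernel[OF conf] W k unfolding is_cokernel_def by blast
    \<comment> \<open>A map out of a direct sum is determined by its restrictions to the summands,
      so the conditions on the two legs amount to the single condition \<open>h\<close>
      \<open>q\<close> = \<open>k\<close>. Existence and uniqueness then transfer from the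
      cokernel.\<close>
    have "Cmp (\<P> L) Y Y' W h f' = u \<and> Cmp (\<P> L) X' Y' W h i' = v \<longleftrightarrow> Cmp (\<P> L) B Y' W h q = k"
      if h: "h \<in> Hom (\<P> L) Y' W" for h
    proof -
      note hh = Hom_add[OF h] Hom_zero[OF Y' W h] and zero = Hom_zero[OF X' W v] Hom_zero[OF Y W u]
      have 1: "Cmp (\<P> L) Y Y' W h f' = u \<longleftrightarrow> (\<forall>y\<in>carrier (src Y). fst h (fst f' y) = fst u y) \<and>
          (\<forall>y\<in>carrier (tgt Y). snd h (snd f' y) = snd u y)"
        by (subst Hom_eq_iff[OF Cmp_Hom[OF Y f' h] u]) (simp add: component_simps)
      have 2: "Cmp (\<P> L) X' Y' W h i' = v \<longleftrightarrow> (\<forall>y\<in>carrier (src X'). fst h (fst i' y) = fst v y) \<and>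
          (\<forall>y\<in>carrier (tgt X'). snd h (snd i' y) = snd v y)"
        by (subst Hom_eq_iff[OF Cmp_Hom[OF X' i' h] v]) (simp add: component_simps)
      have 3: "Cmp (\<P> L) B Y' W h q = k \<longleftrightarrow> (\<forall>z\<in>carrier (src B). fst h (fst q z) = fst k z) \<and>
          (\<forall>z\<in>carrier (tgt B). snd h (snd q z) = snd k z)"
        by (subst Hom_eq_iff[OF Cmp_Hom[OF B q h] k]) (simp add: component_simps)
      show ?thesis
      proof
        assume "Cmp (\<P> L) Y Y' W h f' = u \<and> Cmp (\<P> L) X' Y' W h i' = v"
        then show "Cmp (\<P> L) B Y' W h q = k"
          unfolding 1 2 3
          by (auto simp: B_def q1 q2 k_app hh Hom_closed[OF f'] Hom_closed[OF i'] elim!: dsum_carrierE)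
      next
        assume "Cmp (\<P> L) B Y' W h q = k"
        then have "\<forall>z\<in>carrier (src B). fst h (fst q z) = fst k z" "\<forall>z\<in>carrier (tgt B). snd h (snd q z) = snd k z"
          unfolding 3 by blast+
        then show "Cmp (\<P> L) Y Y' W h f' = u \<and> Cmp (\<P> L) X' Y' W h i' = v"
          unfolding 1 2
          by (simp add: f'_app i'_app B_def dsum_carrierI k_app zero Hom_closed[OF u] Hom_closed[OF v])
      qed
    qed
    then have "h \<in> Hom (\<P> L) Y' W \<and> Cmp (\<P> L) Y Y' W h f' = u \<and> Cmp (\<P> L) X' Y' W h i' = v \<longleftrightarrow>
      h \<in> Hom (\<P> L) Y' W \<and> Cmp (\<P> L) B Y' W h q = k" for h by blast
    then show ?thesis using ex1 by presburger
  qed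
  have "is_pushout (\<P> L) X Y X' Y' i f f' i'"
    unfolding is_pushout_def using i f f' i' comm univ by blast
  \<comment> \<open>The retractions of \<open>i'\<close> are produced separately in the two
    components, from \<open>r1\<close> and from \<open>r2\<close>.\<close>
  moreover have "inflation (\<P> L) X' Y' i'"
    using pushout_retraction[OF inf mX(1) mY(1) mX'(1) Ob_left_module(1)[OF Y'] Hom_component(1)[OF i] r1
        Hom_component(1)[OF f] Hom_component(1)[OF q, unfolded B_def dsum_arrow_simps]
        se(1)[unfolded B_def dsum_arrow_simps] fst_j]
      pushout_retraction[OF inf mX(2) mY(2) mX'(2) Ob_left_module(2)[OF Y'] Hom_component(2)[OF i] r2
        Hom_component(2)[OF f] Hom_component(2)[OF q, unfolded B_def dsum_arrow_simps]
        se(2)[unfolded B_def dsum_arrow_simps] snd_j]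
    using X' Y' i' by (simp add: inflation_iff i'_app)
  ultimately show ?thesis using Y' by blast
qed

text \<open>The pullback is the kernel of (\<open>d\<close>, -\<open>f\<close>) from the direct sum
  of \<open>Y\<close> and \<open>Z'\<close> to \<open>Z\<close>. Pairs with second coordinate zero
  already reach all of \<open>Z\<close>, so this map is a deflation and a conflation supplies the
  kernel with its universal property.\<close>

lemma pullback_exists:
  fixes Y :: "('a, 'b) arrow"
  assumes inf: "infinite (UNIV :: 'b set)" and defl: "deflation (\<P> L) Y Z d"
    and Z': "Z' \<in> Ob (\<P> L)" and f: "f \<in> Hom (\<P> L) Z' Z"
  shows "\<exists>Y' \<in> Ob (\<P> L). \<exists>f' d'. is_pullback (\<P> L) Y' Z' Y Z d' f' d f \<and> deflation (\<P> L) Y' Z' d'"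
proof -
  have Y: "Y \<in> Ob (\<P> L)" and Z: "Z \<in> Ob (\<P> L)" and d: "d \<in> Hom (\<P> L) Y Z"
    and surj: "fst d ` carrier (src Y) = carrier (src Z)" "snd d ` carrier (tgt Y) = carrier (tgt Z)"
    using defl by (auto simp: deflation_iff)
  note mY = Ob_left_module[OF Y] and mZ = Ob_left_module[OF Z] and mZ' = Ob_left_module[OF Z']
  interpret sY: left_module L "src Y" by (rule mY)
  interpret tY: left_module L "tgt Y" by (rule mY)
  interpret sZ: left_module L "src Z" by (rule mZ)
  interpret tZ: left_module L "tgt Z" by (rule mZ)
  interpret sZ': left_module L "src Z'" by (rule mZ')
  interpret tZ': left_module L "tgt Z'" by (rule mZ')
  note fc = Hom_closed[OF f] and dc = Hom_closed[OF d]
  note aZ' = lmod_hom_closed[OF Ob_arr[OF Z']]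
  define f_neg where "f_neg = (\<lambda>x\<in>carrier (src Z'). \<ominus>\<^bsub>src Z\<^esub> fst f x, \<lambda>x\<in>carrier (tgt Z'). \<ominus>\<^bsub>tgt Z\<^esub> snd f x)"
  have f_neg: "f_neg \<in> Hom (\<P> L) Z' Z"
    using mZ' mZ f fc aZ'
    by (auto simp: f_neg_def Hom_iff minus_lmod_hom lmod_hom_minus[OF mZ Ob_arr[OF Z]])
  define B where "B = dsum_arrow Y Z'"
  have B: "B \<in> Ob (\<P> L)" unfolding B_def by (rule dsum_arrow_Ob[OF inf Y Z'])
  define e where "e = copair_arrow Y Z' Z d f_neg"
  have e: "e \<in> Hom (\<P> L) B Z" unfolding e_def B_def by (rule copair_arrow_Hom[OF inf Y Z' Z d f_neg])
  have e_app: "\<lbrakk>y \<in> carrier (src Y); z \<in> carrier (src Z')\<rbrakk> \<Longrightarrow> fst e (pr (y, z)) = fst d y \<ominus>\<^bsub>src Z\<^esub> fst f z"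
    "\<lbrakk>y \<in> carrier (tgt Y); z \<in> carrier (tgt Z')\<rbrakk> \<Longrightarrow> snd e (pr (y, z)) = snd d y \<ominus>\<^bsub>tgt Z\<^esub> snd f z" for y z
    by (simp_all add: e_def f_neg_def copair_arrow_def dsum_carrierI inv_pr[OF inf] a_minus_def)
  have "fst e ` carrier (src B) = carrier (src Z)"
  proof (intro subset_antisym subsetI)
    fix z assume "z \<in> carrier (src Z)"
    then obtain y where "y \<in> carrier (src Y)" "z = fst d y" using surj(1) by blast
    then show "z \<in> fst e ` carrier (src B)"
      using Hom_zero(1)[OF Z' Z f] dc
      by (intro image_eqI[of _ _ "pr (y, \<zero>\<^bsub>src Z'\<^esub>)"]) (simp_all add: B_def dsum_carrierI e_app sZ.M.diff_zero)
  qed (use Hom_closed[OF e] in blast)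
  moreover have "snd e ` carrier (tgt B) = carrier (tgt Z)"
  proof (intro subset_antisym subsetI)
    fix z assume "z \<in> carrier (tgt Z)"
    then obtain y where "y \<in> carrier (tgt Y)" "z = snd d y" using surj(2) by blast
    then show "z \<in> snd e ` carrier (tgt B)"
      using Hom_zero(2)[OF Z' Z f] dc
      by (intro image_eqI[of _ _ "pr (y, \<zero>\<^bsub>tgt Z'\<^esub>)"]) (simp_all add: B_def dsum_carrierI e_app tZ.M.diff_zero)
  qed (use Hom_closed[OF e] in blast)
  ultimately have "deflation (\<P> L) B Z e" using B Z e by (simp add: deflation_iff)
  then obtain k Y' where conf: "(Y', k, B, e, Z) \<in> Confl (\<P> L)" by (auto simp: deflation_def)
  then have Y': "Y' \<in> Ob (\<P> L)" and k: "k \<in> Hom (\<P> L) Y' B"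
    and se: "lmod_short_exact (src Y') (fst k) (src B) (fst e) (src Z)"
      "lmod_short_exact (tgt Y') (snd k) (tgt B) (snd e) (tgt Z)"
    by (auto simp: Confl_iff)
  define f' where "f' = Cmp (\<P> L) Y' B Y (prl_arrow Y Z') k"
  define d' where "d' = Cmp (\<P> L) Y' B Z' (prr_arrow Y Z') k"
  have f': "f' \<in> Hom (\<P> L) Y' Y"
    unfolding f'_def by (rule Cmp_Hom[OF Y' k prl_arrow_Hom[OF inf Y Z', folded B_def]])
  have d': "d' \<in> Hom (\<P> L) Y' Z'"
    unfolding d'_def by (rule Cmp_Hom[OF Y' k prr_arrow_Hom[OF inf Y Z', folded B_def]])
  have k_app: "y \<in> carrier (src Y') \<Longrightarrow> fst k y = pr (fst f' y, fst d' y)"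
    "y \<in> carrier (tgt Y') \<Longrightarrow> snd k y = pr (snd f' y, snd d' y)" for y
    using Hom_closed[OF k, of y]
    by (auto simp: f'_def d'_def component_simps prl_arrow_def prr_arrow_def B_def pr_inv[OF inf])
  have fd: "fst d (fst f' y) = fst f (fst d' y)" if "y \<in> carrier (src Y')" for y
    using short_exact_zero[OF se(1) that] that Hom_closed[OF f'] Hom_closed[OF d'] fc dc
    by (simp add: k_app e_app sZ.M.diff_eq_zero_iff)
  have fd2: "snd d (snd f' y) = snd f (snd d' y)" if "y \<in> carrier (tgt Y')" for y
    using short_exact_zero[OF se(2) that] that Hom_closed[OF f'] Hom_closed[OF d'] fc dc
    by (simp add: k_app e_app tZ.M.diff_eq_zero_iff)
  have comm: "Cmp (\<P> L) Y' Y Z d f' = Cmp (\<P> L) Y' Z' Z f d'"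
    by (subst Hom_eq_iff[OF Cmp_Hom[OF Y' f' d] Cmp_Hom[OF Y' d' f]]) (simp add: component_simps fd fd2)
  have univ: "\<exists>!h. h \<in> Hom (\<P> L) W Y' \<and> Cmp (\<P> L) W Y' Y f' h = u \<and> Cmp (\<P> L) W Y' Z' d' h = v"
    if W: "W \<in> Ob (\<P> L)" and u: "u \<in> Hom (\<P> L) W Y" and v: "v \<in> Hom (\<P> L) W Z'"
      and uv: "Cmp (\<P> L) W Y Z d u = Cmp (\<P> L) W Z' Z f v" for W u v
  proof -
    have uv': "w \<in> carrier (src W) \<Longrightarrow> fst d (fst u w) = fst f (fst v w)"
      "w \<in> carrier (tgt W) \<Longrightarrow> snd d (snd u w) = snd f (snd v w)" for w
      using uv by (metis fst_Cmp) (use uv in \<open>metis snd_Cmp\<close>)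
    define p where "p = pair_arrow W u v"
    have p: "p \<in> Hom (\<P> L) W B" unfolding p_def B_def by (rule pair_arrow_Hom[OF inf Y Z' W u v])
    have p_app: "w \<in> carrier (src W) \<Longrightarrow> fst p w = pr (fst u w, fst v w)"
      "w \<in> carrier (tgt W) \<Longrightarrow> snd p w = pr (snd u w, snd v w)" for w
      by (simp_all add: p_def pair_arrow_def)
    have "Cmp (\<P> L) W B Z e p = Hzero (\<P> L) W Z"
      using fc dc Hom_closed[OF u] Hom_closed[OF v]
      by (simp add: Cmp_eq_Hzero_iff[OF W Z p e] p_app e_app uv' sZ.M.diff_self tZ.M.diff_self)
    then have ex1: "\<exists>!h. h \<in> Hom (\<P> L) W Y' \<and> Cmp (\<P> L) W Y' B k h = p"
      using conflation_is_kernel[OF conf] W p unfolding is_kernel_def by blast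
    \<comment> \<open>\<open>k\<close> pairs \<open>f'\<close> with \<open>d'\<close>, so the
      equation \<open>k\<close> \<open>h\<close> = \<open>p\<close> splits into its two
      coordinates.\<close>
    have "Cmp (\<P> L) W Y' Y f' h = u \<and> Cmp (\<P> L) W Y' Z' d' h = v \<longleftrightarrow> Cmp (\<P> L) W Y' B k h = p"
      if h: "h \<in> Hom (\<P> L) W Y'" for h
    proof -
      have 1: "Cmp (\<P> L) W Y' Y f' h = u \<longleftrightarrow> (\<forall>w\<in>carrier (src W). fst f' (fst h w) = fst u w) \<and>
          (\<forall>w\<in>carrier (tgt W). snd f' (snd h w) = snd u w)"
        by (subst Hom_eq_iff[OF Cmp_Hom[OF W h f'] u]) (simp add: component_simps)
      have 2: "Cmp (\<P> L) W Y' Z' d' h = v \<longleftrightarrow> (\<forall>w\<in>carrier (src W). fst d' (fst h w) = fst v w) \<and>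
          (\<forall>w\<in>carrier (tgt W). snd d' (snd h w) = snd v w)"
        by (subst Hom_eq_iff[OF Cmp_Hom[OF W h d'] v]) (simp add: component_simps)
      have 3: "Cmp (\<P> L) W Y' B k h = p \<longleftrightarrow> (\<forall>w\<in>carrier (src W). fst k (fst h w) = fst p w) \<and>
          (\<forall>w\<in>carrier (tgt W). snd k (snd h w) = snd p w)"
        by (subst Hom_eq_iff[OF Cmp_Hom[OF W h k] p]) (simp add: component_simps)
      show ?thesis
        unfolding 1 2 3 by (auto simp: k_app p_app pr_eq_iff[OF inf] Hom_closed[OF h])
    qed
    then have "h \<in> Hom (\<P> L) W Y' \<and> Cmp (\<P> L) W Y' Y f' h = u \<and> Cmp (\<P> L) W Y' Z' d' h = v \<longleftrightarrow>
      h \<in> Hom (\<P> L) W Y' \<and> Cmp (\<P> L) W Y' B k h = p" for h by blast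
    then show ?thesis using ex1 by presburger
  qed
  have "is_pullback (\<P> L) Y' Z' Y Z d' f' d f"
    unfolding is_pullback_def using d f d' f' comm univ by blast
  moreover have "fst d' ` carrier (src Y') = carrier (src Z')"
  proof (intro subset_antisym subsetI)
    fix z assume z: "z \<in> carrier (src Z')"
    \<comment> \<open>Choose y with \<open>fst d y\<close> = \<open>fst f z\<close>; the pair (y, z)
      lies in the kernel of \<open>fst e\<close>, hence comes from \<open>Y'\<close>, and
      \<open>fst d'\<close> reads off its second coordinate z.\<close>
    then have "fst f z \<in> fst d ` carrier (src Y)" using surj(1) fc by blast
    then obtain y where y: "y \<in> carrier (src Y)" "fst d y = fst f z" by force
    then have "pr (y, z) \<in> fst k ` carrier (src Y')"
      unfolding short_exact_image[OF se(1)] using z fc by (simp add: B_def dsum_carrierI e_app sZ.M.diff_self)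
    then obtain w where w: "w \<in> carrier (src Y')" "pr (y, z) = fst k w" by blast
    then have "z = fst d' w" by (simp add: k_app pr_eq_iff[OF inf])
    then show "z \<in> fst d' ` carrier (src Y')" using w by blast
  qed (use Hom_closed[OF d'] in blast)
  moreover have "snd d' ` carrier (tgt Y') = carrier (tgt Z')"
  proof (intro subset_antisym subsetI)
    fix z assume z: "z \<in> carrier (tgt Z')"
    then have "snd f z \<in> snd d ` carrier (tgt Y)" using surj(2) fc by blast
    then obtain y where y: "y \<in> carrier (tgt Y)" "snd d y = snd f z" by force
    then have "pr (y, z) \<in> snd k ` carrier (tgt Y')"
      unfolding short_exact_image[OF se(2)] using z fc by (simp add: B_def dsum_carrierI e_app tZ.M.diff_self)
    then obtain w where w: "w \<in> carrier (tgt Y')" "pr (y, z) = snd k w" by blast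
    then have "z = snd d' w" by (simp add: k_app pr_eq_iff[OF inf])
    then show "z \<in> snd d' ` carrier (tgt Y')" using w by blast
  qed (use Hom_closed[OF d'] in blast)
  ultimately show ?thesis unfolding deflation_iff using Y' Z' d' by blast
qed

lemma exact_category_proj_morphism:
  fixes L :: "('a, 'c) ring_scheme"
  assumes "ring L" "infinite (UNIV :: 'b set)"
  shows "exact_category (\<P> L :: (('a, 'b) arrow, ('b \<Rightarrow> 'b) \<times> ('b \<Rightarrow> 'b)) excat)"
proof (intro exact_category.intro exact_category_axioms.intro additive_category_proj_morphism assms)
  fix X i Y d Z assume "(X, i, Y, d, Z) \<in> Confl (\<P> L :: (('a, 'b) arrow, _) excat)"
  then show "X \<in> Ob (\<P> L) \<and> Y \<in> Ob (\<P> L) \<and> Z \<in> Ob (\<P> L)" by (simp add: Confl_iff)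
qed ((rule conflation_is_kernel conflation_is_cokernel conflation_iso inflation_Idm deflation_Idm
    inflation_compose deflation_compose pushout_exists[OF assms(2)] pullback_exists[OF assms(2)]; assumption)+)

section \<open>Projective and injective objects\<close>

lemma proj_obj_if_split_mono:
  assumes X: "X \<in> Ob (\<P> L)" and r: "r \<in> lmod_hom L (tgt X) (src X)" "\<And>x. x \<in> carrier (src X) \<Longrightarrow> r (arr X x) = x"
  shows "proj_obj (\<P> L) X"
  unfolding proj_obj_def
proof (intro conjI X allI impI ballI)
  fix Y Z d s assume defl: "deflation (\<P> L) Y Z d" and s: "s \<in> Hom (\<P> L) X Z"
  have Y: "Y \<in> Ob (\<P> L)" and Z: "Z \<in> Ob (\<P> L)" and d: "d \<in> Hom (\<P> L) Y Z"
    and surj: "fst d ` carrier (src Y) = carrier (src Z)" "snd d ` carrier (tgt Y) = carrier (tgt Z)"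
    using defl by (auto simp: deflation_iff)
  note mX = Ob_left_module[OF X] and mY = Ob_left_module[OF Y] and mZ = Ob_left_module[OF Z]
  interpret tY: left_module L "tgt Y" by (rule mY)
  interpret tZ: left_module L "tgt Z" by (rule mZ)
  have P: "fg_projective L (src X)" "fg_projective L (tgt X)" using X by (auto simp: Ob_iff)
  obtain g where g: "g \<in> lmod_hom L (src X) (src Y)" "\<And>x. x \<in> carrier (src X) \<Longrightarrow> fst d (g x) = fst s x"
    using fg_projective_lift[OF P(1) mY(1) mZ(1) Hom_component(1)[OF d] surj(1) Hom_component(1)[OF s]] by blast
  obtain h where h: "h \<in> lmod_hom L (tgt X) (tgt Y)" "\<And>x. x \<in> carrier (tgt X) \<Longrightarrow> snd d (h x) = snd s x"
    using fg_projective_lift[OF P(2) mY(2) mZ(2) Hom_component(2)[OF d] surj(2) Hom_component(2)[OF s]] by blast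
  note aX = Ob_arr[OF X] and aY = Ob_arr[OF Y]
  \<comment> \<open>The defect of the square formed by the independently chosen lifts
    \<open>g\<close> and \<open>h\<close>.\<close>
  define c where "c = (\<lambda>x\<in>carrier (src X). arr Y (g x) \<ominus>\<^bsub>tgt Y\<^esub> h (arr X x))"
  have "c = (\<lambda>x\<in>carrier (src X). compose (carrier (src X)) (arr Y) g x \<ominus>\<^bsub>tgt Y\<^esub> compose (carrier (src X)) h (arr X) x)"
    by (auto simp: c_def compose_def)
  then have c: "c \<in> lmod_hom L (src X) (tgt Y)"
    using diff_lmod_hom[OF mX(1) mY(2) compose_lmod_hom[OF mX(1) g(1) aY] compose_lmod_hom[OF mX(1) aX h(1)]]
    by simp
  \<comment> \<open>At \<open>arr X x\<close> the added term is \<open>c x\<close>, since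
    \<open>r\<close> retracts \<open>arr X\<close>: exactly what \<open>h\<close> lacks
    there.\<close>
  define g2 where "g2 = lmod_add (tgt X) (tgt Y) h (compose (carrier (tgt X)) c r)"
  have g2: "g2 \<in> lmod_hom L (tgt X) (tgt Y)"
    unfolding g2_def by (rule lmod_add_hom[OF mX(2) mY(2) h(1) compose_lmod_hom[OF mX(2) r(1) c]])
  have g2_app: "g2 y = h y \<oplus>\<^bsub>tgt Y\<^esub> c (r y)" if "y \<in> carrier (tgt X)" for y
    using that by (simp add: g2_def lmod_add_def compose_def)
  note cl = lmod_hom_closed[OF aX] lmod_hom_closed[OF aY] lmod_hom_closed[OF g(1)] lmod_hom_closed[OF h(1)]
    lmod_hom_closed[OF r(1)] lmod_hom_closed[OF c] Hom_closed[OF d] Hom_closed[OF s]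
  have "g2 (arr X x) = arr Y (g x)" if "x \<in> carrier (src X)" for x
    using that by (simp add: g2_app cl r(2)) (simp add: c_def cl tY.M.add_diff_cancel)
  then have gg: "(g, g2) \<in> Hom (\<P> L) X Y" using g(1) g2 by (simp add: Hom_iff)
  \<comment> \<open>Under \<open>snd d\<close> both terms of the defect become
    \<open>snd s (arr X x)\<close>, the first one through the squares of \<open>d\<close> and
    \<open>s\<close>. So the correction does not alter what \<open>h\<close> lifts.\<close>
  have c0: "snd d (c x) = \<zero>\<^bsub>tgt Z\<^esub>" if "x \<in> carrier (src X)" for x
    using that Hom_commute[OF s that]
    by (simp add: c_def cl lmod_hom_diff[OF mY(2) mZ(2) Hom_component(2)[OF d]] h(2) Hom_commute[OF d] g(2)
        tZ.M.diff_self lmod_hom_closed[OF Ob_arr[OF Z]])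
  have "snd d (g2 y) = snd s y" if "y \<in> carrier (tgt X)" for y
    using that by (simp add: g2_app cl Hom_add(2)[OF d] h(2) c0)
  then have "Cmp (\<P> L) X Y Z d (g, g2) = s"
    using g(2) by (subst Hom_eq_iff[OF Cmp_Hom[OF X gg d] s]) (simp add: component_simps)
  then show "\<exists>g\<in>Hom (\<P> L) X Y. Cmp (\<P> L) X Y Z d g = s" using gg by blast
qed

lemma inj_obj_if_split_epi:
  assumes I: "I \<in> Ob (\<P> L)" and s: "s \<in> lmod_hom L (tgt I) (src I)" "\<And>y. y \<in> carrier (tgt I) \<Longrightarrow> arr I (s y) = y"
  shows "inj_obj (\<P> L) I"
  unfolding inj_obj_def
proof (intro conjI I allI impI ballI)
  fix X Y i t assume infl: "inflation (\<P> L) X Y i" and t: "t \<in> Hom (\<P> L) X I"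
  have X: "X \<in> Ob (\<P> L)" and Y: "Y \<in> Ob (\<P> L)" and i: "i \<in> Hom (\<P> L) X Y"
    using infl by (auto simp: inflation_iff)
  obtain r1 r2 where r1: "r1 \<in> lmod_hom L (src Y) (src X)" "\<And>x. x \<in> carrier (src X) \<Longrightarrow> r1 (fst i x) = x"
    and r2: "r2 \<in> lmod_hom L (tgt Y) (tgt X)" "\<And>x. x \<in> carrier (tgt X) \<Longrightarrow> r2 (snd i x) = x"
    using infl unfolding inflation_iff by blast
  note mX = Ob_left_module[OF X] and mY = Ob_left_module[OF Y] and mI = Ob_left_module[OF I]
  note aX = Ob_arr[OF X] and aY = Ob_arr[OF Y] and aI = Ob_arr[OF I]
  interpret sI: left_module L "src I" by (rule mI)
  interpret tI: left_module L "tgt I" by (rule mI)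
  \<comment> \<open>\<open>h\<close> and \<open>g2\<close> extend the components of \<open>t\<close>
    through the retractions of \<open>i\<close>; only the source component \<open>h\<close> gets
    corrected.\<close>
  define h where "h = compose (carrier (src Y)) (fst t) r1"
  define g2 where "g2 = compose (carrier (tgt Y)) (snd t) r2"
  have h: "h \<in> lmod_hom L (src Y) (src I)"
    unfolding h_def by (rule compose_lmod_hom[OF mY(1) r1(1) Hom_component(1)[OF t]])
  have g2: "g2 \<in> lmod_hom L (tgt Y) (tgt I)"
    unfolding g2_def by (rule compose_lmod_hom[OF mY(2) r2(1) Hom_component(2)[OF t]])
  define c where "c = (\<lambda>y\<in>carrier (src Y). g2 (arr Y y) \<ominus>\<^bsub>tgt I\<^esub> arr I (h y))"
  have "c = (\<lambda>y\<in>carrier (src Y). compose (carrier (src Y)) g2 (arr Y) y \<ominus>\<^bsub>tgt I\<^esub> compose (carrier (src Y)) (arr I) h y)"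
    by (auto simp: c_def compose_def)
  then have c: "c \<in> lmod_hom L (src Y) (tgt I)"
    using diff_lmod_hom[OF mY(1) mI(2) compose_lmod_hom[OF mY(1) aY g2] compose_lmod_hom[OF mY(1) h aI]]
    by simp
  \<comment> \<open>Adding \<open>s\<close> after \<open>c\<close> changes the composite with
    \<open>arr I\<close> by exactly \<open>c\<close>, because \<open>arr I\<close> \<open>s\<close>
    is the identity.\<close>
  define g1 where "g1 = lmod_add (src Y) (src I) h (compose (carrier (src Y)) s c)"
  have g1: "g1 \<in> lmod_hom L (src Y) (src I)"
    unfolding g1_def by (rule lmod_add_hom[OF mY(1) mI(1) h compose_lmod_hom[OF mY(1) c s(1)]])
  have g1_app: "g1 y = h y \<oplus>\<^bsub>src I\<^esub> s (c y)" if "y \<in> carrier (src Y)" for y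
    using that by (simp add: g1_def lmod_add_def compose_def)
  note cl = lmod_hom_closed[OF aX] lmod_hom_closed[OF aY] lmod_hom_closed[OF aI] lmod_hom_closed[OF h]
    lmod_hom_closed[OF g2] lmod_hom_closed[OF s(1)] lmod_hom_closed[OF c] Hom_closed[OF i] Hom_closed[OF t]
  have "g2 (arr Y y) = arr I (g1 y)" if "y \<in> carrier (src Y)" for y
    using that by (simp add: g1_app cl lmod_hom_add[OF aI] s(2)) (simp add: c_def cl tI.M.add_diff_cancel)
  then have gg: "(g1, g2) \<in> Hom (\<P> L) Y I" using g1 g2 by (simp add: Hom_iff)
  have hi: "h (fst i x) = fst t x" if "x \<in> carrier (src X)" for x
    using that by (simp add: h_def compose_def cl r1(2))
  have g2i: "g2 (snd i x) = snd t x" if "x \<in> carrier (tgt X)" for x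
    using that by (simp add: g2_def compose_def cl r2(2))
  \<comment> \<open>\<open>t\<close> and \<open>i\<close> commute with the arrows, so the defect
    vanishes on the image of \<open>i\<close> and the corrected map still extends
    \<open>t\<close>.\<close>
  have "c (fst i x) = \<zero>\<^bsub>tgt I\<^esub>" if "x \<in> carrier (src X)" for x
    using that by (simp add: c_def cl hi Hom_commute[OF i, symmetric] g2i Hom_commute[OF t] tI.M.diff_self)
  then have "g1 (fst i x) = fst t x" if "x \<in> carrier (src X)" for x
    using that by (simp add: g1_app cl hi lmod_hom_zero[OF mI(2,1) s(1)])
  then have "Cmp (\<P> L) X Y I (g1, g2) i = t"
    using g2i by (subst Hom_eq_iff[OF Cmp_Hom[OF X i gg] t]) (simp add: component_simps)
  then show "\<exists>g\<in>Hom (\<P> L) Y I. Cmp (\<P> L) X Y I g i = t" using gg by blast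
qed

text \<open>For \<open>X\<close> = (P \<rightarrow> Q) this is, up to isomorphism, the direct sum of
  P = P and 0 \<rightarrow> Q: the first summand covers the source of \<open>X\<close>, the second
  its target.\<close>

definition cover :: "('a, 'b) arrow \<Rightarrow> ('a, 'b) arrow"
  where "cover X = \<lparr>src = src X, tgt = direct_sum (src X) (tgt X), arr = (\<lambda>x\<in>carrier (src X). pr (x, \<zero>\<^bsub>tgt X\<^esub>))\<rparr>"

definition cover_map :: "('a, 'b) arrow \<Rightarrow> ('b \<Rightarrow> 'b) \<times> ('b \<Rightarrow> 'b)"
  where "cover_map X = (\<lambda>x\<in>carrier (src X). x,
    \<lambda>z\<in>carrier (direct_sum (src X) (tgt X)). arr X (pr1 z) \<oplus>\<^bsub>tgt X\<^esub> pr2 z)"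

lemma cover_simps:
  "src (cover X) = src X" "tgt (cover X) = direct_sum (src X) (tgt X)"
  "arr (cover X) = (\<lambda>x\<in>carrier (src X). pr (x, \<zero>\<^bsub>tgt X\<^esub>))"
  by (simp_all add: cover_def)

section \<open>The canonical cover, its kernel, and embeddings into projective-injective
  objects\<close>

context
  fixes X :: "('a, 'b) arrow" and L :: "('a, 'c) ring_scheme"
  assumes inf: "infinite (UNIV :: 'b set)" and X: "X \<in> Ob (\<P> L)"
begin

interpretation sX: left_module L "src X" by (rule Ob_left_module[OF X])
interpretation tX: left_module L "tgt X" by (rule Ob_left_module[OF X])

lemma cover_Ob: "cover X \<in> Ob (\<P> L)"
  using X inf dsum_inl_hom[OF inf Ob_left_module[OF X]] by (simp add: Ob_iff cover_simps fg_projective_dsum)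

lemma proj_obj_cover: "proj_obj (\<P> L) (cover X)"
  by (rule proj_obj_if_split_mono[OF cover_Ob, of "\<lambda>z\<in>carrier (direct_sum (src X) (tgt X)). pr1 z"])
    (use dsum_pr1_hom[OF inf Ob_left_module[OF X]] in \<open>simp_all add: cover_simps dsum_carrierI inv_pr[OF inf]\<close>)

lemma deflation_cover_map: "deflation (\<P> L) (cover X) X (cover_map X)"
proof -
  note aX = Ob_arr[OF X]
  have "(\<lambda>z\<in>carrier (direct_sum (src X) (tgt X)). arr X (pr1 z) \<oplus>\<^bsub>tgt X\<^esub> (\<lambda>y\<in>carrier (tgt X). y) (pr2 z))
      = snd (cover_map X)"
    unfolding cover_map_def snd_conv by (intro restrict_ext) (auto simp: inv_pr[OF inf] elim!: dsum_carrierE)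
  then have snd: "snd (cover_map X) \<in> lmod_hom L (direct_sum (src X) (tgt X)) (tgt X)"
    using dsum_copair_hom[OF inf Ob_left_module[OF X] Ob_left_module(2)[OF X] aX id_lmod_hom[OF Ob_left_module(2)[OF X]]]
    by simp
  then have hom: "cover_map X \<in> Hom (\<P> L) (cover X) X"
    using id_lmod_hom[OF Ob_left_module(1)[OF X]] lmod_hom_closed[OF aX]
    by (simp add: Hom_iff cover_simps) (simp add: cover_map_def dsum_carrierI inv_pr[OF inf])
  have "y \<in> snd (cover_map X) ` carrier (tgt (cover X))" if "y \<in> carrier (tgt X)" for y
    using that lmod_hom_zero[OF Ob_left_module[OF X] aX]
    by (intro image_eqI[of _ _ "pr (\<zero>\<^bsub>src X\<^esub>, y)"])
      (simp_all add: cover_map_def cover_simps dsum_carrierI inv_pr[OF inf])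
  then have "snd (cover_map X) ` carrier (tgt (cover X)) = carrier (tgt X)"
    using Hom_closed(2)[OF hom] by blast
  moreover have "fst (cover_map X) ` carrier (src (cover X)) = carrier (src X)"
    by (auto simp: cover_map_def cover_simps)
  ultimately show ?thesis using X cover_Ob hom by (simp add: deflation_iff)
qed

text \<open>Lift the identity of \<open>X\<close> through its cover. The first component of the lift
  \<open>g\<close> is the identity, because that of \<open>cover_map\<close> is; commutativity then
  forces \<open>snd g\<close> to send \<open>arr X x\<close> to the pair (x, 0), from which the
  first projection recovers x.\<close>

lemma proj_obj_split_mono:
  assumes "proj_obj (\<P> L) X"
  shows "\<exists>r \<in> lmod_hom L (tgt X) (src X). \<forall>x \<in> carrier (src X). r (arr X x) = x"
proof -
  obtain g where g: "g \<in> Hom (\<P> L) X (cover X)" "Cmp (\<P> L) X (cover X) X (cover_map X) g = Idm (\<P> L) X"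
    using assms deflation_cover_map Idm_Hom[OF X] unfolding proj_obj_def by blast
  have g1: "fst g x = x" if x: "x \<in> carrier (src X)" for x
  proof -
    have "fst (cover_map X) (fst g x) = x" using x g(2) by (metis fst_Cmp fst_Idm)
    then show ?thesis using Hom_closed(1)[OF g(1) x] by (simp add: cover_map_def cover_simps)
  qed
  let ?r = "compose (carrier (tgt X)) (\<lambda>z\<in>carrier (direct_sum (src X) (tgt X)). pr1 z) (snd g)"
  have g2: "snd g \<in> lmod_hom L (tgt X) (direct_sum (src X) (tgt X))"
    using Hom_component(2)[OF g(1)] by (simp add: cover_simps)
  have "?r \<in> lmod_hom L (tgt X) (src X)"
    by (rule compose_lmod_hom[OF Ob_left_module(2)[OF X] g2 dsum_pr1_hom[OF inf Ob_left_module[OF X]]])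
  moreover have "?r (arr X x) = x" if x: "x \<in> carrier (src X)" for x
    using x lmod_hom_closed[OF Ob_arr[OF X] x] Hom_commute[OF g(1) x] g1[OF x]
    by (simp add: compose_def cover_simps dsum_carrierI inv_pr[OF inf])
  ultimately show ?thesis by blast
qed

text \<open>The kernel of the cover has trivial source, hence is projective.\<close>

lemma cover_conflation: "\<exists>K k. proj_obj (\<P> L) K \<and> (K, k, cover X, cover_map X, X) \<in> Confl (\<P> L)"
proof -
  obtain K k where conf: "(K, k, cover X, cover_map X, X) \<in> Confl (\<P> L)"
    using deflation_cover_map by (auto simp: deflation_def)
  then have K: "K \<in> Ob (\<P> L)" and se: "lmod_short_exact (src K) (fst k) (src (cover X)) (fst (cover_map X)) (src X)"
    and k: "k \<in> Hom (\<P> L) K (cover X)"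
    by (auto simp: Confl_iff)
  note mK = Ob_left_module[OF K]
  interpret sK: left_module L "src K" by (rule mK)
  \<comment> \<open>The first component of \<open>cover_map\<close> is the identity, so exactness
    makes \<open>fst k\<close> zero; being injective as well, it leaves only zero in the source of
    \<open>K\<close>.\<close>
  have "fst k x = \<zero>\<^bsub>src X\<^esub>" if "x \<in> carrier (src K)" for x
    using short_exact_zero[OF se that] Hom_closed(1)[OF k that] by (simp add: cover_map_def cover_simps)
  then have "x = \<zero>\<^bsub>src K\<^esub>" if "x \<in> carrier (src K)" for x
    using that short_exact_inj[OF se] by (simp add: inj_on_def)
  \<comment> \<open>On a trivial source the zero map is a retraction.\<close>
  then have "proj_obj (\<P> L) K"
    using K mK lmod_hom_closed[OF Ob_arr[OF K]]
    by (intro proj_obj_if_split_mono[OF K lmod_zero_hom[OF mK(2,1)]]) (auto simp: lmod_zero_def)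
  then show ?thesis using conf by blast
qed

text \<open>Projectivity of \<open>X\<close> provides the retraction \<open>r\<close> of its arrow,
  and with the identity as second retraction the map into \<open>?Q\<close> is an inflation. Its
  second component is onto, so the cokernel has trivial target, and an arrow onto a trivial module
  is split by the zero map.\<close>

lemma dominant_conflation:
  assumes "proj_obj (\<P> L) X"
  shows "\<exists>i Q d I. proj_obj (\<P> L) Q \<and> inj_obj (\<P> L) Q \<and> inj_obj (\<P> L) I \<and> (X, i, Q, d, I) \<in> Confl (\<P> L)"
proof -
  obtain r where r: "r \<in> lmod_hom L (tgt X) (src X)" "\<And>x. x \<in> carrier (src X) \<Longrightarrow> r (arr X x) = x"
    using proj_obj_split_mono[OF assms] by blast
  let ?id = "\<lambda>y\<in>carrier (tgt X). y"
  let ?Q = "\<lparr>src = tgt X, tgt = tgt X, arr = ?id\<rparr>"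
  note mX = Ob_left_module[OF X] and aX = Ob_arr[OF X]
  have id: "?id \<in> lmod_hom L (tgt X) (tgt X)" by (rule id_lmod_hom[OF mX(2)])
  have Q: "?Q \<in> Ob (\<P> L)" using X id by (simp add: Ob_iff)
  \<comment> \<open>An identity arrow is split mono and split epi at once, with itself as retraction
    and as section.\<close>
  have "proj_obj (\<P> L) ?Q" by (rule proj_obj_if_split_mono[OF Q, of ?id]) (use id in simp_all)
  moreover have "inj_obj (\<P> L) ?Q" by (rule inj_obj_if_split_epi[OF Q, of ?id]) (use id in simp_all)
  moreover have i: "(arr X, ?id) \<in> Hom (\<P> L) X ?Q"
    using aX id lmod_hom_closed[OF aX] by (simp add: Hom_iff)
  obtain d I where conf: "(X, (arr X, ?id), ?Q, d, I) \<in> Confl (\<P> L)"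
    using split_mono_conflation[OF X Q i, of r ?id] r id by auto
  then have I: "I \<in> Ob (\<P> L)" and se: "lmod_short_exact (tgt X) ?id (tgt X) (snd d) (tgt I)"
    by (auto simp: Confl_iff)
  note mI = Ob_left_module[OF I]
  have "y = \<zero>\<^bsub>tgt I\<^esub>" if "y \<in> carrier (tgt I)" for y
    using that short_exact_surj[OF se, symmetric] short_exact_zero[OF se] by auto
  then have "inj_obj (\<P> L) I"
    using I mI lmod_hom_zero[OF mI Ob_arr[OF I]]
    by (intro inj_obj_if_split_epi[OF I lmod_zero_hom[OF mI(2,1)]]) (auto simp: lmod_zero_def)
  ultimately show ?thesis using conf by blast
qed

end

theorem lemma4p3:
  fixes R :: "('r, 'c) ring_scheme" and \<Lambda> :: "('a, 'd) ring_scheme" and \<phi> :: "'r \<Rightarrow> 'a"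
  assumes "artin_algebra R \<Lambda> \<phi>"
    and "infinite (UNIV :: 'b set)" and "carrier \<Lambda> \<lesssim> (UNIV :: 'b set)"
  shows "zero_auslander
    (proj_morphism_category \<Lambda> :: (('a, 'b) arrow, ('b \<Rightarrow> 'b) \<times> ('b \<Rightarrow> 'b)) excat)"
proof -
  have "ring \<Lambda>" using assms(1) by (simp add: artin_algebra_def)
  then have "exact_category (\<P> \<Lambda> :: (('a, 'b) arrow, ('b \<Rightarrow> 'b) \<times> ('b \<Rightarrow> 'b)) excat)"
    using assms(2) by (rule exact_category_proj_morphism)
  moreover have "enough_projectives (\<P> \<Lambda> :: (('a, 'b) arrow, ('b \<Rightarrow> 'b) \<times> ('b \<Rightarrow> 'b)) excat)"
    unfolding enough_projectives_def using proj_obj_cover deflation_cover_map assms(2) by blast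
  moreover have "hereditary (\<P> \<Lambda> :: (('a, 'b) arrow, ('b \<Rightarrow> 'b) \<times> ('b \<Rightarrow> 'b)) excat)"
    unfolding hereditary_def using proj_obj_cover cover_conflation assms(2) by blast
  moreover have "dominant_dimension_ge_1 (\<P> \<Lambda> :: (('a, 'b) arrow, ('b \<Rightarrow> 'b) \<times> ('b \<Rightarrow> 'b)) excat)"
    unfolding dominant_dimension_ge_1_def
  proof (intro allI impI)
    fix P :: "('a, 'b) arrow" assume P: "proj_obj (\<P> \<Lambda>) P"
    then have "P \<in> Ob (\<P> \<Lambda>)" by (simp add: proj_obj_def)
    from dominant_conflation[OF assms(2) this P] show
      "\<exists>i Q d I. proj_obj (\<P> \<Lambda>) Q \<and> inj_obj (\<P> \<Lambda>) Q \<and> inj_obj (\<P> \<Lambda>) I \<and> (P, i, Q, d, I) \<in> Confl (\<P> \<Lambda>)" .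
  qed
  ultimately show ?thesis by (simp add: zero_auslander_def)
qed

end
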